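(* Let $d\in\mathbb{N}$ and let $\theta=(\theta_r)_{r\in\mathbb{N}}$ be a monotonically decreasing sequence of real numbers with $\lim_{r\to\infty}\theta_r=0$. Let $(X(t))_{t\in \mathbb{R}^d}$ be a measurable, stationary, $BL(\theta)$-dependent $\mathbb{R}$-valued random field such that \[ \int_{\mathbb{R}^d}| \operatorname{Cov}\big( X(0), X(t) \big)|\, dt < \infty.\] Let $(W_n)_{n\in \mathbb{N}}$ be a VH-growing sequence of subsets of $\mathbb{R}^d$. Then \[\frac{ \int_{W_n} X(t)\, dt - \mathbb{E}[X(0)]\, \lambda_d(W_n)}{\sqrt{\lambda_d(W_n)}}\to \mathcal{N}(0,\sigma^2), \quad n\to \infty,\] in distribution, where \[ \sigma^2 := \int_{\mathbb{R}^d} \operatorname{Cov}\big( X(0), X(t) \big)\, dt.\]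
   Context: $\lambda_d$ denotes Lebesgue measure on $\mathbb{R}^d$. VH-growing: a sequence $(W_n)_{n\in\mathbb{N}}$ of compact subsets of $\mathbb{R}^d$ (with $\lambda_d(W_n)>0$, so that the ratio below is defined) grows in Van Hove-sense (is VH-growing) if $\lim_{n\to\infty} \lambda_d((\operatorname{bd} W_n)+B^d)/\lambda_d(W_n)=0$, where $\operatorname{bd} W$ is the boundary of $W$, $A+B=\{a+b\mid a\in A, b\in B\}$, and $B^d$ is the closed Euclidean unit ball. Random fields: a random field $(X(t))_{t\in\mathbb{R}^d}$ is a family of random variables on a common probability space; it is measurable if $(\omega,t)\mapsto X(t)(\omega)$ is jointly measurable, and stationary if its finite-dimensional distributions are invariant under translations of $\mathbb{R}^d$. The use of $\operatorname{Cov}(X(0),X(t))$ for all $t$ (including $t=0$) presupposes $\mathbb{E}[X(0)^2]<\infty$. $BL(\theta)$-dependence: for finite $I,J\subseteq\mathbb{R}^d$ put $\operatorname{dist}(I,J)=\min\{\|x-y\|_1: x\in I, y\in J\}$, with $\|\cdot\|_1$ the $\ell_1$-norm. For a Lipschitz function $f:\mathbb{R}^n\to\mathbb{R}$ let $\operatorname{Lip}(f)=\sup\{|f(x)-f(y)|/\|x-y\|_1 : x\neq y\}$. For $\Delta>0$ let $T(\Delta)=\{(j_1/\Delta,\dots,j_d/\Delta)\mid (j_1,\dots,j_d)\in\mathbb{Z}^d\}$. For a finite set $I=\{t_1,\dots,t_n\}$ with $n=\#I$ elements, $f(X_I):=f(X(t_1),\dots,X(t_n))$ (for a fixed enumeration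 of $I$). The field $(X(t))_{t\in\mathbb{R}^d}$ is $BL(\theta)$-dependent if for every $r\in\mathbb{N}$, every real $\Delta>1$, all disjoint finite sets $I,J\subseteq T(\Delta)$ with $\operatorname{dist}(I,J)\ge r$ and all bounded Lipschitz functions $f:\mathbb{R}^{\#I}\to\mathbb{R}$, $g:\mathbb{R}^{\#J}\to\mathbb{R}$, \[\operatorname{Cov}(f(X_I),g(X_J))\le \min\{\#I,\#J\}\operatorname{Lip}(f)\operatorname{Lip}(g)\,\Delta^d\,\theta_r.\] $\mathcal{N}(0,\sigma^2)$ is the normal distribution, understood as the point mass at $0$ if $\sigma^2=0$. *)

theory Defs
  imports "HOL-Probability.Probability"
begin

section \<open>Van Hove growth\<close>

text \<open>
  Euclidean \<open>d\<close>-space is \<open>real ^ 'd\<close> with \<open>d = CARD('d)\<close>. The sum of sets is the Minkowski sum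
  from \<^theory>\<open>HOL-Library.Set_Algebras\<close>.
\<close>

definition VH_growing :: "(nat \<Rightarrow> (real ^ 'd) set) \<Rightarrow> bool" where
  "VH_growing W \<longleftrightarrow>
     (\<forall>n. compact (W n) \<and> 0 < measure lborel (W n)) \<and>
     (\<lambda>n. measure lborel (frontier (W n) + cball 0 1) / measure lborel (W n)) \<longlonglongrightarrow> 0"


section \<open>Random fields\<close>

definition covariance :: "'w measure \<Rightarrow> ('w \<Rightarrow> real) \<Rightarrow> ('w \<Rightarrow> real) \<Rightarrow> real" where
  "covariance M Y Z =
     (\<integral>\<omega>. (Y \<omega> - (\<integral>\<omega>'. Y \<omega>' \<partial>M)) * (Z \<omega> - (\<integral>\<omega>'. Z \<omega>' \<partial>M)) \<partial>M)"

definition random_field :: "'w measure \<Rightarrow> (real ^ 'd \<Rightarrow> 'w \<Rightarrow> real) \<Rightarrow> bool" where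
  "random_field M X \<longleftrightarrow> prob_space M \<and> (\<forall>t. X t \<in> borel_measurable M)"

definition measurable_field :: "'w measure \<Rightarrow> (real ^ 'd \<Rightarrow> 'w \<Rightarrow> real) \<Rightarrow> bool" where
  "measurable_field M X \<longleftrightarrow> (\<lambda>(\<omega>, t). X t \<omega>) \<in> borel_measurable (M \<Otimes>\<^sub>M borel)"

text \<open>The finite-dimensional distribution at a finite set \<open>I\<close> is a measure on the functions on \<open>I\<close>.\<close>

definition stationary_field :: "'w measure \<Rightarrow> (real ^ 'd \<Rightarrow> 'w \<Rightarrow> real) \<Rightarrow> bool" where
  "stationary_field M X \<longleftrightarrow>
     (\<forall>I h. finite I \<longrightarrow>
        distr M (Pi\<^sub>M I (\<lambda>_. borel)) (\<lambda>\<omega>. \<lambda>t\<in>I. X (t + h) \<omega>) =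
        distr M (Pi\<^sub>M I (\<lambda>_. borel)) (\<lambda>\<omega>. \<lambda>t\<in>I. X t \<omega>))"


section \<open>Dependence condition\<close>

definition l1_norm :: "real ^ 'd \<Rightarrow> real" where
  "l1_norm x = (\<Sum>i\<in>UNIV. \<bar>x $ i\<bar>)"

definition l1_set_dist :: "(real ^ 'd) set \<Rightarrow> (real ^ 'd) set \<Rightarrow> real" where
  "l1_set_dist I J = Min {l1_norm (x - y) | x y. x \<in> I \<and> y \<in> J}"

definition grid :: "real \<Rightarrow> (real ^ 'd) set" where
  "grid \<Delta> = {(\<chi> i. of_int (j $ i) / \<Delta>) | j :: int ^ 'd. True}"

text \<open>
  The number of arguments of the test functions varies inside the dependence condition, so the
  space \<open>\<real>\<^sup>n\<close> on which they live is a set of functions on \<open>{..<n}\<close>; test functions matter only there.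
\<close>

abbreviation Rn :: "nat \<Rightarrow> (nat \<Rightarrow> real) set" where
  "Rn n \<equiv> {..<n} \<rightarrow>\<^sub>E UNIV"

definition l1_dist :: "nat \<Rightarrow> (nat \<Rightarrow> real) \<Rightarrow> (nat \<Rightarrow> real) \<Rightarrow> real" where
  "l1_dist n x y = (\<Sum>i<n. \<bar>x i - y i\<bar>)"

definition lipschitz_fun :: "nat \<Rightarrow> ((nat \<Rightarrow> real) \<Rightarrow> real) \<Rightarrow> bool" where
  "lipschitz_fun n f \<longleftrightarrow> (\<exists>L. \<forall>x\<in>Rn n. \<forall>y\<in>Rn n. \<bar>f x - f y\<bar> \<le> L * l1_dist n x y)"

definition Lip :: "nat \<Rightarrow> ((nat \<Rightarrow> real) \<Rightarrow> real) \<Rightarrow> real" where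
  "Lip n f = Sup {\<bar>f x - f y\<bar> / l1_dist n x y | x y. x \<in> Rn n \<and> y \<in> Rn n \<and> x \<noteq> y}"

definition bounded_lipschitz :: "nat \<Rightarrow> ((nat \<Rightarrow> real) \<Rightarrow> real) \<Rightarrow> bool" where
  "bounded_lipschitz n f \<longleftrightarrow> bounded (f ` Rn n) \<and> lipschitz_fun n f"

text \<open>
  The vector \<open>X\<^sub>I\<close>. For finite \<open>I\<close>, \<^const>\<open>from_nat_into\<close> is a fixed enumeration of \<open>I\<close> by
  \<open>{..<card I}\<close>. The choice is irrelevant, since permuting the arguments of a bounded Lipschitz
  function changes neither its boundedness nor its Lipschitz constant.
\<close>

definition field_vec ::
    "(real ^ 'd \<Rightarrow> 'w \<Rightarrow> real) \<Rightarrow> (real ^ 'd) set \<Rightarrow> 'w \<Rightarrow> (nat \<Rightarrow> real)" where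
  "field_vec X I \<omega> = (\<lambda>i\<in>{..<card I}. X (from_nat_into I i) \<omega>)"

text \<open>
  The index \<open>r\<close> ranges over the positive integers, so \<open>\<theta> 0\<close> plays no role. The sets \<open>I\<close> and \<open>J\<close>
  are nonempty so that their distance is defined; for an empty one both sides of the inequality
  would vanish.
\<close>

definition BL_dependent ::
    "'w measure \<Rightarrow> (nat \<Rightarrow> real) \<Rightarrow> (real ^ 'd \<Rightarrow> 'w \<Rightarrow> real) \<Rightarrow> bool" where
  "BL_dependent M \<theta> X \<longleftrightarrow>
     (\<forall>r\<ge>1. \<forall>\<Delta>>1. \<forall>I J. \<forall>f g.
        I \<subseteq> grid \<Delta> \<and> J \<subseteq> grid \<Delta> \<and> finite I \<and> finite J \<and> I \<noteq> {} \<and> J \<noteq> {} \<and>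
        I \<inter> J = {} \<and> l1_set_dist I J \<ge> real r \<and>
        bounded_lipschitz (card I) f \<and> bounded_lipschitz (card J) g \<longrightarrow>
        covariance M (\<lambda>\<omega>. f (field_vec X I \<omega>)) (\<lambda>\<omega>. g (field_vec X J \<omega>))
          \<le> real (min (card I) (card J)) * Lip (card I) f * Lip (card J) g * \<Delta> ^ CARD('d) * \<theta> r)"


section \<open>Normal distribution\<close>

text \<open>Parametrised by the variance \<open>v \<ge> 0\<close>; degenerate for \<open>v = 0\<close>.\<close>

definition normal_distribution :: "real \<Rightarrow> real \<Rightarrow> real measure" where
  "normal_distribution \<mu> v =
     (if v = 0 then return borel \<mu> else density lborel (normal_density \<mu> (sqrt v)))"

end

theory Submission
  imports Defs
begin

text \<open>
  The field is cut into blocks, and the blocks are treated as if they were independent. Partition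
  \<open>\<real>\<^sup>d\<close> into cubes of side \<open>m\<close> and shrink each cube to a block of side \<open>m - r\<close>, so that different
  blocks have distance at least \<open>r\<close>. Van Hove growth means that the cubes contained in \<open>W n\<close> exhaust
  \<open>W n\<close> up to a vanishing proportion of its volume (\<open>VH_block_density\<close>). The centred integral over
  \<open>W n\<close> therefore differs from the sum of the centred block integrals by an integral over the
  corridors and the rim, whose variance is at most its volume times \<open>\<integral> |Cov (X 0, X h)| dh\<close>.

  The key point is the behaviour of the dependence condition under refinement of the grid. For the
  grid of mesh \<open>1/k\<close>, a Riemann sum is a function of the field values whose Lipschitz constant is
  \<open>k\<close> to the power \<open>- d\<close>, and a set \<open>B\<close> contains \<open>|B| k\<^sup>d\<close> grid points. In the bound
  \<open>min(#I, #J) Lip(f) Lip(g) k\<^sup>d \<theta>\<^sub>r\<close> all powers of \<open>k\<close> cancel, so it survives the limit and shows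
  that bounded Lipschitz functions of the integrals over \<open>A\<close> and \<open>B\<close> have covariance at most
  \<open>|B| \<theta>\<^sub>r\<close> times their Lipschitz constants (\<open>covariance_field_integral_le\<close>). Since only the smaller
  set enters, blocks can be split off one at a time: at the argument \<open>u / sqrt |W n|\<close>, each block
  costs \<open>4 u\<^sup>2 \<theta>\<^sub>r |B| / |W n|\<close>, and all of them together cost at most \<open>4 u\<^sup>2 \<theta>\<^sub>r\<close>
  (\<open>char_separated_union\<close>). This is small for large \<open>r\<close>, uniformly in \<open>n\<close> and \<open>m\<close>, so that
  the mere convergence of \<open>\<theta>\<close> to 0 suffices.

  Consequently \<open>m\<close> and \<open>r\<close> stay fixed while \<open>n\<close> tends to infinity, and all that is needed is the
  classical limit of the powers of one characteristic function (\<open>char_power_tendsto\<close>). The remaining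
  errors depend on \<open>m\<close> and \<open>r\<close> only (\<open>block_error\<close>), and they disappear when first \<open>m\<close> and then
  \<open>r\<close> grows, because the variance of a block integral divided by the volume of the cube tends to
  \<open>\<integral> Cov (X 0, X h) dh\<close> (\<open>variance_cube_tendsto\<close>). Levy's continuity theorem turns the convergence of
  characteristic functions into weak convergence.

  The approximation of integrals by Riemann sums needs some continuity of the field. It holds in the
  mean and follows from joint measurability and stationarity: almost every path is locally
  integrable, translation is continuous in the mean for integrable functions, and the expected
  increment between two points depends on their difference only (\<open>increment_tendsto_0\<close>).
\<close>

section \<open>Continuity of translations in the mean\<close>

lemma integrable_translate:
  fixes f :: "'a::euclidean_space \<Rightarrow> 'b::{banach, second_countable_topology}"
  assumes "integrable lborel f"
  shows "integrable lborel (\<lambda>x. f (x + h))"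
proof -
  have [measurable]: "f \<in> borel_measurable borel"
    using borel_measurable_integrable[OF assms] by simp
  have "integrable (distr lborel borel ((+) h)) f"
    using assms by (simp add: lborel_distr_plus)
  then show ?thesis
    by (subst (asm) integrable_distr_eq) (auto simp: add.commute)
qed

lemma integral_translate:
  fixes f :: "'a::euclidean_space \<Rightarrow> 'b::{banach, second_countable_topology}"
  assumes [measurable]: "f \<in> borel_measurable borel"
  shows "(\<integral>x. f (x + h) \<partial>lborel) = (\<integral>x. f x \<partial>lborel)"
proof -
  have "(\<integral>x. f x \<partial>lborel) = (\<integral>x. f x \<partial>distr lborel borel ((+) h))"
    by (simp add: lborel_distr_plus)
  also have "\<dots> = (\<integral>x. f (x + h) \<partial>lborel)"
    by (subst integral_distr) (auto simp: add.commute)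
  finally show ?thesis ..
qed

definition shift_diff :: "('a::euclidean_space \<Rightarrow> real) \<Rightarrow> 'a \<Rightarrow> real" where
  "shift_diff f h = (\<integral>x. \<bar>f (x + h) - f x\<bar> \<partial>lborel)"

text \<open>
  Translation is an isometry of \<open>L\<^sup>1\<close>, so functions that are close in \<open>L\<^sup>1\<close> have close shift
  differences, uniformly in the translation. This reduces continuity to a dense class.
\<close>

lemma shift_diff_approx:
  fixes f g :: "'a::euclidean_space \<Rightarrow> real"
  assumes [simp]: "integrable lborel f" "integrable lborel g"
  shows "shift_diff f h \<le> shift_diff g h + 2 * (\<integral>x. \<bar>f x - g x\<bar> \<partial>lborel)"
proof -
  have [measurable]: "f \<in> borel_measurable borel" "g \<in> borel_measurable borel"
    using assms[THEN borel_measurable_integrable] by auto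
  have "shift_diff f h \<le> (\<integral>x. \<bar>g (x + h) - g x\<bar> + (\<bar>f (x + h) - g (x + h)\<bar> + \<bar>f x - g x\<bar>) \<partial>lborel)"
    unfolding shift_diff_def
    using integrable_translate[OF assms(1), of h] integrable_translate[OF assms(2), of h]
    by (intro integral_mono) auto
  also have "\<dots> = shift_diff g h + ((\<integral>x. \<bar>f (x + h) - g (x + h)\<bar> \<partial>lborel) + (\<integral>x. \<bar>f x - g x\<bar> \<partial>lborel))"
    using integrable_translate[OF assms(1), of h] integrable_translate[OF assms(2), of h]
    unfolding shift_diff_def by simp
  also have "(\<integral>x. \<bar>f (x + h) - g (x + h)\<bar> \<partial>lborel) = (\<integral>x. \<bar>f x - g x\<bar> \<partial>lborel)"
    by (rule integral_translate[where f="\<lambda>x. \<bar>f x - g x\<bar>"]) auto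
  finally show ?thesis by simp
qed

lemma shift_diff_nonneg: "0 \<le> shift_diff f h"
  by (simp add: shift_diff_def)

lemma shift_diff_le:
  assumes "integrable lborel f"
  shows "shift_diff f h \<le> 2 * (\<integral>x. \<bar>f x\<bar> \<partial>lborel)"
  using shift_diff_approx[OF assms, of "\<lambda>_. 0" h] by (simp add: shift_diff_def[of "\<lambda>_. 0"])

text \<open>
  For an open set, \<open>x \<in> U\<close> implies \<open>x + h \<in> U\<close> for small \<open>h\<close>, which controls the part of \<open>U\<close> that
  leaves \<open>U\<close> under the translation. The part that enters \<open>U\<close> has the same measure, because
  translations preserve the volume of \<open>U\<close>.
\<close>

lemma shift_diff_indicator_open:
  fixes U :: "'a::euclidean_space set"
  assumes U: "open U" "emeasure lborel U < \<infinity>" and h: "h \<longlonglongrightarrow> 0"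
  shows "(\<lambda>k. shift_diff (indicator U) (h k)) \<longlonglongrightarrow> 0"
proof -
  let ?g = "indicator U :: 'a \<Rightarrow> real"
  have [measurable]: "U \<in> sets borel" using U by auto
  have int: "integrable lborel ?g" using U by auto
  \<comment> \<open>The integrals of \<open>1\<^sub>U\<close> and of its translate are equal, so the positive and the negative
    part of their difference have the same integral.\<close>
  have *: "shift_diff ?g y = 2 * (\<integral>x. ?g x * (1 - ?g (x + y)) \<partial>lborel)" for y
  proof -
    have i2: "integrable lborel (\<lambda>x. ?g x * (1 - ?g (x + y)))"
      by (rule Bochner_Integration.integrable_bound[OF int]) (auto simp: indicator_def)
    have "shift_diff ?g y = (\<integral>x. 2 * (?g x * (1 - ?g (x + y))) + (?g (x + y) - ?g x) \<partial>lborel)"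
      unfolding shift_diff_def by (intro Bochner_Integration.integral_cong) (auto simp: indicator_def)
    also have "\<dots> = 2 * (\<integral>x. ?g x * (1 - ?g (x + y)) \<partial>lborel)
        + ((\<integral>x. ?g (x + y) \<partial>lborel) - (\<integral>x. ?g x \<partial>lborel))"
      using i2 int integrable_translate[OF int, of y] by simp
    also have "(\<integral>x. ?g (x + y) \<partial>lborel) = (\<integral>x. ?g x \<partial>lborel)"
      by (rule integral_translate) auto
    finally show ?thesis by simp
  qed
  have "(\<lambda>k. \<integral>x. ?g x * (1 - ?g (x + h k)) \<partial>lborel) \<longlonglongrightarrow> integral\<^sup>L lborel (\<lambda>_::'a. 0::real)"
  proof (rule integral_dominated_convergence[where w="?g" and f="\<lambda>_. 0"
        and s="\<lambda>k x. ?g x * (1 - ?g (x + h k))"])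
    show "AE x in lborel. (\<lambda>k. ?g x * (1 - ?g (x + h k))) \<longlonglongrightarrow> 0"
    proof (intro AE_I2)
      fix x :: 'a
      show "(\<lambda>k. ?g x * (1 - ?g (x + h k))) \<longlonglongrightarrow> 0"
      proof (cases "x \<in> U")
        case True
        have "(\<lambda>k. x + h k) \<longlonglongrightarrow> x" using tendsto_add[OF tendsto_const h, of x] by simp
        then have "eventually (\<lambda>k. x + h k \<in> U) sequentially"
          using topological_tendstoD[OF _ U(1) True] by blast
        then show ?thesis
          by (intro tendsto_eventually) (auto elim!: eventually_mono simp: indicator_def)
      qed auto
    qed
  qed (use int in \<open>auto simp: indicator_def\<close>)
  then show ?thesis unfolding * by (auto intro: tendsto_mult_right_zero)
qed

text \<open>
  Indicators of open sets approximate indicators of sets of finite measure by outer regularity, and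
  these span a dense subspace of \<open>L\<^sup>1\<close>.
\<close>

proposition shift_diff_tendsto_0:
  fixes f :: "'a::euclidean_space \<Rightarrow> real"
  assumes f: "integrable lborel f" and h: "h \<longlonglongrightarrow> 0"
  shows "(\<lambda>k. shift_diff f (h k)) \<longlonglongrightarrow> 0"
proof -
  have approx: "(\<lambda>k. shift_diff f (h k)) \<longlonglongrightarrow> 0"
    if f: "integrable lborel f"
    and ex: "\<And>e. e > 0 \<Longrightarrow> \<exists>g. integrable lborel g \<and> (\<integral>x. \<bar>f x - g x\<bar> \<partial>lborel) < e \<and>
           (\<lambda>k. shift_diff g (h k)) \<longlonglongrightarrow> 0" for f :: "'a \<Rightarrow> real"
  proof (rule LIMSEQ_I)
    fix e :: real assume e: "e > 0"
    obtain g where g: "integrable lborel g" "(\<integral>x. \<bar>f x - g x\<bar> \<partial>lborel) < e/4"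
        "(\<lambda>k. shift_diff g (h k)) \<longlonglongrightarrow> 0" using ex[of "e/4"] e by auto
    obtain N where N: "\<And>k. k \<ge> N \<Longrightarrow> norm (shift_diff g (h k) - 0) < e/2"
      using LIMSEQ_D[OF g(3), of "e/2"] e by auto
    have "norm (shift_diff f (h k) - 0) < e" if "k \<ge> N" for k
    proof -
      have "0 \<le> shift_diff f (h k)" by (simp add: shift_diff_def)
      then show ?thesis using shift_diff_approx[OF f g(1), of "h k"] N[OF that] g(2) by auto
    qed
    then show "\<exists>N. \<forall>k\<ge>N. norm (shift_diff f (h k) - 0) < e" by blast
  qed
  show ?thesis using f
  proof (induction rule: integrable_induct)
    case (base A c)
    have [measurable]: "A \<in> sets borel" using base by auto
    have A: "(\<lambda>k. shift_diff (indicator A) (h k)) \<longlonglongrightarrow> 0"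
    proof (rule approx)
      show "integrable lborel (indicator A :: 'a \<Rightarrow> real)" using base by auto
      fix e :: real assume e: "e > 0"
      obtain U where U: "open U" "A \<subseteq> U" "emeasure lborel (U - A) < ennreal e"
        using outer_regular_lborel[of A e] e by auto
      have [measurable]: "U \<in> sets borel" using U by auto
      have "emeasure lborel U = emeasure lborel A + emeasure lborel (U - A)"
        using U by (subst plus_emeasure) (auto simp: Un_absorb1)
      also have "\<dots> < \<infinity>" using base(2) order.strict_trans[OF U(3) ennreal_less_top] by (simp add: ennreal_add_less_top)
      finally have fin: "emeasure lborel U < \<infinity>" .
      have "(\<integral>x. \<bar>indicator A x - indicator U x :: real\<bar> \<partial>lborel) = (\<integral>x. indicator (U - A) x \<partial>lborel)"
        using U by (intro Bochner_Integration.integral_cong) (auto simp: indicator_def)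
      also have "\<dots> = measure lborel (U - A)" by simp
      also have "\<dots> < e" 
        using U(3) emeasure_eq_ennreal_measure[of lborel "U - A"] order.strict_trans[OF U(3) ennreal_less_top]
        by (metis ennreal_less_iff measure_nonneg order_less_irrefl)
      finally have lt: "(\<integral>x. \<bar>indicator A x - indicator U x :: real\<bar> \<partial>lborel) < e" .
      show "\<exists>g. integrable lborel g \<and> (\<integral>x. \<bar>indicator A x - g x\<bar> \<partial>lborel) < e \<and>
           (\<lambda>k. shift_diff g (h k)) \<longlonglongrightarrow> 0"
        using fin lt shift_diff_indicator_open[OF U(1) fin h]
        by (intro exI[of _ "indicator U"]) auto
    qed
    have "shift_diff (\<lambda>x. indicator A x *\<^sub>R c) y = \<bar>c\<bar> * shift_diff (indicator A) y" for y
    proof -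
      have "\<bar>indicator A (x + y) *\<^sub>R c - indicator A x *\<^sub>R c\<bar>
          = \<bar>c\<bar> * \<bar>indicator A (x + y) - indicator A x\<bar>" for x
        by (auto simp: indicator_def)
      then show ?thesis unfolding shift_diff_def by simp
    qed
    then show ?case using tendsto_mult_right_zero[OF A, of "\<bar>c\<bar>"] by simp
  next
    case (add f g)
    have le: "shift_diff (\<lambda>x. f x + g x) y \<le> shift_diff f y + shift_diff g y" for y
    proof -
      note int = add(1,2) integrable_translate[OF add(1), of y] integrable_translate[OF add(2), of y]
      have "shift_diff (\<lambda>x. f x + g x) y \<le> (\<integral>x. \<bar>f (x + y) - f x\<bar> + \<bar>g (x + y) - g x\<bar> \<partial>lborel)"
        unfolding shift_diff_def using int by (intro integral_mono) auto
      also have "\<dots> = shift_diff f y + shift_diff g y"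
        unfolding shift_diff_def using int by simp
      finally show ?thesis .
    qed
    show ?case
    proof (rule tendsto_sandwich[OF _ _ tendsto_const])
      show "(\<lambda>k. shift_diff f (h k) + shift_diff g (h k)) \<longlonglongrightarrow> 0"
        using tendsto_add[OF add(3,4)] by simp
      show "\<forall>\<^sub>F k in sequentially. shift_diff (\<lambda>x. f x + g x) (h k) \<le> shift_diff f (h k) + shift_diff g (h k)"
        using le by simp
    qed (simp add: shift_diff_def)
  next
    case (lim f s)
    have conv: "(\<lambda>i. \<integral>x. \<bar>f x - s i x\<bar> \<partial>lborel) \<longlonglongrightarrow> integral\<^sup>L lborel (\<lambda>_::'a. 0::real)"
    proof (rule integral_dominated_convergence[where w="\<lambda>x. 3 * norm (f x)"])
      show "AE x in lborel. (\<lambda>i. \<bar>f x - s i x\<bar>) \<longlonglongrightarrow> 0"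
      proof (intro AE_I2)
        fix x :: 'a
        have "(\<lambda>i. \<bar>f x - s i x\<bar>) \<longlonglongrightarrow> \<bar>f x - f x\<bar>" using lim(2)[of x] by (intro tendsto_intros) auto
        then show "(\<lambda>i. \<bar>f x - s i x\<bar>) \<longlonglongrightarrow> 0" by simp
      qed
      show "AE x in lborel. norm \<bar>f x - s i x\<bar> \<le> 3 * norm (f x)" for i
        proof (intro AE_I2)
        fix x :: 'a
        have "norm (s i x) \<le> 2 * norm (f x)" using lim(3)[of x i] by simp
        then show "norm \<bar>f x - s i x\<bar> \<le> 3 * norm (f x)" by simp
      qed
    qed (use lim in auto)
    show ?case
    proof (rule approx)
      show "integrable lborel f" by fact
      fix e :: real assume e: "e > 0"
      obtain N where "\<And>i. i \<ge> N \<Longrightarrow> norm ((\<integral>x. \<bar>f x - s i x\<bar> \<partial>lborel) - integral\<^sup>L lborel (\<lambda>_::'a. 0::real)) < e"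
        using LIMSEQ_D[OF conv e] by auto
      then have "(\<integral>x. \<bar>f x - s N x\<bar> \<partial>lborel) < e" by force
      then show "\<exists>g. integrable lborel g \<and> (\<integral>x. \<bar>f x - g x\<bar> \<partial>lborel) < e \<and> (\<lambda>k. shift_diff g (h k)) \<longlonglongrightarrow> 0"
        using lim(1,5) by blast
    qed
  qed
qed

section \<open>Stationary fields with finite second moment\<close>

text \<open>
  Fubini's theorem in the form in which it is applied to random fields: uniformly bounded first
  absolute moments on a set of finite measure make the field jointly integrable there.
\<close>

lemma (in prob_space) set_integral_fubini:
  fixes Y :: "'b \<Rightarrow> 'a \<Rightarrow> real"
  assumes N: "sigma_finite_measure N"
    and meas: "(\<lambda>(\<omega>, t). Y t \<omega>) \<in> borel_measurable (M \<Otimes>\<^sub>M N)"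
    and A: "A \<in> sets N" "emeasure N A < \<infinity>"
    and bound: "\<And>t. t \<in> A \<Longrightarrow> integrable M (Y t)" "\<And>t. t \<in> A \<Longrightarrow> (\<integral>\<omega>. \<bar>Y t \<omega>\<bar> \<partial>M) \<le> c"
  shows AE_set_integrable: "AE \<omega> in M. set_integrable N A (\<lambda>t. Y t \<omega>)"
    and integrable_set_integral: "integrable M (\<lambda>\<omega>. LINT t:A|N. Y t \<omega>)"
    and set_integrable_expectation: "set_integrable N A (\<lambda>t. \<integral>\<omega>. Y t \<omega> \<partial>M)"
    and expectation_set_integral: "(\<integral>\<omega>. (LINT t:A|N. Y t \<omega>) \<partial>M) = (LINT t:A|N. (\<integral>\<omega>. Y t \<omega> \<partial>M))"
proof -
  interpret N: sigma_finite_measure N by fact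
  interpret P: pair_sigma_finite M N ..
  note [measurable] = meas A(1)
  let ?f = "\<lambda>(\<omega>, t). indicator A t *\<^sub>R Y t \<omega>"
  have m: "?f \<in> borel_measurable (M \<Otimes>\<^sub>M N)" using meas by (simp add: split_beta') measurable
  have "(\<integral>\<^sup>+z. norm (?f z) \<partial>(M \<Otimes>\<^sub>M N)) = (\<integral>\<^sup>+t. (\<integral>\<^sup>+\<omega>. norm (?f (\<omega>, t)) \<partial>M) \<partial>N)"
    using m by (intro P.nn_integral_snd[symmetric]) auto
  also have "\<dots> \<le> (\<integral>\<^sup>+t. ennreal c * indicator A t \<partial>N)"
  proof (intro nn_integral_mono)
    fix t
    show "(\<integral>\<^sup>+\<omega>. norm (?f (\<omega>, t)) \<partial>M) \<le> ennreal c * indicator A t"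
    proof (cases "t \<in> A")
      case True
      have "(\<integral>\<^sup>+\<omega>. norm (?f (\<omega>, t)) \<partial>M) = (\<integral>\<^sup>+\<omega>. \<bar>Y t \<omega>\<bar> \<partial>M)" using True by simp
      also have "\<dots> = ennreal (\<integral>\<omega>. \<bar>Y t \<omega>\<bar> \<partial>M)"
        using bound(1)[OF True] by (intro nn_integral_eq_integral) auto
      also have "\<dots> \<le> ennreal c" using bound(2)[OF True] by (rule ennreal_leI)
      finally show ?thesis using True by simp
    qed simp
  qed
  also have "\<dots> = ennreal c * emeasure N A" by (simp add: nn_integral_cmult)
  also have "\<dots> < \<infinity>" using A(2) by (simp add: ennreal_mult_less_top)
  finally have int: "integrable (M \<Otimes>\<^sub>M N) ?f" using m by (intro integrableI_bounded) auto
  show "AE \<omega> in M. set_integrable N A (\<lambda>t. Y t \<omega>)"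
    using P.AE_integrable_fst'[OF int] by (simp add: set_integrable_def)
  show "integrable M (\<lambda>\<omega>. LINT t:A|N. Y t \<omega>)"
    using P.integrable_fst'[OF int] by (simp add: set_lebesgue_integral_def)
  show "set_integrable N A (\<lambda>t. \<integral>\<omega>. Y t \<omega> \<partial>M)"
    using P.integrable_snd[OF int] by (simp add: set_integrable_def)
  show "(\<integral>\<omega>. (LINT t:A|N. Y t \<omega>) \<partial>M) = (LINT t:A|N. (\<integral>\<omega>. Y t \<omega> \<partial>M))"
    using P.Fubini_integral[OF int] by (simp add: set_lebesgue_integral_def)
qed

locale stationary_L2_field = prob_space M
  for M :: "'w measure" and X :: "real ^ 'd \<Rightarrow> 'w \<Rightarrow> real" +
  assumes measurable_field: "measurable_field M X"
    and stationary_field: "stationary_field M X"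
    and square_integrable_0: "integrable M (\<lambda>\<omega>. (X 0 \<omega>)\<^sup>2)"
begin

lemma measurable_X[measurable (raw)]:
  assumes [measurable]: "f \<in> N \<rightarrow>\<^sub>M M" "g \<in> N \<rightarrow>\<^sub>M borel"
  shows "(\<lambda>x. X (g x) (f x)) \<in> borel_measurable N"
proof -
  have "(\<lambda>x. (f x, g x)) \<in> N \<rightarrow>\<^sub>M (M \<Otimes>\<^sub>M borel)" by measurable
  from measurable_compose[OF this measurable_field[unfolded measurable_field_def]]
  show ?thesis by simp
qed

lemma random_variable_X[measurable]: "X t \<in> borel_measurable M"
  using measurable_X[of "\<lambda>x. x" M "\<lambda>_. t"] by simp

lemma distr_shift:
  assumes "finite I"
  shows "distr M (Pi\<^sub>M I (\<lambda>_. borel)) (\<lambda>\<omega>. \<lambda>t\<in>I. X (t + h) \<omega>) =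
         distr M (Pi\<^sub>M I (\<lambda>_. borel)) (\<lambda>\<omega>. \<lambda>t\<in>I. X t \<omega>)"
  using stationary_field assms unfolding stationary_field_def by blast

lemma stationary_integral:
  fixes \<phi> :: "(real ^ 'd \<Rightarrow> real) \<Rightarrow> 'e::{banach, second_countable_topology}"
  assumes "finite I" and [measurable]: "\<phi> \<in> borel_measurable (Pi\<^sub>M I (\<lambda>_. borel))"
  shows "(\<integral>\<omega>. \<phi> (\<lambda>t\<in>I. X (t + h) \<omega>) \<partial>M) = (\<integral>\<omega>. \<phi> (\<lambda>t\<in>I. X t \<omega>) \<partial>M)"
    and "integrable M (\<lambda>\<omega>. \<phi> (\<lambda>t\<in>I. X (t + h) \<omega>)) \<longleftrightarrow> integrable M (\<lambda>\<omega>. \<phi> (\<lambda>t\<in>I. X t \<omega>))"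
proof -
  have m: "(\<lambda>\<omega>. \<lambda>t\<in>I. X (t + h) \<omega>) \<in> M \<rightarrow>\<^sub>M Pi\<^sub>M I (\<lambda>_. borel)" for h
    by (intro measurable_restrict) simp
  have m0: "(\<lambda>\<omega>. \<lambda>t\<in>I. X t \<omega>) \<in> M \<rightarrow>\<^sub>M Pi\<^sub>M I (\<lambda>_. borel)"
    by (intro measurable_restrict) simp
  show "(\<integral>\<omega>. \<phi> (\<lambda>t\<in>I. X (t + h) \<omega>) \<partial>M) = (\<integral>\<omega>. \<phi> (\<lambda>t\<in>I. X t \<omega>) \<partial>M)"
    using integral_distr[OF m[of h] assms(2)] integral_distr[OF m0 assms(2)] distr_shift[OF assms(1), of h]
    by simp
  show "integrable M (\<lambda>\<omega>. \<phi> (\<lambda>t\<in>I. X (t + h) \<omega>)) \<longleftrightarrow> integrable M (\<lambda>\<omega>. \<phi> (\<lambda>t\<in>I. X t \<omega>))"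
    using integrable_distr_eq[OF m[of h] assms(2)] integrable_distr_eq[OF m0 assms(2)] distr_shift[OF assms(1), of h]
    by simp
qed

text \<open>
  Shifting by \<open>- s\<close> moves a pair of sites to the origin and their difference.
\<close>

lemma stationary_pair:
  fixes \<psi> :: "real \<Rightarrow> real \<Rightarrow> 'e::{banach, second_countable_topology}"
  assumes [measurable]: "case_prod \<psi> \<in> borel_measurable (borel \<Otimes>\<^sub>M borel)"
  shows "(\<integral>\<omega>. \<psi> (X s \<omega>) (X t \<omega>) \<partial>M) = (\<integral>\<omega>. \<psi> (X 0 \<omega>) (X (t - s) \<omega>) \<partial>M)"
    and "integrable M (\<lambda>\<omega>. \<psi> (X s \<omega>) (X t \<omega>)) \<longleftrightarrow> integrable M (\<lambda>\<omega>. \<psi> (X 0 \<omega>) (X (t - s) \<omega>))"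
proof -
  have m: "(\<lambda>x. \<psi> (x 0) (x (t - s))) \<in> borel_measurable (Pi\<^sub>M {0, t - s} (\<lambda>_. borel))"
  proof -
    have "(\<lambda>x. (x 0, x (t - s))) \<in> Pi\<^sub>M {0, t - s} (\<lambda>_. borel) \<rightarrow>\<^sub>M (borel \<Otimes>\<^sub>M borel :: (real \<times> real) measure)"
      by (intro measurable_Pair measurable_component_singleton) auto
    from measurable_compose[OF this assms] show ?thesis by simp
  qed
  show "(\<integral>\<omega>. \<psi> (X s \<omega>) (X t \<omega>) \<partial>M) = (\<integral>\<omega>. \<psi> (X 0 \<omega>) (X (t - s) \<omega>) \<partial>M)"
    using stationary_integral(1)[OF _ m, of s] by simp
  show "integrable M (\<lambda>\<omega>. \<psi> (X s \<omega>) (X t \<omega>)) \<longleftrightarrow> integrable M (\<lambda>\<omega>. \<psi> (X 0 \<omega>) (X (t - s) \<omega>))"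
    using stationary_integral(2)[OF _ m, of s] by simp
qed

lemma stationary_single:
  fixes \<psi> :: "real \<Rightarrow> 'e::{banach, second_countable_topology}"
  assumes [measurable]: "\<psi> \<in> borel_measurable borel"
  shows "(\<integral>\<omega>. \<psi> (X t \<omega>) \<partial>M) = (\<integral>\<omega>. \<psi> (X 0 \<omega>) \<partial>M)"
    and "integrable M (\<lambda>\<omega>. \<psi> (X t \<omega>)) \<longleftrightarrow> integrable M (\<lambda>\<omega>. \<psi> (X 0 \<omega>))"
  using stationary_pair[of "\<lambda>x _. \<psi> x" t t] by simp_all

abbreviation mean :: real where "mean \<equiv> (\<integral>\<omega>. X 0 \<omega> \<partial>M)"

lemma square_integrable_X: "integrable M (\<lambda>\<omega>. (X t \<omega>)\<^sup>2)"
  using stationary_single(2)[of "\<lambda>x. x\<^sup>2" t] square_integrable_0 by simp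

lemma integrable_X[simp]: "integrable M (X t)"
  using square_integrable_imp_integrable[OF _ square_integrable_X] by simp

lemma mean_X: "(\<integral>\<omega>. X t \<omega> \<partial>M) = mean"
  using stationary_single(1)[of "\<lambda>x. x" t] by simp

definition centered :: "real ^ 'd \<Rightarrow> 'w \<Rightarrow> real" where "centered t \<omega> = X t \<omega> - mean"

lemma measurable_centered[measurable (raw)]:
  assumes [measurable]: "f \<in> N \<rightarrow>\<^sub>M M" "g \<in> N \<rightarrow>\<^sub>M borel"
  shows "(\<lambda>x. centered (g x) (f x)) \<in> borel_measurable N"
  unfolding centered_def by measurable

lemma random_variable_centered[measurable]: "centered t \<in> borel_measurable M"
  using measurable_centered[of "\<lambda>x. x" M "\<lambda>_. t"] by simp

lemma integrable_centered[simp]: "integrable M (centered t)"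
  and mean_centered[simp]: "(\<integral>\<omega>. centered t \<omega> \<partial>M) = 0"
  unfolding centered_def using mean_X[of t] by (simp_all add: prob_space)

lemma square_integrable_centered: "integrable M (\<lambda>\<omega>. (centered t \<omega>)\<^sup>2)"
  unfolding centered_def power2_diff using square_integrable_X by simp

definition autocov :: "real ^ 'd \<Rightarrow> real" where "autocov t = covariance M (X 0) (X t)"

lemma autocov_eq: "(\<integral>\<omega>. centered s \<omega> * centered t \<omega> \<partial>M) = autocov (t - s)"
  using stationary_pair(1)[of "\<lambda>x y. (x - mean) * (y - mean)" s t] mean_X[of "t - s"]
  unfolding autocov_def covariance_def centered_def by simp

lemma abs_centered_mult_le: "\<bar>centered s \<omega> * centered t \<omega>\<bar> \<le> (centered s \<omega>)\<^sup>2 + (centered t \<omega>)\<^sup>2"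
proof -
  have "2 * (\<bar>centered s \<omega>\<bar> * \<bar>centered t \<omega>\<bar>) \<le> (centered s \<omega>)\<^sup>2 + (centered t \<omega>)\<^sup>2"
    using sum_squares_bound[of "\<bar>centered s \<omega>\<bar>" "\<bar>centered t \<omega>\<bar>"] by (simp add: mult.assoc)
  moreover have "0 \<le> \<bar>centered s \<omega>\<bar> * \<bar>centered t \<omega>\<bar>" by simp
  ultimately show ?thesis unfolding abs_mult by linarith
qed

lemma integrable_centered_mult: "integrable M (\<lambda>\<omega>. centered s \<omega> * centered t \<omega>)"
proof (rule Bochner_Integration.integrable_bound[where f="\<lambda>\<omega>. (centered s \<omega>)\<^sup>2 + (centered t \<omega>)\<^sup>2"])
  show "AE \<omega> in M. norm (centered s \<omega> * centered t \<omega>) \<le> norm ((centered s \<omega>)\<^sup>2 + (centered t \<omega>)\<^sup>2)"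
    using abs_centered_mult_le[of s _ t] by (intro AE_I2) fastforce
qed (auto simp: square_integrable_centered)

lemma measurable_autocov[measurable]: "autocov \<in> borel_measurable borel"
proof -
  have "(\<lambda>t. \<integral>\<omega>. centered 0 \<omega> * centered t \<omega> \<partial>M) \<in> borel_measurable borel"
    by (rule borel_measurable_lebesgue_integral) measurable
  then show ?thesis by (simp add: autocov_eq)
qed

definition increment :: "real ^ 'd \<Rightarrow> real" where "increment h = (\<integral>\<omega>. \<bar>X h \<omega> - X 0 \<omega>\<bar> \<partial>M)"

lemma increment_eq: "(\<integral>\<omega>. \<bar>X t \<omega> - X s \<omega>\<bar> \<partial>M) = increment (t - s)"
  unfolding increment_def using stationary_pair(1)[of "\<lambda>x y. \<bar>y - x\<bar>" s t] by simp

lemma increment_nonneg: "0 \<le> increment h" unfolding increment_def by simp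

lemma increment_bound: "increment h \<le> 2 * (\<integral>\<omega>. \<bar>X 0 \<omega>\<bar> \<partial>M)"
proof -
  have "increment h \<le> (\<integral>\<omega>. \<bar>X h \<omega>\<bar> + \<bar>X 0 \<omega>\<bar> \<partial>M)"
    unfolding increment_def by (intro integral_mono) auto
  also have "\<dots> = 2 * (\<integral>\<omega>. \<bar>X 0 \<omega>\<bar> \<partial>M)"
    using stationary_single(1)[of abs h] by simp
  finally show ?thesis .
qed

lemma measurable_increment[measurable]: "increment \<in> borel_measurable borel"
  unfolding increment_def by (rule borel_measurable_lebesgue_integral) measurable

text \<open>
  Continuity in the mean. Almost every path, restricted to a ball of radius 2, is integrable, so its
  shift difference tends to 0; by dominated convergence the same holds for the expectation. That
  expectation dominates the integral of \<open>E |X (t + h) - X t|\<close> over the unit ball, where the integrand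
  does not depend on \<open>t\<close>.
\<close>

proposition increment_tendsto_0:
  assumes h: "h \<longlonglongrightarrow> 0"
  shows "(\<lambda>k. increment (h k)) \<longlonglongrightarrow> 0"
proof -
  define f where "f \<omega> t = indicator (cball 0 2) t *\<^sub>R X t \<omega>" for \<omega> t
  let ?v = "measure lborel (cball (0 :: real ^ 'd) 1)"
  have v: "?v > 0"
    by (simp add: content_cball_pos)
  have mf[measurable (raw)]: "(\<lambda>x. f (p x) (q x)) \<in> borel_measurable N"
    if p: "p \<in> N \<rightarrow>\<^sub>M M" and q: "q \<in> N \<rightarrow>\<^sub>M borel" for N :: "'n measure" and p q
  proof -
    have "(indicator (cball 0 2) :: real ^ 'd \<Rightarrow> real) \<in> borel_measurable borel"
      by (intro borel_measurable_indicator borel_closed closed_cball)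
    from measurable_compose[OF q this] show ?thesis
      unfolding f_def by (intro borel_measurable_scaleR measurable_X p q)
  qed
  have sd: "(\<lambda>\<omega>. shift_diff (f \<omega>) y) \<in> borel_measurable M" for y
    unfolding shift_diff_def
    by (rule lborel.borel_measurable_lebesgue_integral) (simp add: split_beta')
  have jm: "(\<lambda>(\<omega>, t). X t \<omega>) \<in> borel_measurable (M \<Otimes>\<^sub>M lborel)"
    by (simp add: split_beta') measurable
  have fin: "emeasure lborel (cball (0 :: real ^ 'd) r) < \<infinity>" for r
    by (rule emeasure_lborel_cball_finite)
  define c where "c = (\<integral>\<omega>. \<bar>X 0 \<omega>\<bar> \<partial>M)"
  have abs_eq: "(\<integral>\<omega>. \<bar>X t \<omega>\<bar> \<partial>M) = c" for t
    using stationary_single(1)[of abs t] by (simp add: c_def)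
  have ae: "AE \<omega> in M. integrable lborel (f \<omega>)"
    unfolding f_def set_integrable_def[symmetric]
    by (rule AE_set_integrable[OF lborel.sigma_finite_measure_axioms jm _ fin[of 2],
          of c]) (auto simp: abs_eq)
  have jm': "(\<lambda>(\<omega>, t). \<bar>X t \<omega>\<bar>) \<in> borel_measurable (M \<Otimes>\<^sub>M lborel)"
    by (simp add: split_beta') measurable
  have "integrable M (\<lambda>\<omega>. LINT t:cball 0 2|lborel. \<bar>X t \<omega>\<bar>)"
    by (rule integrable_set_integral[OF lborel.sigma_finite_measure_axioms jm' _ fin[of 2],
          of c]) (auto simp: abs_eq)
  then have w: "integrable M (\<lambda>\<omega>. 2 * (\<integral>t. \<bar>f \<omega> t\<bar> \<partial>lborel))"
    unfolding f_def set_lebesgue_integral_def by (simp add: abs_mult)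
  have D: "(\<lambda>k. \<integral>\<omega>. shift_diff (f \<omega>) (h k) \<partial>M) \<longlonglongrightarrow> (\<integral>\<omega>. 0 \<partial>M)"
  proof (rule integral_dominated_convergence[OF _ _ w])
    show "AE \<omega> in M. (\<lambda>k. shift_diff (f \<omega>) (h k)) \<longlonglongrightarrow> 0"
      using ae by eventually_elim (rule shift_diff_tendsto_0[OF _ h])
    show "(\<lambda>\<omega>. shift_diff (f \<omega>) (h k)) \<in> borel_measurable M" for k
      by (rule sd)
    show "AE \<omega> in M. norm (shift_diff (f \<omega>) (h k)) \<le> 2 * (\<integral>t. \<bar>f \<omega> t\<bar> \<partial>lborel)" for k
      using ae
    proof eventually_elim
      fix \<omega> assume f: "integrable lborel (f \<omega>)"
      show "norm (shift_diff (f \<omega>) (h k)) \<le> 2 * (\<integral>t. \<bar>f \<omega> t\<bar> \<partial>lborel)"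
        using shift_diff_le[OF f] by (simp add: shift_diff_nonneg)
    qed
  qed simp
  \<comment> \<open>If \<open>|t| \<le> 1\<close> and \<open>|y| \<le> 1\<close>, then \<open>t\<close> and \<open>t + y\<close> both lie in the ball of radius 2, so the
    truncation in \<open>f\<close> does not affect the increment there.\<close>
  have le: "increment y * ?v \<le> (\<integral>\<omega>. shift_diff (f \<omega>) y \<partial>M)" if y: "norm y \<le> 1" for y
  proof -
    have jm2: "(\<lambda>(\<omega>, t). \<bar>X (t + y) \<omega> - X t \<omega>\<bar>) \<in> borel_measurable (M \<Otimes>\<^sub>M lborel)"
      by (simp add: split_beta') measurable
    note fub = lborel.sigma_finite_measure_axioms jm2 _ fin[of 1] 
    have i1: "integrable M (\<lambda>\<omega>. LINT t:cball 0 1|lborel. \<bar>X (t + y) \<omega> - X t \<omega>\<bar>)"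
      by (rule integrable_set_integral[OF fub, of "increment y"]) (auto simp: increment_eq)
    have ae1: "AE \<omega> in M. set_integrable lborel (cball 0 1) (\<lambda>t. \<bar>X (t + y) \<omega> - X t \<omega>\<bar>)"
      by (rule AE_set_integrable[OF fub, of "increment y"]) (auto simp: increment_eq)
    have e1: "(\<integral>\<omega>. (LINT t:cball 0 1|lborel. \<bar>X (t + y) \<omega> - X t \<omega>\<bar>) \<partial>M)
        = (LINT t:cball (0::real^'d) 1|lborel. (\<integral>\<omega>. \<bar>X (t + y) \<omega> - X t \<omega>\<bar> \<partial>M))"
      by (rule expectation_set_integral[OF fub, of "increment y"]) (auto simp: increment_eq)
    have "increment y * ?v = (LINT t:cball (0::real^'d) 1|lborel. (\<integral>\<omega>. \<bar>X (t + y) \<omega> - X t \<omega>\<bar> \<partial>M))"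
      by (simp add: increment_eq set_integral_const set_lebesgue_integral_def)
    also have "\<dots> = (\<integral>\<omega>. (LINT t:cball 0 1|lborel. \<bar>X (t + y) \<omega> - X t \<omega>\<bar>) \<partial>M)"
      by (rule e1[symmetric])
    also have "\<dots> \<le> (\<integral>\<omega>. shift_diff (f \<omega>) y \<partial>M)"
    proof (rule integral_mono_AE[OF i1])
      show "AE \<omega> in M. (LINT t:cball 0 1|lborel. \<bar>X (t + y) \<omega> - X t \<omega>\<bar>) \<le> shift_diff (f \<omega>) y"
        using ae ae1
      proof eventually_elim
        fix \<omega> assume f: "integrable lborel (f \<omega>)"
          and s: "set_integrable lborel (cball 0 1) (\<lambda>t. \<bar>X (t + y) \<omega> - X t \<omega>\<bar>)"
        show "(LINT t:cball 0 1|lborel. \<bar>X (t + y) \<omega> - X t \<omega>\<bar>) \<le> shift_diff (f \<omega>) y"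
          unfolding set_lebesgue_integral_def shift_diff_def
        proof (rule integral_mono)
          show "integrable lborel (\<lambda>x. \<bar>f \<omega> (x + y) - f \<omega> x\<bar>)"
            using f integrable_translate[OF f, of y] by simp
          fix x :: "real ^ 'd"
          have "norm (x + y) \<le> 2" if "norm x \<le> 1"
            using norm_triangle_ineq[of x y] that y by linarith
          then show "indicator (cball 0 1) x *\<^sub>R \<bar>X (x + y) \<omega> - X x \<omega>\<bar> \<le> \<bar>f \<omega> (x + y) - f \<omega> x\<bar>"
            by (auto simp: f_def indicator_def)
        qed (use s in \<open>simp add: set_integrable_def\<close>)
      qed
      show "integrable M (\<lambda>\<omega>. shift_diff (f \<omega>) y)"
      proof (rule Bochner_Integration.integrable_bound[OF w])
        show "(\<lambda>\<omega>. shift_diff (f \<omega>) y) \<in> borel_measurable M"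
          by (rule sd)
        show "AE \<omega> in M. norm (shift_diff (f \<omega>) y) \<le> norm (2 * (\<integral>t. \<bar>f \<omega> t\<bar> \<partial>lborel))"
          using ae
        proof eventually_elim
          fix \<omega> assume f: "integrable lborel (f \<omega>)"
          show "norm (shift_diff (f \<omega>) y) \<le> norm (2 * (\<integral>t. \<bar>f \<omega> t\<bar> \<partial>lborel))"
            using shift_diff_le[OF f] by (simp add: shift_diff_nonneg)
        qed
      qed
    qed
    finally show ?thesis .
  qed
  have "eventually (\<lambda>k. norm (h k) < 1) sequentially"
    using order_tendstoD(2)[OF tendsto_norm_zero[OF h], of 1] by simp
  then have ev: "eventually (\<lambda>k. increment (h k) * ?v \<le> (\<integral>\<omega>. shift_diff (f \<omega>) (h k) \<partial>M)) sequentially"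
    by eventually_elim (intro le, simp)
  have "(\<lambda>k. increment (h k) * ?v) \<longlonglongrightarrow> 0"
  proof (rule tendsto_sandwich[OF _ ev tendsto_const])
    show "(\<lambda>k. \<integral>\<omega>. shift_diff (f \<omega>) (h k) \<partial>M) \<longlonglongrightarrow> 0" using D by simp
  qed (auto simp: increment_nonneg v less_imp_le)
  from tendsto_mult_right[OF this, of "inverse ?v"] v show ?thesis by (simp add: field_simps)
qed

end

section \<open>Riemann sums\<close>

lemma bounded_fmeasurable:
  fixes A :: "'a::euclidean_space set"
  shows "bounded A \<Longrightarrow> A \<in> sets borel \<Longrightarrow> A \<in> fmeasurable lborel"
  using emeasure_bounded_finite[of A] by (simp add: fmeasurable_def)

definition half_open_box :: "real ^ 'd \<Rightarrow> real ^ 'd \<Rightarrow> (real ^ 'd) set" where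
  "half_open_box a b = {x. \<forall>i. a $ i \<le> x $ i \<and> x $ i < b $ i}"

lemma half_open_box_sets[measurable]: "half_open_box a b \<in> sets borel"
  and half_open_box_measure: "(\<And>i. a $ i \<le> b $ i) \<Longrightarrow> measure lborel (half_open_box a b) = (\<Prod>i\<in>UNIV. b $ i - a $ i)"
proof -
  show [measurable]: "half_open_box a b \<in> sets borel" unfolding half_open_box_def by measurable
  assume le: "\<And>i. a $ i \<le> b $ i"
  have bas: "a \<bullet> e \<le> b \<bullet> e" if "e \<in> Basis" for e
    using that le by (auto simp: Basis_vec_def inner_axis)
  have sub: "box a b \<subseteq> half_open_box a b" "half_open_box a b \<subseteq> cbox a b"
    by (auto simp: half_open_box_def mem_box_cart less_imp_le)
  have fin: "emeasure lborel (cbox a b) < \<infinity>" by (rule emeasure_lborel_cbox_finite)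
  have fin': "emeasure lborel (half_open_box a b) < \<infinity>"
    using emeasure_mono[OF sub(2), of lborel] fin by (simp add: order.strict_trans1)
  have "measure lborel (half_open_box a b) \<le> measure lborel (cbox a b)"
    using fin by (intro measure_mono_fmeasurable sub) (auto simp: fmeasurable_def)
  moreover have "measure lborel (box a b) \<le> measure lborel (half_open_box a b)"
    using fin' by (intro measure_mono_fmeasurable sub) (auto simp: fmeasurable_def)
  moreover have "measure lborel (box a b) = measure lborel (cbox a b)"
    using bas by (simp add: measure_lborel_box measure_lborel_cbox)
  moreover have "cbox a b \<noteq> {}" using le by (simp add: interval_ne_empty_cart)
  then have "measure lborel (cbox a b) = (\<Prod>i\<in>UNIV. b $ i - a $ i)"
    by (rule content_cbox_cart)
  ultimately show "measure lborel (half_open_box a b) = (\<Prod>i\<in>UNIV. b $ i - a $ i)" by simp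
qed

lemma bounded_half_open_box: "bounded (half_open_box a b)"
  by (rule bounded_subset[OF bounded_cbox[of a b]]) (auto simp: half_open_box_def mem_box_cart less_imp_le)

definition grid_floor :: "nat \<Rightarrow> real ^ 'd \<Rightarrow> real ^ 'd" where
  "grid_floor k t = (\<chi> i. of_int \<lfloor>real k * t $ i\<rfloor> / real k)"

text \<open>
  A set is aligned if it is a union of unit cells with integer corners. Then it is also a union of
  cells of every finer grid of mesh \<open>1/k\<close>, which makes Riemann sums over it exact integrals of step
  functions.
\<close>

definition aligned :: "(real ^ 'd) set \<Rightarrow> bool" where
  "aligned B \<longleftrightarrow> (\<forall>t. grid_floor 1 t \<in> B \<longleftrightarrow> t \<in> B)"

lemma aligned_Union: "(\<And>z. z \<in> S \<Longrightarrow> aligned (B z)) \<Longrightarrow> aligned (\<Union>z\<in>S. B z)"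
  unfolding aligned_def by blast

lemma grid_floor_grid: "grid_floor k t \<in> grid (real k)"
  unfolding grid_floor_def grid_def by (auto intro!: exI[of _ "\<chi> i. \<lfloor>real k * t $ i\<rfloor>"])

lemma measurable_grid_floor[measurable]: "grid_floor k \<in> borel \<rightarrow>\<^sub>M borel"
proof -
  have "(\<lambda>t. grid_floor k t \<bullet> b) \<in> borel_measurable borel" if "b \<in> Basis" for b :: "real ^ 'd"
  proof -
    obtain i where b: "b = axis i 1" using \<open>b \<in> Basis\<close> by (auto simp: Basis_vec_def)
    have "(\<lambda>t :: real ^ 'd. of_int \<lfloor>real k * t $ i\<rfloor> / real k) \<in> borel_measurable borel" by measurable
    then show ?thesis by (simp add: b inner_axis grid_floor_def)
  qed
  then show ?thesis by (subst borel_measurable_euclidean_space) blast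
qed

lemma grid_floor_eq_iff:
  assumes k: "k \<ge> 1" and g: "(g :: real ^ 'd) \<in> grid (real k)"
  shows "grid_floor k t = g \<longleftrightarrow> t \<in> half_open_box g (\<chi> i. g $ i + 1 / real k)"
proof -
  obtain j :: "int ^ 'd" where j: "g = (\<chi> i. of_int (j $ i) / real k)"
    using g by (auto simp: grid_def)
  have "grid_floor k t = g \<longleftrightarrow> (\<forall>i. \<lfloor>real k * t $ i\<rfloor> = j $ i)"
    using k by (auto simp: grid_floor_def j vec_eq_iff)
  also have "\<dots> \<longleftrightarrow> (\<forall>i. of_int (j $ i) \<le> real k * t $ i \<and> real k * t $ i < of_int (j $ i) + 1)"
    by (simp add: floor_eq_iff)
  also have "\<dots> \<longleftrightarrow> t \<in> half_open_box g (\<chi> i. g $ i + 1 / real k)"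
    using k by (auto simp: half_open_box_def j field_simps)
  finally show ?thesis .
qed

lemma measure_grid_cell:
  assumes k: "k \<ge> 1" and g: "(g :: real ^ 'd) \<in> grid (real k)"
  shows "measure lborel {t. grid_floor k t = g} = 1 / real k ^ CARD('d)"
proof -
  have "{t. grid_floor k t = g} = half_open_box g (\<chi> i. g $ i + 1 / real k)"
    using grid_floor_eq_iff[OF k g] by auto
  then show ?thesis by (simp add: half_open_box_measure power_one_over)
qed

lemma grid_floor_1_grid_floor:
  assumes k: "k \<ge> 1"
  shows "grid_floor 1 (grid_floor k t) = grid_floor 1 t"
proof -
  have "\<lfloor>of_int \<lfloor>real k * x\<rfloor> / real k\<rfloor> = \<lfloor>x\<rfloor>" for x :: real
  proof (rule floor_unique)
    have "of_int (int k * \<lfloor>x\<rfloor>) \<le> real k * x"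
      using mult_left_mono[OF of_int_floor_le[of x], of "real k"] by simp
    then have "int k * \<lfloor>x\<rfloor> \<le> \<lfloor>real k * x\<rfloor>" by (simp only: le_floor_iff)
    then have "real_of_int (int k * \<lfloor>x\<rfloor>) \<le> of_int \<lfloor>real k * x\<rfloor>" by (simp only: of_int_le_iff)
    then show "of_int \<lfloor>x\<rfloor> \<le> of_int \<lfloor>real k * x\<rfloor> / real k"
      using k by (simp add: field_simps)
    have "of_int \<lfloor>real k * x\<rfloor> / real k \<le> x"
      using k of_int_floor_le[of "real k * x"] by (simp add: field_simps)
    then show "of_int \<lfloor>real k * x\<rfloor> / real k < of_int \<lfloor>x\<rfloor> + 1"
      using real_of_int_floor_add_one_gt[of x] by linarith
  qed
  then show ?thesis by (simp add: grid_floor_def vec_eq_iff)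
qed

lemma aligned_grid_floor: "aligned B \<Longrightarrow> k \<ge> 1 \<Longrightarrow> grid_floor k t \<in> B \<longleftrightarrow> t \<in> B"
  using grid_floor_1_grid_floor unfolding aligned_def by metis

lemma norm_diff_grid_floor:
  fixes t :: "real ^ 'd"
  assumes k: "k \<ge> 1"
  shows "norm (t - grid_floor k t) \<le> CARD('d) / real k"
proof -
  have "\<bar>(t - grid_floor k t) $ i\<bar> \<le> 1 / real k" for i
  proof -
    have "\<bar>real k * t $ i - of_int \<lfloor>real k * t $ i\<rfloor>\<bar> \<le> 1"
      by linarith
    then have "\<bar>real k * ((t - grid_floor k t) $ i)\<bar> \<le> 1"
      using k by (simp add: grid_floor_def right_diff_distrib)
    then have "real k * \<bar>(t - grid_floor k t) $ i\<bar> \<le> 1" unfolding abs_mult by simp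
    then show ?thesis using k by (simp add: pos_le_divide_eq mult.commute)
  qed
  then have "(\<Sum>i\<in>UNIV. \<bar>(t - grid_floor k t) $ i\<bar>) \<le> (\<Sum>i\<in>(UNIV::'d set). 1 / real k)"
    by (intro sum_mono) simp
  then show ?thesis using norm_le_l1_cart[of "t - grid_floor k t"] by simp
qed

lemma grid_floor_tendsto:
  fixes t :: "real ^ 'd"
  shows "(\<lambda>k. t - grid_floor k t) \<longlonglongrightarrow> 0"
proof (rule Lim_null_comparison)
  show "\<forall>\<^sub>F k in sequentially. norm (t - grid_floor k t) \<le> CARD('d) / real k"
    using eventually_ge_at_top[of 1] by eventually_elim (rule norm_diff_grid_floor)
qed real_asymp

lemma finite_grid_Int:
  fixes B :: "(real ^ 'd) set"
  assumes k: "k \<ge> 1" and B: "bounded B"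
  shows "finite (grid (real k) \<inter> B)"
proof -
  obtain b where b: "\<And>x. x \<in> B \<Longrightarrow> norm x \<le> b" using B by (auto simp: bounded_iff)
  define K where "K = \<lceil>real k * b\<rceil>"
  have "grid (real k) \<inter> B \<subseteq> (\<lambda>f. \<chi> i. of_int (f i) / real k) ` (PiE UNIV (\<lambda>_::'d. {-K..K}))"
  proof
    fix x assume x: "x \<in> grid (real k) \<inter> B"
    then obtain j :: "int ^ 'd" where j: "x = (\<chi> i. of_int (j $ i) / real k)"
      by (auto simp: grid_def)
    have "j $ i \<in> {-K..K}" for i
    proof -
      have "\<bar>x $ i\<bar> \<le> b" using component_le_norm_cart[of x i] b[of x] x by auto
      then have "\<bar>of_int (j $ i)\<bar> \<le> real k * b" using k by (simp add: j field_simps)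
      then have "of_int \<bar>j $ i\<bar> \<le> real_of_int K" unfolding K_def by linarith
      then have "\<bar>j $ i\<bar> \<le> K" by (simp only: of_int_le_iff)
      then show ?thesis by auto
    qed
    then show "x \<in> (\<lambda>f. \<chi> i. of_int (f i) / real k) ` (PiE UNIV (\<lambda>_::'d. {-K..K}))"
      by (intro image_eqI[of _ _ "\<lambda>i. j $ i"]) (auto simp: j)
  qed
  then show ?thesis by (rule finite_subset) (intro finite_imageI finite_PiE; simp)
qed

text \<open>
  Both sides integrate the step function that is constant on the cells of the grid: it has the value
  \<open>\<phi> g\<close> on the cell with lower corner \<open>g\<close>.
\<close>

lemma set_integral_grid_floor:
  fixes \<phi> :: "real ^ 'd \<Rightarrow> real"
  assumes k: "k \<ge> 1" and B: "bounded B" "aligned B"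
  shows "set_integrable lborel B (\<lambda>t. \<phi> (grid_floor k t))"
    and "(LINT t:B|lborel. \<phi> (grid_floor k t)) = (\<Sum>g\<in>grid (real k) \<inter> B. \<phi> g) / real k ^ CARD('d)"
proof -
  let ?G = "grid (real k) \<inter> B"
  let ?c = "\<lambda>g. {t. grid_floor k t = g}"
  have G: "finite ?G" by (rule finite_grid_Int[OF k B(1)])
  have eq: "indicator B t *\<^sub>R \<phi> (grid_floor k t) = (\<Sum>g\<in>?G. indicator (?c g) t * \<phi> g)" for t
  proof (cases "t \<in> B")
    case True
    then have "grid_floor k t \<in> ?G"
      using aligned_grid_floor[OF B(2) k] grid_floor_grid by auto
    moreover have "(\<Sum>g\<in>?G. indicator (?c g) t * \<phi> g) = (\<Sum>g\<in>?G. if g = grid_floor k t then \<phi> g else 0)"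
      by (intro sum.cong) (auto simp: indicator_def)
    ultimately show ?thesis using True G by simp
  next
    case False
    then have "grid_floor k t \<notin> B" using aligned_grid_floor[OF B(2) k] by auto
    then have "(\<Sum>g\<in>?G. indicator (?c g) t * \<phi> g) = 0"
      by (intro sum.neutral) (auto simp: indicator_def)
    with False show ?thesis by simp
  qed
  have m: "measure lborel (?c g) = 1 / real k ^ CARD('d)" if "g \<in> ?G" for g
    using measure_grid_cell[OF k] that by auto
  have fin: "emeasure lborel (?c g) < \<infinity>" if "g \<in> ?G" for g
  proof -
    have "?c g = half_open_box g (\<chi> i. g $ i + 1 / real k)"
      using grid_floor_eq_iff[OF k] that by auto
    then show ?thesis using emeasure_bounded_finite[OF bounded_half_open_box] by simp
  qed
  have ms: "?c g \<in> sets lborel" for g :: "real ^ 'd"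
    by measurable
  have int: "integrable lborel (\<lambda>t. indicator (?c g) t * \<phi> g)" if "g \<in> ?G" for g
    using fin[OF that] ms[of g] by (intro integrable_mult_left integrable_real_indicator) auto
  show "set_integrable lborel B (\<lambda>t. \<phi> (grid_floor k t))"
    unfolding set_integrable_def eq by (rule Bochner_Integration.integrable_sum) (rule int)
  have "(LINT t:B|lborel. \<phi> (grid_floor k t)) = (\<Sum>g\<in>?G. (\<integral>t. indicator (?c g) t * \<phi> g \<partial>lborel))"
    unfolding set_lebesgue_integral_def eq by (rule Bochner_Integration.integral_sum) (rule int)
  also have "\<dots> = (\<Sum>g\<in>?G. \<phi> g / real k ^ CARD('d))"
    using m by (intro sum.cong) auto
  finally show "(LINT t:B|lborel. \<phi> (grid_floor k t)) = (\<Sum>g\<in>?G. \<phi> g) / real k ^ CARD('d)"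
    by (simp add: sum_divide_distrib)
qed

lemma card_grid_Int:
  fixes B :: "(real ^ 'd) set"
  assumes k: "k \<ge> 1" and B: "bounded B" "aligned B" "B \<in> sets borel"
  shows "real (card (grid (real k) \<inter> B)) = measure lborel B * real k ^ CARD('d)"
proof -
  have "(LINT t:B|lborel. 1) = measure lborel B"
    using B emeasure_bounded_finite[OF B(1)] by (simp add: set_lebesgue_integral_def)
  with set_integral_grid_floor(2)[OF k B(1,2), of "\<lambda>_. 1"] k show ?thesis
    by (simp add: field_simps)
qed

context stationary_L2_field begin

text \<open>
  The shift \<open>h\<close> is kept as a parameter so that the Riemann sum of a shifted field uses the same grid
  points as that of the field itself. This is what makes stationarity applicable to integrals.
\<close>

definition field_integral :: "real ^ 'd \<Rightarrow> (real ^ 'd) set \<Rightarrow> 'w \<Rightarrow> real" where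
  "field_integral h B \<omega> = (LINT t:B|lborel. X (t + h) \<omega>)"

definition riemann_sum :: "nat \<Rightarrow> real ^ 'd \<Rightarrow> (real ^ 'd) set \<Rightarrow> 'w \<Rightarrow> real" where
  "riemann_sum k h B \<omega> = (\<Sum>g\<in>grid (real k) \<inter> B. X (g + h) \<omega>) / real k ^ CARD('d)"

lemma abs_mean_X: "(\<integral>\<omega>. \<bar>X t \<omega>\<bar> \<partial>M) = (\<integral>\<omega>. \<bar>X 0 \<omega>\<bar> \<partial>M)"
  using stationary_single(1)[of abs t] by simp

lemma
  assumes B: "bounded B" "B \<in> sets borel"
  shows AE_integrable_field_integral: "AE \<omega> in M. set_integrable lborel B (\<lambda>t. X (t + h) \<omega>)"
    and integrable_field_integral: "integrable M (field_integral h B)"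
proof -
  have jm: "(\<lambda>(\<omega>, t). X (t + h) \<omega>) \<in> borel_measurable (M \<Otimes>\<^sub>M lborel)"
    by (simp add: split_beta')
  have B': "B \<in> sets lborel" "emeasure lborel B < \<infinity>" using B emeasure_bounded_finite[OF B(1)] by auto
  note f = lborel.sigma_finite_measure_axioms jm B'
  show "AE \<omega> in M. set_integrable lborel B (\<lambda>t. X (t + h) \<omega>)"
    by (rule AE_set_integrable[OF f]) (auto intro: eq_refl[OF abs_mean_X])
  show "integrable M (field_integral h B)"
    unfolding field_integral_def by (rule integrable_set_integral[OF f]) (auto intro: eq_refl[OF abs_mean_X])
qed

lemma integrable_riemann_sum: "integrable M (riemann_sum k h B)"
  unfolding riemann_sum_def by simp

text \<open>
  The difference is the integral over \<open>B\<close> of the increment between \<open>t + h\<close> and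
  \<open>grid_floor k t + h\<close>, whose expectation depends on \<open>t - grid_floor k t\<close> only and tends to 0 by
  continuity in the mean.
\<close>

lemma riemann_approx:
  assumes B: "bounded B" "B \<in> sets borel" "aligned B"
  shows "(\<lambda>k. \<integral>\<omega>. \<bar>field_integral h B \<omega> - riemann_sum k h B \<omega>\<bar> \<partial>M) \<longlonglongrightarrow> 0"
proof (rule tendsto_sandwich[OF _ _ tendsto_const])
  show "\<forall>\<^sub>F k in sequentially. 0 \<le> (\<integral>\<omega>. \<bar>field_integral h B \<omega> - riemann_sum k h B \<omega>\<bar> \<partial>M)" by simp
  have B': "B \<in> sets lborel" "emeasure lborel B < \<infinity>" using B emeasure_bounded_finite[OF B(1)] by auto
  define c where "c = 2 * (\<integral>\<omega>. \<bar>X 0 \<omega>\<bar> \<partial>M)"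
  have c: "increment y \<le> c" for y unfolding c_def by (rule increment_bound)
  show "(\<lambda>k. LINT t:B|lborel. increment (t - grid_floor k t)) \<longlonglongrightarrow> 0"
  proof -
    have "(\<lambda>k. \<integral>t. indicator B t *\<^sub>R increment (t - grid_floor k t) \<partial>lborel) \<longlonglongrightarrow> integral\<^sup>L lborel (\<lambda>_::real^'d. 0::real)"
    proof (rule integral_dominated_convergence[where w="\<lambda>t. indicator B t * c"])
      show "integrable lborel (\<lambda>t. indicator B t * c)"
        using B' by (intro integrable_mult_left integrable_real_indicator) auto
      show "AE t in lborel. (\<lambda>k. indicator B t *\<^sub>R increment (t - grid_floor k t)) \<longlonglongrightarrow> 0"
        using increment_tendsto_0[OF grid_floor_tendsto] by (auto intro!: tendsto_mult_right_zero)
      show "AE t in lborel. norm (indicator B t *\<^sub>R increment (t - grid_floor k t)) \<le> indicator B t * c" for k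
        using c increment_nonneg by (auto simp: indicator_def)
    qed (use B in measurable)
    then show ?thesis by (simp add: set_lebesgue_integral_def)
  qed
  show "\<forall>\<^sub>F k in sequentially. (\<integral>\<omega>. \<bar>field_integral h B \<omega> - riemann_sum k h B \<omega>\<bar> \<partial>M) \<le> (LINT t:B|lborel. increment (t - grid_floor k t))"
    using eventually_ge_at_top[of 1]
  proof eventually_elim
    fix k :: nat assume k: "k \<ge> 1"
    have jm: "(\<lambda>(\<omega>, t). \<bar>X (t + h) \<omega> - X (grid_floor k t + h) \<omega>\<bar>) \<in> borel_measurable (M \<Otimes>\<^sub>M lborel)"
      by (simp add: split_beta')
    note f = lborel.sigma_finite_measure_axioms jm B'
    have incr: "(\<integral>\<omega>. \<bar>X (t + h) \<omega> - X (grid_floor k t + h) \<omega>\<bar> \<partial>M) = increment (t - grid_floor k t)" for t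
      by (simp add: increment_eq)
    have "(\<integral>\<omega>. \<bar>field_integral h B \<omega> - riemann_sum k h B \<omega>\<bar> \<partial>M) \<le> (\<integral>\<omega>. (LINT t:B|lborel. \<bar>X (t + h) \<omega> - X (grid_floor k t + h) \<omega>\<bar>) \<partial>M)"
    proof (rule integral_mono_AE)
      show "integrable M (\<lambda>\<omega>. \<bar>field_integral h B \<omega> - riemann_sum k h B \<omega>\<bar>)"
        using integrable_field_integral[OF B(1,2)] integrable_riemann_sum by auto
      show "integrable M (\<lambda>\<omega>. LINT t:B|lborel. \<bar>X (t + h) \<omega> - X (grid_floor k t + h) \<omega>\<bar>)"
        by (rule integrable_set_integral[OF f, of c]) (auto simp: incr c)
      show "AE \<omega> in M. \<bar>field_integral h B \<omega> - riemann_sum k h B \<omega>\<bar> \<le> (LINT t:B|lborel. \<bar>X (t + h) \<omega> - X (grid_floor k t + h) \<omega>\<bar>)"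
        using AE_integrable_field_integral[OF B(1,2), of h]
      proof eventually_elim
        fix \<omega> assume i: "set_integrable lborel B (\<lambda>t. X (t + h) \<omega>)"
        note j = set_integral_grid_floor[OF k B(1,3), of "\<lambda>t. X (t + h) \<omega>"]
        have "field_integral h B \<omega> - riemann_sum k h B \<omega> = (LINT t:B|lborel. X (t + h) \<omega> - X (grid_floor k t + h) \<omega>)"
          using i j by (simp add: field_integral_def riemann_sum_def)
        also have "norm \<dots> \<le> (LINT t:B|lborel. \<bar>X (t + h) \<omega> - X (grid_floor k t + h) \<omega>\<bar>)"
          unfolding real_norm_def[symmetric] by (rule set_integral_norm_bound) (use i j in auto)
        finally show "\<bar>field_integral h B \<omega> - riemann_sum k h B \<omega>\<bar> \<le> (LINT t:B|lborel. \<bar>X (t + h) \<omega> - X (grid_floor k t + h) \<omega>\<bar>)"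
          by simp
      qed
    qed
    also have "\<dots> = (LINT t:B|lborel. increment (t - grid_floor k t))"
      by (subst expectation_set_integral[OF f, of c]) (auto simp: incr c)
    finally show "(\<integral>\<omega>. \<bar>field_integral h B \<omega> - riemann_sum k h B \<omega>\<bar> \<partial>M) \<le> (LINT t:B|lborel. increment (t - grid_floor k t))" .
  qed
qed

end

section \<open>Expectations of Lipschitz functions\<close>

lemma abs_mult_le_one: "\<bar>a\<bar> \<le> 1 \<Longrightarrow> \<bar>b\<bar> \<le> 1 \<Longrightarrow> \<bar>a\<bar> * \<bar>b\<bar> \<le> (1 :: real)"
  by (rule mult_le_one) auto

lemma norm_iexp_diff: "cmod (iexp x - iexp y) \<le> \<bar>x - y\<bar>"
proof -
  have "iexp x - iexp y = iexp y * (iexp (x - y) - 1)"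
    by (simp add: algebra_simps exp_add[symmetric])
  then have "cmod (iexp x - iexp y) = cmod (iexp (x - y) - 1)" by (simp add: norm_mult)
  also have "\<dots> \<le> \<bar>x - y\<bar>" using iexp_approx1[of "x - y" 0] by simp
  finally show ?thesis .
qed

lemma iexp_eq_cos_sin: "iexp x = Complex (cos x) (sin x)"
  by (simp add: complex_eq_iff Re_exp Im_exp)

lemma abs_cos_diff: "\<bar>cos x - cos y\<bar> \<le> \<bar>x - y :: real\<bar>"
  using abs_Re_le_cmod[of "iexp x - iexp y"] norm_iexp_diff[of x y] by (simp add: iexp_eq_cos_sin)

lemma abs_sin_diff: "\<bar>sin x - sin y\<bar> \<le> \<bar>x - y :: real\<bar>"
  using abs_Im_le_cmod[of "iexp x - iexp y"] norm_iexp_diff[of x y] by (simp add: iexp_eq_cos_sin)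

lemma (in prob_space) integrable_iexp_real[simp]:
  "f \<in> borel_measurable M \<Longrightarrow> integrable M (\<lambda>\<omega>. iexp (f \<omega>))"
  by (rule integrable_iexp) auto

lemma (in prob_space) expectation_iexp_tendsto:
  fixes Y :: "'a \<Rightarrow> real"
  assumes [simp]: "integrable M Y" "\<And>k. integrable M (Yk k)"
    and lim: "(\<lambda>k. \<integral>\<omega>. \<bar>Y \<omega> - Yk k \<omega>\<bar> \<partial>M) \<longlonglongrightarrow> 0"
  shows "(\<lambda>k. \<integral>\<omega>. iexp (u * (Yk k \<omega> - c)) \<partial>M) \<longlonglongrightarrow> (\<integral>\<omega>. iexp (u * (Y \<omega> - c)) \<partial>M)"
proof (rule LIM_zero_cancel, rule Lim_null_comparison)
  have [measurable]: "Y \<in> borel_measurable M" "Yk k \<in> borel_measurable M" for k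
    by (auto intro: borel_measurable_integrable)
  show "\<forall>\<^sub>F k in sequentially. norm ((\<integral>\<omega>. iexp (u * (Yk k \<omega> - c)) \<partial>M) - (\<integral>\<omega>. iexp (u * (Y \<omega> - c)) \<partial>M))
      \<le> \<bar>u\<bar> * (\<integral>\<omega>. \<bar>Y \<omega> - Yk k \<omega>\<bar> \<partial>M)"
  proof (intro always_eventually allI)
    fix k
    have "(\<integral>\<omega>. iexp (u * (Yk k \<omega> - c)) \<partial>M) - (\<integral>\<omega>. iexp (u * (Y \<omega> - c)) \<partial>M)
        = (\<integral>\<omega>. iexp (u * (Yk k \<omega> - c)) - iexp (u * (Y \<omega> - c)) \<partial>M)"
      by (rule Bochner_Integration.integral_diff[symmetric]; rule integrable_iexp_real; measurable)
    also have "norm \<dots> \<le> (\<integral>\<omega>. norm (iexp (u * (Yk k \<omega> - c)) - iexp (u * (Y \<omega> - c))) \<partial>M)"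
      by (rule integral_norm_bound)
    also have "\<dots> \<le> (\<integral>\<omega>. \<bar>u\<bar> * \<bar>Y \<omega> - Yk k \<omega>\<bar> \<partial>M)"
    proof (rule integral_mono)
      show "integrable M (\<lambda>\<omega>. norm (iexp (u * (Yk k \<omega> - c)) - iexp (u * (Y \<omega> - c))))"
        by (intro integrable_norm Bochner_Integration.integrable_diff integrable_iexp_real) measurable
      fix \<omega>
      have "norm (iexp (u * (Yk k \<omega> - c)) - iexp (u * (Y \<omega> - c))) \<le> \<bar>u * (Yk k \<omega> - c) - u * (Y \<omega> - c)\<bar>"
        by (rule norm_iexp_diff)
      also have "u * (Yk k \<omega> - c) - u * (Y \<omega> - c) = - (u * (Y \<omega> - Yk k \<omega>))" by (simp add: algebra_simps)
      finally show "norm (iexp (u * (Yk k \<omega> - c)) - iexp (u * (Y \<omega> - c))) \<le> \<bar>u\<bar> * \<bar>Y \<omega> - Yk k \<omega>\<bar>"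
        by (simp add: abs_mult)
    qed simp
    also have "\<dots> = \<bar>u\<bar> * (\<integral>\<omega>. \<bar>Y \<omega> - Yk k \<omega>\<bar> \<partial>M)" by simp
    finally show "norm ((\<integral>\<omega>. iexp (u * (Yk k \<omega> - c)) \<partial>M) - (\<integral>\<omega>. iexp (u * (Y \<omega> - c)) \<partial>M))
      \<le> \<bar>u\<bar> * (\<integral>\<omega>. \<bar>Y \<omega> - Yk k \<omega>\<bar> \<partial>M)" .
  qed
  show "(\<lambda>k. \<bar>u\<bar> * (\<integral>\<omega>. \<bar>Y \<omega> - Yk k \<omega>\<bar> \<partial>M)) \<longlonglongrightarrow> 0"
    using tendsto_mult_right_zero[OF lim] by simp
qed

text \<open>
  Test functions of one real variable, with an explicit Lipschitz bound. Fixing the bound 1 for the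
  values suffices for sine and cosine and makes products easy to compare.
\<close>

definition lipschitz_test :: "real \<Rightarrow> (real \<Rightarrow> real) \<Rightarrow> bool" where
  "lipschitz_test L F \<longleftrightarrow> 0 \<le> L \<and> (\<forall>x. \<bar>F x\<bar> \<le> 1) \<and> (\<forall>x y. \<bar>F x - F y\<bar> \<le> L * \<bar>x - y\<bar>)"

lemma lipschitz_test_measurable: "lipschitz_test L F \<Longrightarrow> F \<in> borel_measurable borel"
proof -
  assume F: "lipschitz_test L F"
  have "L-lipschitz_on UNIV F"
    using F by (auto simp: lipschitz_test_def lipschitz_on_def dist_real_def)
  then show ?thesis
    by (intro borel_measurable_continuous_onI lipschitz_on_continuous_on)
qed

lemma lipschitz_test_uminus: "lipschitz_test L F \<Longrightarrow> lipschitz_test L (\<lambda>x. - F x)"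
  by (auto simp: lipschitz_test_def abs_minus_commute)

lemma (in prob_space) covariance_bounded:
  fixes Y :: "'a \<Rightarrow> real"
  assumes [measurable]: "Y \<in> borel_measurable M" "Z \<in> borel_measurable M"
    and b: "\<And>\<omega>. \<bar>Y \<omega>\<bar> \<le> 1" "\<And>\<omega>. \<bar>Z \<omega>\<bar> \<le> 1"
  shows "covariance M Y Z = (\<integral>\<omega>. Y \<omega> * Z \<omega> \<partial>M) - (\<integral>\<omega>. Y \<omega> \<partial>M) * (\<integral>\<omega>. Z \<omega> \<partial>M)"
proof -
  have [simp]: "integrable M Y" "integrable M Z"
    using b by (auto intro!: integrable_const_bound[where B=1])
  have [simp]: "integrable M (\<lambda>\<omega>. Y \<omega> * Z \<omega>)"
    using b by (auto intro!: integrable_const_bound[where B=1] AE_I2 abs_mult_le_one simp: abs_mult)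
  have "covariance M Y Z = (\<integral>\<omega>. Y \<omega> * Z \<omega> - (\<integral>\<omega>. Y \<omega> \<partial>M) * Z \<omega> - Y \<omega> * (\<integral>\<omega>. Z \<omega> \<partial>M)
        + (\<integral>\<omega>. Y \<omega> \<partial>M) * (\<integral>\<omega>. Z \<omega> \<partial>M) \<partial>M)"
    unfolding covariance_def by (simp add: algebra_simps)
  also have "\<dots> = (\<integral>\<omega>. Y \<omega> * Z \<omega> \<partial>M) - (\<integral>\<omega>. Y \<omega> \<partial>M) * (\<integral>\<omega>. Z \<omega> \<partial>M)"
    by (simp add: prob_space)
  finally show ?thesis .
qed

lemma (in prob_space) expectation_lipschitz_test_tendsto:
  fixes Y :: "'a \<Rightarrow> real"
  assumes F: "lipschitz_test L F" "lipschitz_test L' F'"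
    and [simp]: "integrable M Y" "\<And>k. integrable M (Yk k)" "integrable M Y'" "\<And>k. integrable M (Yk' k)"
    and lim: "(\<lambda>k. \<integral>\<omega>. \<bar>Y \<omega> - Yk k \<omega>\<bar> \<partial>M) \<longlonglongrightarrow> 0" "(\<lambda>k. \<integral>\<omega>. \<bar>Y' \<omega> - Yk' k \<omega>\<bar> \<partial>M) \<longlonglongrightarrow> 0"
  shows "(\<lambda>k. \<integral>\<omega>. F (Yk k \<omega>) * F' (Yk' k \<omega>) \<partial>M) \<longlonglongrightarrow> (\<integral>\<omega>. F (Y \<omega>) * F' (Y' \<omega>) \<partial>M)"
proof (rule LIM_zero_cancel, rule Lim_null_comparison)
  have [measurable]: "Y \<in> borel_measurable M" "\<And>k. Yk k \<in> borel_measurable M"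
     "Y' \<in> borel_measurable M" "\<And>k. Yk' k \<in> borel_measurable M"
    by (auto intro: borel_measurable_integrable)
  have [measurable]: "F \<in> borel_measurable borel" "F' \<in> borel_measurable borel"
    using F by (auto intro: lipschitz_test_measurable)
  have b: "\<bar>F x\<bar> \<le> 1" "\<bar>F' x\<bar> \<le> 1" for x using F by (auto simp: lipschitz_test_def)
  have l: "\<bar>F x - F y\<bar> \<le> L * \<bar>x - y\<bar>" "\<bar>F' x - F' y\<bar> \<le> L' * \<bar>x - y\<bar>" for x y
    using F by (auto simp: lipschitz_test_def)
  have int: "integrable M (\<lambda>\<omega>. F (f \<omega>) * F' (g \<omega>))"
    if [measurable]: "f \<in> borel_measurable M" "g \<in> borel_measurable M" for f g
    using b by (auto intro!: integrable_const_bound[where B=1] AE_I2 abs_mult_le_one simp: abs_mult)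
  show "\<forall>\<^sub>F k in sequentially. norm ((\<integral>\<omega>. F (Yk k \<omega>) * F' (Yk' k \<omega>) \<partial>M) - (\<integral>\<omega>. F (Y \<omega>) * F' (Y' \<omega>) \<partial>M))
      \<le> L * (\<integral>\<omega>. \<bar>Y \<omega> - Yk k \<omega>\<bar> \<partial>M) + L' * (\<integral>\<omega>. \<bar>Y' \<omega> - Yk' k \<omega>\<bar> \<partial>M)"
  proof (intro always_eventually allI)
    fix k
    have "(\<integral>\<omega>. F (Yk k \<omega>) * F' (Yk' k \<omega>) \<partial>M) - (\<integral>\<omega>. F (Y \<omega>) * F' (Y' \<omega>) \<partial>M)
      = (\<integral>\<omega>. F (Yk k \<omega>) * F' (Yk' k \<omega>) - F (Y \<omega>) * F' (Y' \<omega>) \<partial>M)"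
      using int by simp
    also have "norm \<dots> \<le> (\<integral>\<omega>. norm (F (Yk k \<omega>) * F' (Yk' k \<omega>) - F (Y \<omega>) * F' (Y' \<omega>)) \<partial>M)"
      by (rule integral_norm_bound)
    also have "\<dots> \<le> (\<integral>\<omega>. L * \<bar>Y \<omega> - Yk k \<omega>\<bar> + L' * \<bar>Y' \<omega> - Yk' k \<omega>\<bar> \<partial>M)"
    proof (rule integral_mono)
      fix \<omega>
      have "F (Yk k \<omega>) * F' (Yk' k \<omega>) - F (Y \<omega>) * F' (Y' \<omega>)
          = (F (Yk k \<omega>) - F (Y \<omega>)) * F' (Yk' k \<omega>) + F (Y \<omega>) * (F' (Yk' k \<omega>) - F' (Y' \<omega>))"
        by (simp add: algebra_simps)
      also have "norm \<dots> \<le> \<bar>F (Yk k \<omega>) - F (Y \<omega>)\<bar> * \<bar>F' (Yk' k \<omega>)\<bar> + \<bar>F (Y \<omega>)\<bar> * \<bar>F' (Yk' k \<omega>) - F' (Y' \<omega>)\<bar>"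
        using norm_triangle_ineq[of "(F (Yk k \<omega>) - F (Y \<omega>)) * F' (Yk' k \<omega>)" "F (Y \<omega>) * (F' (Yk' k \<omega>) - F' (Y' \<omega>))"]
        by (simp add: abs_mult)
      also have "\<dots> \<le> (L * \<bar>Yk k \<omega> - Y \<omega>\<bar>) * 1 + 1 * (L' * \<bar>Yk' k \<omega> - Y' \<omega>\<bar>)"
        using F by (intro add_mono mult_mono b l) (auto simp: lipschitz_test_def)
      finally show "norm (F (Yk k \<omega>) * F' (Yk' k \<omega>) - F (Y \<omega>) * F' (Y' \<omega>)) \<le> L * \<bar>Y \<omega> - Yk k \<omega>\<bar> + L' * \<bar>Y' \<omega> - Yk' k \<omega>\<bar>"
        by (simp add: abs_minus_commute)
    qed (use int in auto)
    also have "\<dots> = L * (\<integral>\<omega>. \<bar>Y \<omega> - Yk k \<omega>\<bar> \<partial>M) + L' * (\<integral>\<omega>. \<bar>Y' \<omega> - Yk' k \<omega>\<bar> \<partial>M)" by simp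
    finally show "norm ((\<integral>\<omega>. F (Yk k \<omega>) * F' (Yk' k \<omega>) \<partial>M) - (\<integral>\<omega>. F (Y \<omega>) * F' (Y' \<omega>) \<partial>M))
      \<le> L * (\<integral>\<omega>. \<bar>Y \<omega> - Yk k \<omega>\<bar> \<partial>M) + L' * (\<integral>\<omega>. \<bar>Y' \<omega> - Yk' k \<omega>\<bar> \<partial>M)" .
  qed
  show "(\<lambda>k. L * (\<integral>\<omega>. \<bar>Y \<omega> - Yk k \<omega>\<bar> \<partial>M) + L' * (\<integral>\<omega>. \<bar>Y' \<omega> - Yk' k \<omega>\<bar> \<partial>M)) \<longlonglongrightarrow> 0"
    using tendsto_add[OF tendsto_mult_right_zero[OF lim(1), of L] tendsto_mult_right_zero[OF lim(2), of L']] by simp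
qed

lemma (in prob_space) covariance_lipschitz_test_tendsto:
  fixes Y :: "'a \<Rightarrow> real"
  assumes F: "lipschitz_test L F" "lipschitz_test L' F'"
    and i: "integrable M Y" "\<And>k. integrable M (Yk k)" "integrable M Y'" "\<And>k. integrable M (Yk' k)"
    and lim: "(\<lambda>k. \<integral>\<omega>. \<bar>Y \<omega> - Yk k \<omega>\<bar> \<partial>M) \<longlonglongrightarrow> 0" "(\<lambda>k. \<integral>\<omega>. \<bar>Y' \<omega> - Yk' k \<omega>\<bar> \<partial>M) \<longlonglongrightarrow> 0"
  shows "(\<lambda>k. covariance M (\<lambda>\<omega>. F (Yk k \<omega>)) (\<lambda>\<omega>. F' (Yk' k \<omega>)))
      \<longlonglongrightarrow> covariance M (\<lambda>\<omega>. F (Y \<omega>)) (\<lambda>\<omega>. F' (Y' \<omega>))"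
proof -
  have one: "lipschitz_test 0 (\<lambda>_. 1)" by (simp add: lipschitz_test_def)
  have [measurable]: "Y \<in> borel_measurable M" "\<And>k. Yk k \<in> borel_measurable M"
     "Y' \<in> borel_measurable M" "\<And>k. Yk' k \<in> borel_measurable M" using i by auto
  have [measurable]: "F \<in> borel_measurable borel" "F' \<in> borel_measurable borel"
    using F by (auto intro: lipschitz_test_measurable)
  have b: "\<bar>F x\<bar> \<le> 1" "\<bar>F' x\<bar> \<le> 1" for x using F by (auto simp: lipschitz_test_def)
  have c: "covariance M (\<lambda>\<omega>. F (f \<omega>)) (\<lambda>\<omega>. F' (g \<omega>)) =
      (\<integral>\<omega>. F (f \<omega>) * F' (g \<omega>) \<partial>M) - (\<integral>\<omega>. F (f \<omega>) \<partial>M) * (\<integral>\<omega>. F' (g \<omega>) \<partial>M)"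
    if [measurable]: "f \<in> borel_measurable M" "g \<in> borel_measurable M" for f g
    by (rule covariance_bounded) (auto simp: b)
  note t1 = expectation_lipschitz_test_tendsto[OF F i lim]
  note t2 = expectation_lipschitz_test_tendsto[OF F(1) one i(1,2) i(1,2) lim(1) lim(1), simplified]
  note t3 = expectation_lipschitz_test_tendsto[OF F(2) one i(3,4) i(3,4) lim(2) lim(2), simplified]
  show ?thesis
    using tendsto_diff[OF t1 tendsto_mult[OF t2 t3]] by (simp add: c)
qed

text \<open>
  Averaging divides the Lipschitz constant with respect to the \<open>l\<^sup>1\<close> distance by the normalisation
  \<open>c\<close>, regardless of the number \<open>n\<close> of arguments.
\<close>

lemma average_bounded_lipschitz:
  assumes F: "lipschitz_test L F" and n: "n > 0" and c: "c > 0"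
  defines "f \<equiv> \<lambda>v :: nat \<Rightarrow> real. F ((\<Sum>i<n. v i) / c)"
  shows "bounded_lipschitz n f" "0 \<le> Lip n f" "Lip n f \<le> L / c"
proof -
  have L: "0 \<le> L" using F by (simp add: lipschitz_test_def)
  have lip: "\<bar>f x - f y\<bar> \<le> L / c * l1_dist n x y" for x y
  proof -
    have "\<bar>f x - f y\<bar> \<le> L * \<bar>(\<Sum>i<n. x i) / c - (\<Sum>i<n. y i) / c\<bar>"
      using F unfolding f_def lipschitz_test_def by blast
    also have "(\<Sum>i<n. x i) / c - (\<Sum>i<n. y i) / c = (\<Sum>i<n. x i - y i) / c"
      by (simp add: sum_subtractf diff_divide_distrib)
    also have "L * \<bar>\<dots>\<bar> \<le> L * (l1_dist n x y / c)"
      using c L unfolding l1_dist_def abs_divide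
      by (intro mult_left_mono divide_right_mono[THEN order_trans[OF _ eq_refl]]) auto
    finally show ?thesis by simp
  qed
  have "bounded (f ` Rn n)"
    using F by (auto simp: bounded_iff f_def lipschitz_test_def)
  with lip show "bounded_lipschitz n f"
    unfolding bounded_lipschitz_def lipschitz_fun_def by blast
  let ?S = "{\<bar>f x - f y\<bar> / l1_dist n x y | x y. x \<in> Rn n \<and> y \<in> Rn n \<and> x \<noteq> y}"
  have pos: "l1_dist n x y > 0" if xy: "x \<in> Rn n" "y \<in> Rn n" "x \<noteq> y" for x y
  proof -
    obtain i where "i < n" "x i \<noteq> y i"
      using xy by (metis PiE_ext lessThan_iff)
    then show ?thesis
      unfolding l1_dist_def by (intro sum_pos2[of _ i]) auto
  qed
  have le: "s \<le> L / c" and ge: "s \<ge> 0" if "s \<in> ?S" for s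
    using that pos lip by (auto simp: divide_le_eq less_imp_le)
  define x0 where "x0 = (\<lambda>i\<in>{..<n}. 0 :: real)"
  define x1 where "x1 = (\<lambda>i\<in>{..<n}. 1 :: real)"
  have "x0 0 \<noteq> x1 0" using n by (simp add: x0_def x1_def)
  then have "x0 \<noteq> x1" by auto
  moreover have "x0 \<in> Rn n" "x1 \<in> Rn n" by (auto simp: x0_def x1_def)
  ultimately have ex: "\<bar>f x0 - f x1\<bar> / l1_dist n x0 x1 \<in> ?S" by blast
  then have ne: "?S \<noteq> {}" by blast
  show "Lip n f \<le> L / c" unfolding Lip_def by (rule cSup_least[OF ne le])
  have "bdd_above ?S" using le by (rule bdd_aboveI)
  from cSup_upper[OF ex this] ge[OF ex] show "0 \<le> Lip n f" unfolding Lip_def by linarith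
qed

section \<open>Integrals of the field over windows\<close>

context stationary_L2_field begin

text \<open>
  Characteristic functions of window integrals are invariant under translations: stationarity gives
  this for Riemann sums, which have finitely many arguments, and the identity passes to the limit.
\<close>

lemma expectation_iexp_shift:
  assumes B: "bounded B" "B \<in> sets borel" "aligned B"
  shows "(\<integral>\<omega>. iexp (u * (field_integral h B \<omega> - c)) \<partial>M) = (\<integral>\<omega>. iexp (u * (field_integral 0 B \<omega> - c)) \<partial>M)"
proof -
  have eq: "(\<integral>\<omega>. iexp (u * (riemann_sum k h B \<omega> - c)) \<partial>M) = (\<integral>\<omega>. iexp (u * (riemann_sum k 0 B \<omega> - c)) \<partial>M)" if k: "k \<ge> 1" for k
  proof -
    let ?G = "grid (real k) \<inter> B"
    let ?\<phi> = "\<lambda>x. iexp (u * ((\<Sum>g\<in>?G. x g) / real k ^ CARD('d) - c))"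
    have "(\<lambda>x. u * ((\<Sum>g\<in>?G. x g) / real k ^ CARD('d) - c)) \<in> borel_measurable (Pi\<^sub>M ?G (\<lambda>_. borel))"
      by measurable
    then have m: "?\<phi> \<in> borel_measurable (Pi\<^sub>M ?G (\<lambda>_. borel))" by simp
    show ?thesis
      using stationary_integral(1)[OF finite_grid_Int[OF k B(1)] m, of h] by (simp add: riemann_sum_def)
  qed
  have lim: "(\<lambda>k. \<integral>\<omega>. iexp (u * (riemann_sum k h B \<omega> - c)) \<partial>M) \<longlonglongrightarrow> (\<integral>\<omega>. iexp (u * (field_integral h B \<omega> - c)) \<partial>M)" for h
    using B by (intro expectation_iexp_tendsto integrable_field_integral integrable_riemann_sum riemann_approx)
  have "(\<lambda>k. \<integral>\<omega>. iexp (u * (riemann_sum k h B \<omega> - c)) \<partial>M) \<longlonglongrightarrow> (\<integral>\<omega>. iexp (u * (field_integral 0 B \<omega> - c)) \<partial>M)"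
    by (rule Lim_transform_eventually[OF lim[of 0]])
       (use eventually_ge_at_top[of 1] in eventually_elim, rule eq[symmetric])
  with lim[of h] show ?thesis by (rule LIMSEQ_unique)
qed

lemma field_integral_translate:
  assumes "\<And>t. t + h \<in> B' \<longleftrightarrow> t \<in> B" and [measurable]: "B' \<in> sets borel" and "\<omega> \<in> space M"
  shows "field_integral 0 B' \<omega> = field_integral h B \<omega>"
proof -
  have [measurable]: "(\<lambda>t. X t \<omega>) \<in> borel_measurable borel"
    using \<open>\<omega> \<in> space M\<close> by measurable
  have "(\<integral>t. indicator B' (t + h) *\<^sub>R X (t + h) \<omega> \<partial>lborel) = (\<integral>t. indicator B' t *\<^sub>R X t \<omega> \<partial>lborel)"
    by (rule integral_translate[where f="\<lambda>t. indicator B' t *\<^sub>R X t \<omega>"]) measurable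
  moreover have "indicator B' (t + h) = (indicator B t :: real)" for t
    using assms(1) by (simp add: indicator_def)
  ultimately show ?thesis by (simp add: field_integral_def set_lebesgue_integral_def)
qed

text \<open>
  Centring by \<open>mean |A|\<close> makes the fluctuation a fixed function of the integral at every sample point.
  The integral of the centred field agrees with it only almost surely (\<open>fluctuation_eq_centered\<close>).
\<close>

definition fluctuation :: "(real ^ 'd) set \<Rightarrow> 'w \<Rightarrow> real" where
  "fluctuation A \<omega> = field_integral 0 A \<omega> - mean * measure lborel A"

lemma integrable_fluctuation: "bounded A \<Longrightarrow> A \<in> sets borel \<Longrightarrow> integrable M (fluctuation A)"
  unfolding fluctuation_def using integrable_field_integral[of A 0] by simp


text \<open>
  Additivity holds only almost surely, since the integral of a path that is not integrable has the
  default value 0.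
\<close>

lemma fluctuation_Un:
  assumes A: "bounded A" "A \<in> sets borel" and B: "bounded B" "B \<in> sets borel" and disj: "A \<inter> B = {}"
  shows "AE \<omega> in M. fluctuation (A \<union> B) \<omega> = fluctuation A \<omega> + fluctuation B \<omega>"
  using AE_integrable_field_integral[OF A, of 0] AE_integrable_field_integral[OF B, of 0]
proof eventually_elim
  fix \<omega> assume i: "set_integrable lborel A (\<lambda>t. X (t + 0) \<omega>)" "set_integrable lborel B (\<lambda>t. X (t + 0) \<omega>)"
  have "measure lborel (A \<union> B) = measure lborel A + measure lborel B"
    using A B disj emeasure_bounded_finite[OF A(1)] emeasure_bounded_finite[OF B(1)]
    by (intro measure_Union) auto
  then show "fluctuation (A \<union> B) \<omega> = fluctuation A \<omega> + fluctuation B \<omega>"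
    using set_integral_Un[OF disj i] by (simp add: fluctuation_def field_integral_def algebra_simps)
qed

lemma fluctuation_eq_centered:
  assumes A: "bounded A" "A \<in> sets borel"
  shows "AE \<omega> in M. fluctuation A \<omega> = (LINT t:A|lborel. centered t \<omega>)"
  using AE_integrable_field_integral[OF A, of 0]
proof eventually_elim
  fix \<omega> assume i: "set_integrable lborel A (\<lambda>t. X (t + 0) \<omega>)"
  have fin: "emeasure lborel A < \<infinity>" by (rule emeasure_bounded_finite[OF A(1)])
  have c: "set_integrable lborel A (\<lambda>t. mean)"
    unfolding set_integrable_def using A fin by (intro integrable_scaleR_left integrable_real_indicator) auto
  have "(LINT t:A|lborel. mean) = mean * measure lborel A"
    using A fin by (simp add: set_integral_const)
  then show "fluctuation A \<omega> = (LINT t:A|lborel. centered t \<omega>)"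
    using set_integral_diff(2)[OF i c] by (simp add: fluctuation_def field_integral_def centered_def)
qed

end

section \<open>The variance of a window integral\<close>

context stationary_L2_field begin

text \<open>
  The factor of the autocovariance is the covariogram of \<open>A\<close>, the volume of the intersection of
  \<open>A\<close> with its translate by \<open>- h\<close>.
\<close>

definition window_variance :: "(real ^ 'd) set \<Rightarrow> real" where
  "window_variance A = (\<integral>h. autocov h * measure lborel {s \<in> A. s + h \<in> A} \<partial>lborel)"

text \<open>
  The square of the integral is a double integral over \<open>A \<times> A\<close>. Taking expectations replaces the
  product by the autocovariance of the lag, and substituting \<open>t = s + h\<close> before exchanging the order
  of integration yields the covariogram, which is bounded by the volume of \<open>A\<close>.
\<close>

lemma
  assumes A: "bounded A" "A \<in> sets borel" and C: "integrable lborel autocov"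
  shows square_integrable_fluctuation: "integrable M (\<lambda>\<omega>. (fluctuation A \<omega>)\<^sup>2)"
    and second_moment_fluctuation: "(\<integral>\<omega>. (fluctuation A \<omega>)\<^sup>2 \<partial>M) = window_variance A"
    and window_variance_le: "window_variance A \<le> measure lborel A * (\<integral>h. \<bar>autocov h\<bar> \<partial>lborel)"
proof -
  let ?N = "lborel \<Otimes>\<^sub>M lborel :: ((real ^ 'd) \<times> (real ^ 'd)) measure"
  have [measurable]: "A \<in> sets borel" by fact
  have fin: "emeasure lborel A < \<infinity>" by (rule emeasure_bounded_finite[OF A(1)])
  define Y where "Y p \<omega> = centered (fst p) \<omega> * centered (snd p) \<omega>" for p :: "(real ^ 'd) \<times> (real ^ 'd)" and \<omega>
  have sf: "sigma_finite_measure ?N" by (rule lborel_pair.sigma_finite_measure_axioms)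
  have jm: "(\<lambda>(\<omega>, p). Y p \<omega>) \<in> borel_measurable (M \<Otimes>\<^sub>M ?N)"
    unfolding Y_def by (simp add: split_beta')
  have AA: "A \<times> A \<in> sets ?N" by simp
  have "emeasure ?N (A \<times> A) = emeasure lborel A * emeasure lborel A"
    by (simp add: lborel.emeasure_pair_measure_Times)
  then have finAA: "emeasure ?N (A \<times> A) < \<infinity>" using fin by (simp add: ennreal_mult_less_top)
  have iY: "integrable M (Y p)" for p unfolding Y_def by (rule integrable_centered_mult)
  have bY: "(\<integral>\<omega>. \<bar>Y p \<omega>\<bar> \<partial>M) \<le> 2 * autocov 0" for p
  proof -
    have "(\<integral>\<omega>. \<bar>Y p \<omega>\<bar> \<partial>M) \<le> (\<integral>\<omega>. (centered (fst p) \<omega>)\<^sup>2 + (centered (snd p) \<omega>)\<^sup>2 \<partial>M)"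
    proof (rule integral_mono)
      show "\<bar>Y p \<omega>\<bar> \<le> (centered (fst p) \<omega>)\<^sup>2 + (centered (snd p) \<omega>)\<^sup>2" for \<omega>
        unfolding Y_def by (rule abs_centered_mult_le)
    qed (use iY square_integrable_centered in auto)
    also have "\<dots> = 2 * autocov 0"
      using autocov_eq[of "fst p" "fst p"] autocov_eq[of "snd p" "snd p"] square_integrable_centered
      by (simp add: power2_eq_square)
    finally show ?thesis .
  qed
  note fub = sf jm AA finAA iY bY
  have ae: "AE \<omega> in M. (LINT p:A\<times>A|?N. Y p \<omega>) = (fluctuation A \<omega>)\<^sup>2"
    using AE_set_integrable[OF fub] fluctuation_eq_centered[OF A]
  proof eventually_elim
    fix \<omega> assume i: "set_integrable ?N (A \<times> A) (\<lambda>p. Y p \<omega>)" and J: "fluctuation A \<omega> = (LINT t:A|lborel. centered t \<omega>)"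
    have "(LINT p:A\<times>A|?N. Y p \<omega>) = (\<integral>s. (\<integral>t. indicator (A \<times> A) (s, t) *\<^sub>R Y (s, t) \<omega> \<partial>lborel) \<partial>lborel)"
      using i unfolding set_lebesgue_integral_def set_integrable_def
      by (rule lborel_pair.integral_fst'[symmetric])
    also have "\<dots> = (\<integral>s. (\<integral>t. (indicator A s * centered s \<omega>) * (indicator A t * centered t \<omega>) \<partial>lborel) \<partial>lborel)"
      by (simp add: Y_def indicator_times algebra_simps)
    also have "\<dots> = (fluctuation A \<omega>)\<^sup>2"
      unfolding J by (simp add: set_lebesgue_integral_def power2_eq_square)
    finally show "(LINT p:A\<times>A|?N. Y p \<omega>) = (fluctuation A \<omega>)\<^sup>2" .
  qed
  have [measurable]: "fluctuation A \<in> borel_measurable M" using integrable_fluctuation[OF A] by auto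
  show "integrable M (\<lambda>\<omega>. (fluctuation A \<omega>)\<^sup>2)"
    by (rule integrable_cong_AE_imp[OF integrable_set_integral[OF fub]]) (use ae in auto)
  have eq: "(\<integral>\<omega>. (fluctuation A \<omega>)\<^sup>2 \<partial>M) = (LINT p:A\<times>A|?N. autocov (snd p - fst p))"
  proof -
    have "(\<integral>\<omega>. (fluctuation A \<omega>)\<^sup>2 \<partial>M) = (\<integral>\<omega>. (LINT p:A\<times>A|?N. Y p \<omega>) \<partial>M)"
      using integrable_set_integral[OF fub] ae by (intro integral_cong_AE) auto
    also have "\<dots> = (LINT p:A\<times>A|?N. autocov (snd p - fst p))"
      by (simp add: expectation_set_integral[OF fub]) (simp add: Y_def autocov_eq)
    finally show ?thesis .
  qed
  have int: "set_integrable ?N (A \<times> A) (\<lambda>p. autocov (snd p - fst p))"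
    using set_integrable_expectation[OF fub] by (simp add: Y_def autocov_eq)
  let ?g = "\<lambda>(s, h). indicator A s * indicator A (s + h) * autocov h"
  have mg: "?g \<in> borel_measurable ?N" by (simp add: split_beta')
  have int_g: "integrable ?N ?g"
  proof (rule lborel_pair.Fubini_integrable[OF mg])
    have "integrable lborel (\<lambda>h. indicator A (s + h) * autocov h)" for s
      using C by (rule Bochner_Integration.integrable_bound) (auto simp: indicator_def)
    then show "AE s in lborel. integrable lborel (\<lambda>h. ?g (s, h))"
      by (auto simp: mult.assoc)
    show "integrable lborel (\<lambda>s. \<integral>h. norm (?g (s, h)) \<partial>lborel)"
    proof (rule Bochner_Integration.integrable_bound)
      show "integrable lborel (\<lambda>s. indicator A s * (\<integral>h. \<bar>autocov h\<bar> \<partial>lborel))"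
        using fin by (intro integrable_mult_left integrable_real_indicator) auto
      show "(\<lambda>s. \<integral>h. norm (?g (s, h)) \<partial>lborel) \<in> borel_measurable lborel"
        using mg by (intro lborel.borel_measurable_lebesgue_integral) simp
      have "(\<integral>h. \<bar>indicator A (s + h) * autocov h\<bar> \<partial>lborel) \<le> (\<integral>h. \<bar>autocov h\<bar> \<partial>lborel)" for s
        using C by (intro integral_mono Bochner_Integration.integrable_bound[OF C])
          (auto simp: indicator_def)
      then show "AE s in lborel. norm (\<integral>h. norm (?g (s, h)) \<partial>lborel) \<le> norm (indicator A s * (\<integral>h. \<bar>autocov h\<bar> \<partial>lborel))"
        by (intro AE_I2) (auto simp: indicator_def)
    qed
  qed
  have m_eq: "(\<integral>s. indicator A s * indicator A (s + h) \<partial>lborel) = measure lborel {s \<in> A. s + h \<in> A}" for h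
  proof -
    have "(\<integral>s. indicator A s * indicator A (s + h) \<partial>lborel) = (\<integral>s. indicator {s \<in> A. s + h \<in> A} s \<partial>lborel :: real)"
      by (intro Bochner_Integration.integral_cong) (auto simp: indicator_def)
    then show ?thesis by simp
  qed
  have "(LINT p:A\<times>A|?N. autocov (snd p - fst p)) = (\<integral>s. (\<integral>t. indicator (A \<times> A) (s, t) *\<^sub>R autocov (t - s) \<partial>lborel) \<partial>lborel)"
    using lborel_pair.integral_fst'[OF int[unfolded set_integrable_def]]
    by (simp add: set_lebesgue_integral_def)
  also have "\<dots> = (\<integral>s. (\<integral>h. ?g (s, h) \<partial>lborel) \<partial>lborel)"
  proof (rule Bochner_Integration.integral_cong[OF refl])
    fix s
    have "(\<integral>t. indicator (A \<times> A) (s, t + s) *\<^sub>R autocov (t + s - s) \<partial>lborel) = (\<integral>t. indicator (A \<times> A) (s, t) *\<^sub>R autocov (t - s) \<partial>lborel)"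
      by (rule integral_translate[where f="\<lambda>t. indicator (A \<times> A) (s, t) *\<^sub>R autocov (t - s)"]) measurable
    then show "(\<integral>t. indicator (A \<times> A) (s, t) *\<^sub>R autocov (t - s) \<partial>lborel) = (\<integral>h. ?g (s, h) \<partial>lborel)"
      by (simp add: indicator_times add.commute)
  qed
  also have "\<dots> = (\<integral>h. (\<integral>s. ?g (s, h) \<partial>lborel) \<partial>lborel)"
    using lborel_pair.Fubini_integral[of "\<lambda>s h. ?g (s, h)"] int_g by simp
  also have "\<dots> = window_variance A"
    unfolding window_variance_def using m_eq by (simp add: mult.commute[of _ "autocov _"])
  finally show "(\<integral>\<omega>. (fluctuation A \<omega>)\<^sup>2 \<partial>M) = window_variance A" using eq by simp
  have le: "measure lborel {s \<in> A. s + h \<in> A} \<le> measure lborel A" for h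
    using fin by (intro measure_mono_fmeasurable) (auto simp: fmeasurable_def)
  have "window_variance A \<le> (\<integral>h. \<bar>autocov h\<bar> * measure lborel A \<partial>lborel)"
    unfolding window_variance_def
  proof (rule integral_mono_AE)
    have "integrable lborel (\<lambda>h. \<integral>s. ?g (s, h) \<partial>lborel)"
      using lborel_pair.integrable_snd[of "\<lambda>s h. ?g (s, h)"] int_g by simp
    then show "integrable lborel (\<lambda>h. autocov h * measure lborel {s \<in> A. s + h \<in> A})"
      using m_eq by (simp add: mult.commute[of _ "autocov _"])
    show "AE h in lborel. autocov h * measure lborel {s \<in> A. s + h \<in> A} \<le> \<bar>autocov h\<bar> * measure lborel A"
      by (intro AE_I2 mult_mono le) auto
  qed (use C in simp)
  then show "window_variance A \<le> measure lborel A * (\<integral>h. \<bar>autocov h\<bar> \<partial>lborel)"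
    by (simp add: mult.commute)
qed

abbreviation cube :: "real \<Rightarrow> (real ^ 'd) set" where
  "cube b \<equiv> half_open_box 0 (\<chi> i. b)"

text \<open>
  For a fixed lag \<open>h\<close>, a cube of side \<open>b\<close> meets its translate by \<open>h\<close> in a set that contains a cube of
  side \<open>b - 2 |h|\<close>. Hence the normalised covariogram tends to 1, and dominated convergence applies.
\<close>

lemma variance_cube_tendsto:
  assumes C: "integrable lborel autocov" and b: "filterlim b at_top sequentially"
  shows "(\<lambda>n. window_variance (cube (b n)) / b n ^ CARD('d)) \<longlonglongrightarrow> (\<integral>h. autocov h \<partial>lborel)"
proof -
  let ?D = "CARD('d)"
  define m where "m n h = measure lborel {s \<in> cube (b n). s + h \<in> cube (b n)} / b n ^ ?D" for n and h :: "real ^ 'd"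
  have lower: "(1 - 2 * norm h / y) ^ ?D \<le> measure lborel {s \<in> cube y. s + h \<in> cube y} / y ^ ?D"
    if y: "y > 0" "y \<ge> 2 * norm h" for y and h :: "real ^ 'd"
  proof -
    let ?s = "half_open_box (\<chi> i. norm h) (\<chi> i. y - norm h) :: (real ^ 'd) set"
    have "?s \<subseteq> {s \<in> cube y. s + h \<in> cube y}"
    proof
      fix s assume s: "s \<in> ?s"
      have "norm h \<le> s $ i \<and> s $ i < y - norm h \<and> \<bar>h $ i\<bar> \<le> norm h" for i
        using s component_le_norm_cart[of h i] by (auto simp: half_open_box_def)
      then have "0 \<le> s $ i \<and> s $ i < y \<and> 0 \<le> s $ i + h $ i \<and> s $ i + h $ i < y" for i
        by (smt (verit) norm_ge_zero)
      then show "s \<in> {s \<in> cube y. s + h \<in> cube y}" by (auto simp: half_open_box_def)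
    qed
    then have "measure lborel ?s \<le> measure lborel {s \<in> cube y. s + h \<in> cube y}"
      by (rule measure_mono_fmeasurable)
         (auto intro!: bounded_fmeasurable bounded_subset[OF bounded_half_open_box[of 0 "\<chi> i. y"]])
    moreover have "measure lborel ?s = (y - 2 * norm h) ^ ?D"
      using y by (subst half_open_box_measure) auto
    moreover have "(1 - 2 * norm h / y) ^ ?D = (y - 2 * norm h) ^ ?D / y ^ ?D"
      using y by (simp add: power_divide[symmetric] diff_divide_distrib)
    ultimately show ?thesis using y by (simp add: divide_right_mono)
  qed
  have upper: "measure lborel {s \<in> cube y. s + h \<in> cube y} / y ^ ?D \<le> 1" if y: "y > 0" for y and h :: "real ^ 'd"
  proof -
    have "measure lborel {s \<in> cube y. s + h \<in> cube y} \<le> measure lborel (cube y :: (real ^ 'd) set)"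
      by (rule measure_mono_fmeasurable)
         (auto intro!: bounded_fmeasurable bounded_half_open_box)
    also have "\<dots> = y ^ ?D" using y by (subst half_open_box_measure) auto
    finally show ?thesis using y by simp
  qed
  have pos: "eventually (\<lambda>n. b n > 0) sequentially" using b by (rule filterlim_at_top_dense[THEN iffD1, rule_format])
  have m_lim: "(\<lambda>n. m n h) \<longlonglongrightarrow> 1" for h
  proof (rule tendsto_sandwich)
    have "eventually (\<lambda>n. b n \<ge> 2 * norm h) sequentially" using b by (simp add: filterlim_at_top)
    with pos show "\<forall>\<^sub>F n in sequentially. (1 - 2 * norm h / b n) ^ ?D \<le> m n h"
      by eventually_elim (unfold m_def, rule lower)
    show "\<forall>\<^sub>F n in sequentially. m n h \<le> 1"
      using pos by eventually_elim (unfold m_def, rule upper)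
    have "(\<lambda>n. 2 * norm h / b n) \<longlonglongrightarrow> 0"
      by (rule tendsto_divide_0[OF tendsto_const filterlim_at_top_imp_at_infinity[OF b]])
    then have "(\<lambda>n. (1 - 2 * norm h / b n) ^ ?D) \<longlonglongrightarrow> (1 - 0) ^ ?D" by (intro tendsto_intros)
    then show "(\<lambda>n. (1 - 2 * norm h / b n) ^ ?D) \<longlonglongrightarrow> 1" by simp
  qed simp
  obtain N where N: "\<And>n. n \<ge> N \<Longrightarrow> b n > 0" using pos by (auto simp: eventually_sequentially)
  have "(\<lambda>n. \<integral>h. autocov h * m (n + N) h \<partial>lborel) \<longlonglongrightarrow> (\<integral>h. autocov h \<partial>lborel)"
  proof (rule integral_dominated_convergence[where w="\<lambda>h. \<bar>autocov h\<bar>"])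
    show "AE h in lborel. (\<lambda>n. autocov h * m (n + N) h) \<longlonglongrightarrow> autocov h"
      using tendsto_mult[OF tendsto_const LIMSEQ_ignore_initial_segment[OF m_lim]] by (intro AE_I2) fastforce
    show "AE h in lborel. norm (autocov h * m (n + N) h) \<le> \<bar>autocov h\<bar>" for n
    proof (intro AE_I2)
      fix h
      have "0 \<le> m (n + N) h" "m (n + N) h \<le> 1"
        unfolding m_def using N[of "n + N"] by (simp, intro upper) simp
      then show "norm (autocov h * m (n + N) h) \<le> \<bar>autocov h\<bar>"
        by (simp add: abs_mult mult_left_le)
    qed
    have "m n \<in> borel_measurable borel" for n
    proof -
      have "(\<lambda>h. \<integral>s. indicator (cube (b n)) s * indicator (cube (b n)) (s + h) / b n ^ ?D \<partial>lborel) \<in> borel_measurable borel"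
        by (rule lborel.borel_measurable_lebesgue_integral) measurable
      also have "(\<lambda>h. \<integral>s. indicator (cube (b n)) s * indicator (cube (b n)) (s + h) / b n ^ ?D \<partial>lborel) = m n"
      proof
        fix h
        have "(\<integral>s. indicator (cube (b n)) s * indicator (cube (b n)) (s + h) \<partial>lborel)
            = (\<integral>s. indicator {s \<in> cube (b n). s + h \<in> cube (b n)} s \<partial>lborel :: real)"
          by (intro Bochner_Integration.integral_cong) (auto simp: indicator_def)
        then show "(\<integral>s. indicator (cube (b n)) s * indicator (cube (b n)) (s + h) / b n ^ ?D \<partial>lborel) = m n h"
          by (simp add: m_def)
      qed
      finally show ?thesis .
    qed
    then show "(\<lambda>h. autocov h * m (n + N) h) \<in> borel_measurable lborel" for n by simp
  qed (use C in auto)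
  then have "(\<lambda>n. \<integral>h. autocov h * m n h \<partial>lborel) \<longlonglongrightarrow> (\<integral>h. autocov h \<partial>lborel)" by (rule LIMSEQ_offset)
  then show ?thesis by (simp add: window_variance_def m_def flip: integral_divide_zero)
qed

end

section \<open>Decorrelation of separated windows\<close>

locale BL_field = stationary_L2_field M X
  for M :: "'w measure" and X :: "real ^ 'd \<Rightarrow> 'w \<Rightarrow> real" +
  fixes \<theta> :: "nat \<Rightarrow> real"
  assumes theta_decseq: "decseq \<theta>" and theta_lim: "\<theta> \<longlonglongrightarrow> 0"
    and BL: "BL_dependent M \<theta> X"
begin

lemma theta_nonneg: "0 \<le> \<theta> r"
  using decseq_ge[OF theta_decseq theta_lim] .

text \<open>
  The cancellation of the powers of \<open>k\<close>. The number of grid points in \<open>B\<close> contributes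
  \<open>|B| k\<^sup>d\<close>, each of the two Riemann sums contributes the inverse of \<open>k\<^sup>d\<close>, and the dependence
  condition itself contributes \<open>k\<^sup>d\<close>. The condition requires a mesh parameter larger than 1, whence
  \<open>k \<ge> 2\<close>.
\<close>

lemma covariance_riemann_sum_le:
  fixes A B :: "(real ^ 'd) set"
  assumes A: "bounded A"
    and B: "bounded B" "B \<in> sets borel" "aligned B"
    and F: "lipschitz_test L F" "lipschitz_test L' F'"
    and r: "r \<ge> 1" and sep: "\<And>x y. x \<in> A \<Longrightarrow> y \<in> B \<Longrightarrow> real r \<le> l1_norm (x - y)"
    and k: "k \<ge> 2"
  shows "covariance M (\<lambda>\<omega>. F (riemann_sum k 0 A \<omega>)) (\<lambda>\<omega>. F' (riemann_sum k 0 B \<omega>)) \<le> L * L' * measure lborel B * \<theta> r"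
proof -
  let ?I = "grid (real k) \<inter> A" and ?J = "grid (real k) \<inter> B"
  let ?c = "real k ^ CARD('d)"
  have c: "?c > 0" using k by simp
  have L: "0 \<le> L" "0 \<le> L'" using F by (auto simp: lipschitz_test_def)
  have fin: "finite ?I" "finite ?J" using k A B by (auto intro!: finite_grid_Int)
  show ?thesis
  proof (cases "?I = {} \<or> ?J = {}")
    case True
    have "0 \<le> L * L' * measure lborel B * \<theta> r" using L theta_nonneg by simp
    moreover have "covariance M (\<lambda>\<omega>. F (riemann_sum k 0 A \<omega>)) (\<lambda>\<omega>. F' (riemann_sum k 0 B \<omega>)) = 0"
      using True
    proof
      assume "?I = {}" then show ?thesis by (simp add: riemann_sum_def covariance_def prob_space)
    next
      assume "?J = {}" then show ?thesis by (simp add: riemann_sum_def covariance_def prob_space)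
    qed
    ultimately show ?thesis by simp
  next
    case False
    let ?f = "\<lambda>v. F ((\<Sum>i<card ?I. v i) / ?c)" and ?g = "\<lambda>v. F' ((\<Sum>i<card ?J. v i) / ?c)"
    have n: "card ?I > 0" "card ?J > 0" using False fin by (auto simp: card_gt_0_iff)
    have vec: "(\<Sum>i<card K. field_vec X K \<omega> i) = (\<Sum>g\<in>K. X g \<omega>)" if "finite K" for K \<omega>
      using sum.reindex_bij_betw[OF bij_betw_from_nat_into_finite[OF that], of "\<lambda>g. X g \<omega>"]
      by (simp add: field_vec_def)
    have f: "?f (field_vec X ?I \<omega>) = F (riemann_sum k 0 A \<omega>)" for \<omega> using vec[OF fin(1)] by (simp add: riemann_sum_def)
    have g: "?g (field_vec X ?J \<omega>) = F' (riemann_sum k 0 B \<omega>)" for \<omega> using vec[OF fin(2)] by (simp add: riemann_sum_def)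
    have disj: "?I \<inter> ?J = {}"
    proof -
      { fix x assume "x \<in> A" "x \<in> B"
        from sep[OF this] r have False by (simp add: l1_norm_def) }
      then show ?thesis by blast
    qed
    have dist: "real r \<le> l1_set_dist ?I ?J"
    proof -
      have eq: "{l1_norm (x - y) |x y. x \<in> ?I \<and> y \<in> ?J} = (\<lambda>(x, y). l1_norm (x - y)) ` (?I \<times> ?J)" by auto
      show ?thesis unfolding l1_set_dist_def eq
        using fin False sep by (intro Min.boundedI) auto
    qed
    note bf = average_bounded_lipschitz[OF F(1) n(1) c] and bg = average_bounded_lipschitz[OF F(2) n(2) c]
    have "covariance M (\<lambda>\<omega>. ?f (field_vec X ?I \<omega>)) (\<lambda>\<omega>. ?g (field_vec X ?J \<omega>))
          \<le> real (min (card ?I) (card ?J)) * Lip (card ?I) ?f * Lip (card ?J) ?g * real k ^ CARD('d) * \<theta> r"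
      using BL[unfolded BL_dependent_def, rule_format, of r "real k" ?I ?J ?f ?g] r k fin False disj dist bf(1) bg(1)
      by auto
    also have "\<dots> \<le> real (card ?J) * (L / ?c) * (L' / ?c) * ?c * \<theta> r"
      using bf(2,3) bg(2,3) theta_nonneg L c
      by (intro mult_mono mult_right_mono) auto
    also have "real (card ?J) = measure lborel B * ?c"
      using k by (intro card_grid_Int B) auto
    also have "measure lborel B * ?c * (L / ?c) * (L' / ?c) * ?c * \<theta> r = L * L' * measure lborel B * \<theta> r"
      using c by (simp add: field_simps)
    finally show ?thesis unfolding f g .
  qed
qed

text \<open>
  The dependence condition bounds covariances from above only; replacing \<open>F\<close> by \<open>- F\<close> gives the bound
  from below.
\<close>

lemma covariance_field_integral_le:
  fixes A B :: "(real ^ 'd) set"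
  assumes A: "bounded A" "A \<in> sets borel" "aligned A"
    and B: "bounded B" "B \<in> sets borel" "aligned B"
    and F: "lipschitz_test L F" "lipschitz_test L' F'"
    and r: "r \<ge> 1" and sep: "\<And>x y. x \<in> A \<Longrightarrow> y \<in> B \<Longrightarrow> real r \<le> l1_norm (x - y)"
  shows "\<bar>covariance M (\<lambda>\<omega>. F (field_integral 0 A \<omega>)) (\<lambda>\<omega>. F' (field_integral 0 B \<omega>))\<bar> \<le> L * L' * measure lborel B * \<theta> r"
proof -
  have upper: "covariance M (\<lambda>\<omega>. F (field_integral 0 A \<omega>)) (\<lambda>\<omega>. F' (field_integral 0 B \<omega>)) \<le> L * L' * measure lborel B * \<theta> r"
    if F: "lipschitz_test L F" for F
  proof (rule LIMSEQ_le_const2)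
    show "(\<lambda>k. covariance M (\<lambda>\<omega>. F (riemann_sum k 0 A \<omega>)) (\<lambda>\<omega>. F' (riemann_sum k 0 B \<omega>)))
       \<longlonglongrightarrow> covariance M (\<lambda>\<omega>. F (field_integral 0 A \<omega>)) (\<lambda>\<omega>. F' (field_integral 0 B \<omega>))"
      by (rule covariance_lipschitz_test_tendsto[OF F \<open>lipschitz_test L' F'\<close>])
         (auto intro!: integrable_field_integral integrable_riemann_sum riemann_approx A B)
    show "\<exists>N. \<forall>k\<ge>N. covariance M (\<lambda>\<omega>. F (riemann_sum k 0 A \<omega>)) (\<lambda>\<omega>. F' (riemann_sum k 0 B \<omega>)) \<le> L * L' * measure lborel B * \<theta> r"
      using covariance_riemann_sum_le[OF A(1) B F \<open>lipschitz_test L' F'\<close> r sep] by blast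
  qed
  have "covariance M (\<lambda>\<omega>. - F (field_integral 0 A \<omega>)) (\<lambda>\<omega>. F' (field_integral 0 B \<omega>))
      = - covariance M (\<lambda>\<omega>. F (field_integral 0 A \<omega>)) (\<lambda>\<omega>. F' (field_integral 0 B \<omega>))"
  proof -
    have "covariance M (\<lambda>\<omega>. - F (field_integral 0 A \<omega>)) (\<lambda>\<omega>. F' (field_integral 0 B \<omega>))
      = (\<integral>\<omega>. - ((F (field_integral 0 A \<omega>) - (\<integral>\<omega>. F (field_integral 0 A \<omega>) \<partial>M)) * (F' (field_integral 0 B \<omega>) - (\<integral>\<omega>. F' (field_integral 0 B \<omega>) \<partial>M))) \<partial>M)"
      unfolding covariance_def by (intro Bochner_Integration.integral_cong refl) (simp add: algebra_simps)
    then show ?thesis unfolding covariance_def by simp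
  qed
  with upper[OF F(1)] upper[OF lipschitz_test_uminus[OF F(1)]] show ?thesis by simp
qed

text \<open>
  The real and the imaginary part of the difference are signed sums of two covariances each, between
  sines and cosines of the fluctuations. As functions of the integrals these have the Lipschitz
  constant \<open>|u|\<close>.
\<close>

lemma decorrelation:
  fixes A B :: "(real ^ 'd) set"
  assumes A: "bounded A" "A \<in> sets borel" "aligned A"
    and B: "bounded B" "B \<in> sets borel" "aligned B"
    and r: "r \<ge> 1" and sep: "\<And>x y. x \<in> A \<Longrightarrow> y \<in> B \<Longrightarrow> real r \<le> l1_norm (x - y)"
  shows "cmod ((\<integral>\<omega>. iexp (u * fluctuation A \<omega>) * iexp (u * fluctuation B \<omega>) \<partial>M)
        - (\<integral>\<omega>. iexp (u * fluctuation A \<omega>) \<partial>M) * (\<integral>\<omega>. iexp (u * fluctuation B \<omega>) \<partial>M))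
     \<le> 4 * u\<^sup>2 * measure lborel B * \<theta> r"
proof -
  let ?a = "mean * measure lborel A" and ?b = "mean * measure lborel B"
  have [measurable]: "fluctuation A \<in> borel_measurable M" "fluctuation B \<in> borel_measurable M"
    using integrable_fluctuation[OF A(1,2)] integrable_fluctuation[OF B(1,2)] by auto
  have trig: "lipschitz_test \<bar>u\<bar> (\<lambda>x. cos (u * (x - c)))" "lipschitz_test \<bar>u\<bar> (\<lambda>x. sin (u * (x - c)))" for c
  proof -
    have "\<bar>u * (x - c) - u * (y - c)\<bar> = \<bar>u\<bar> * \<bar>x - y\<bar>" for x y
      by (simp add: abs_mult[symmetric] algebra_simps)
    then show "lipschitz_test \<bar>u\<bar> (\<lambda>x. cos (u * (x - c)))" "lipschitz_test \<bar>u\<bar> (\<lambda>x. sin (u * (x - c)))"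
      using abs_cos_diff abs_sin_diff unfolding lipschitz_test_def by (metis abs_cos_le_one abs_ge_zero abs_sin_le_one)+
  qed
  let ?cov = "\<lambda>f g. covariance M (\<lambda>\<omega>. f (u * fluctuation A \<omega>)) (\<lambda>\<omega>. g (u * fluctuation B \<omega>))"
  have le: "\<bar>?cov f g\<bar> \<le> u\<^sup>2 * measure lborel B * \<theta> r"
    if "f = cos \<or> f = sin" "g = cos \<or> g = sin" for f g
  proof -
    have "lipschitz_test \<bar>u\<bar> (\<lambda>x. f (u * (x - ?a)))" "lipschitz_test \<bar>u\<bar> (\<lambda>x. g (u * (x - ?b)))"
      using that trig by auto
    from covariance_field_integral_le[OF A B this r sep] show ?thesis
      by (simp add: fluctuation_def power2_eq_square)
  qed
  have bd: "\<bar>f x\<bar> \<le> 1" if "f = cos \<or> f = sin" for f and x :: real using that by auto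
  have fm: "f \<in> borel_measurable borel" if "f = cos \<or> f = sin" for f :: "real \<Rightarrow> real"
    using that by (auto intro!: borel_measurable_continuous_onI continuous_intros)
  have cov: "?cov f g = (\<integral>\<omega>. f (u * fluctuation A \<omega>) * g (u * fluctuation B \<omega>) \<partial>M)
      - (\<integral>\<omega>. f (u * fluctuation A \<omega>) \<partial>M) * (\<integral>\<omega>. g (u * fluctuation B \<omega>) \<partial>M)"
    if fg: "f = cos \<or> f = sin" "g = cos \<or> g = sin" for f g
  proof -
    have [measurable]: "f \<in> borel_measurable borel" "g \<in> borel_measurable borel" using fm fg by auto
    show ?thesis by (rule covariance_bounded) (auto simp: bd[OF fg(1)] bd[OF fg(2)])
  qed
  have int: "integrable M (\<lambda>\<omega>. f (u * fluctuation A \<omega>) * g (u * fluctuation B \<omega>))"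
    if fg: "f = cos \<or> f = sin" "g = cos \<or> g = sin" for f g
  proof -
    have [measurable]: "f \<in> borel_measurable borel" "g \<in> borel_measurable borel" using fm fg by auto
    show ?thesis
      using bd[OF fg(1)] bd[OF fg(2)] by (auto intro!: integrable_const_bound[where B=1] AE_I2 abs_mult_le_one simp: abs_mult)
  qed
  have ReIm: "Re (\<integral>\<omega>. iexp (f \<omega>) \<partial>M) = (\<integral>\<omega>. cos (f \<omega>) \<partial>M)" "Im (\<integral>\<omega>. iexp (f \<omega>) \<partial>M) = (\<integral>\<omega>. sin (f \<omega>) \<partial>M)"
    if "f \<in> borel_measurable M" for f
    using integral_Re[OF integrable_iexp_real[OF that]] integral_Im[OF integrable_iexp_real[OF that]]
    by (simp_all add: iexp_eq_cos_sin)
  have i2: "integrable M (\<lambda>\<omega>. iexp (u * fluctuation A \<omega>) * iexp (u * fluctuation B \<omega>))"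
  proof -
    have "integrable M (\<lambda>\<omega>. iexp (u * fluctuation A \<omega> + u * fluctuation B \<omega>))" by (rule integrable_iexp_real) measurable
    then show ?thesis by (simp add: exp_add[symmetric] distrib_left)
  qed
  let ?D = "(\<integral>\<omega>. iexp (u * fluctuation A \<omega>) * iexp (u * fluctuation B \<omega>) \<partial>M)
        - (\<integral>\<omega>. iexp (u * fluctuation A \<omega>) \<partial>M) * (\<integral>\<omega>. iexp (u * fluctuation B \<omega>) \<partial>M)"
  have m: "(\<lambda>\<omega>. u * fluctuation A \<omega>) \<in> borel_measurable M" "(\<lambda>\<omega>. u * fluctuation B \<omega>) \<in> borel_measurable M" by measurable
  have "Re (\<integral>\<omega>. iexp (u * fluctuation A \<omega>) * iexp (u * fluctuation B \<omega>) \<partial>M)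
      = (\<integral>\<omega>. cos (u * fluctuation A \<omega>) * cos (u * fluctuation B \<omega>) - sin (u * fluctuation A \<omega>) * sin (u * fluctuation B \<omega>) \<partial>M)"
    using integral_Re[OF i2] unfolding iexp_eq_cos_sin by simp
  then have "Re ?D = ?cov cos cos - ?cov sin sin"
    using int by (simp add: cov ReIm[OF m(1)] ReIm[OF m(2)] algebra_simps del: of_real_mult)
  moreover have "Im (\<integral>\<omega>. iexp (u * fluctuation A \<omega>) * iexp (u * fluctuation B \<omega>) \<partial>M)
      = (\<integral>\<omega>. cos (u * fluctuation A \<omega>) * sin (u * fluctuation B \<omega>) + sin (u * fluctuation A \<omega>) * cos (u * fluctuation B \<omega>) \<partial>M)"
    using integral_Im[OF i2] unfolding iexp_eq_cos_sin by simp
  then have "Im ?D = ?cov cos sin + ?cov sin cos"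
    by (simp add: cov ReIm[OF m(1)] ReIm[OF m(2)] int del: of_real_mult)
  ultimately have "\<bar>Re ?D\<bar> + \<bar>Im ?D\<bar> \<le> 4 * (u\<^sup>2 * measure lborel B * \<theta> r)"
    using le[of cos cos] le[of sin sin] le[of cos sin] le[of sin cos] by simp
  with cmod_le[of ?D] show ?thesis by simp
qed

text \<open>
  The blocks are split off one after the other. Each step costs one application of the decorrelation
  inequality, in which only the volume \<open>v\<close> of the single block counts, however many blocks remain.
\<close>

lemma char_separated_union:
  fixes B :: "'z \<Rightarrow> (real ^ 'd) set"
  assumes "finite S"
    and "\<And>z. z \<in> S \<Longrightarrow> bounded (B z)" "\<And>z. z \<in> S \<Longrightarrow> B z \<in> sets borel" "\<And>z. z \<in> S \<Longrightarrow> aligned (B z)"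
    and "\<And>z. z \<in> S \<Longrightarrow> measure lborel (B z) = v"
    and "\<And>z. z \<in> S \<Longrightarrow> (\<integral>\<omega>. iexp (u * fluctuation (B z) \<omega>) \<partial>M) = \<phi>"
    and \<phi>: "cmod \<phi> \<le> 1" and r: "r \<ge> 1"
    and "\<And>z z' x y. z \<in> S \<Longrightarrow> z' \<in> S \<Longrightarrow> z \<noteq> z' \<Longrightarrow> x \<in> B z \<Longrightarrow> y \<in> B z' \<Longrightarrow> real r \<le> l1_norm (x - y)"
  shows "cmod ((\<integral>\<omega>. iexp (u * fluctuation (\<Union>z\<in>S. B z) \<omega>) \<partial>M) - \<phi> ^ card S) \<le> card S * (4 * u\<^sup>2 * v * \<theta> r)"
  using assms(1-6,9)
proof (induction S rule: finite_induct)
  case empty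
  then show ?case by (simp add: fluctuation_def field_integral_def set_lebesgue_integral_def prob_space)
next
  case (insert z S)
  let ?A = "\<Union>z\<in>S. B z"
  have A: "bounded ?A" "?A \<in> sets borel" "aligned ?A"
    using insert.hyps insert.prems by (auto intro!: bounded_UN sets.finite_UN aligned_Union)
  have B: "bounded (B z)" "B z \<in> sets borel" "aligned (B z)"
    using insert.prems by auto
  have sep: "real r \<le> l1_norm (x - y)" if "x \<in> ?A" "y \<in> B z" for x y
    using insert.hyps insert.prems(6) that by blast
  have disj: "?A \<inter> B z = {}"
  proof -
    { fix x assume "x \<in> ?A" "x \<in> B z"
      from sep[OF this] r have False by (simp add: l1_norm_def) }
    then show ?thesis by blast
  qed
  have [measurable]: "fluctuation ?A \<in> borel_measurable M" "fluctuation (B z) \<in> borel_measurable M" "fluctuation (?A \<union> B z) \<in> borel_measurable M"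
    using integrable_fluctuation A B by (auto intro!: borel_measurable_integrable)
  let ?a = "\<integral>\<omega>. iexp (u * fluctuation ?A \<omega>) \<partial>M"
  let ?p = "\<integral>\<omega>. iexp (u * fluctuation ?A \<omega>) * iexp (u * fluctuation (B z) \<omega>) \<partial>M"
  have IH: "cmod (?a - \<phi> ^ card S) \<le> card S * (4 * u\<^sup>2 * v * \<theta> r)"
    by (rule insert.IH) (blast intro: insert.prems)+
  have "(\<integral>\<omega>. iexp (u * fluctuation (\<Union>z\<in>insert z S. B z) \<omega>) \<partial>M) = (\<integral>\<omega>. iexp (u * fluctuation (?A \<union> B z) \<omega>) \<partial>M)"
    by (simp add: Un_commute)
  also have "\<dots> = ?p"
  proof (rule integral_cong_AE)
    show "AE \<omega> in M. iexp (u * fluctuation (?A \<union> B z) \<omega>) = iexp (u * fluctuation ?A \<omega>) * iexp (u * fluctuation (B z) \<omega>)"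
      using fluctuation_Un[OF A(1,2) B(1,2) disj] by eventually_elim (simp add: distrib_left exp_add)
  qed measurable
  finally have eq: "(\<integral>\<omega>. iexp (u * fluctuation (\<Union>z\<in>insert z S. B z) \<omega>) \<partial>M) = ?p" .
  have split: "?p - \<phi> ^ card (insert z S) = (?p - ?a * \<phi>) + (?a - \<phi> ^ card S) * \<phi>"
    using insert.hyps by (simp add: algebra_simps)
  have "cmod (?p - \<phi> ^ card (insert z S)) \<le> cmod (?p - ?a * \<phi>) + cmod (?a - \<phi> ^ card S) * cmod \<phi>"
    unfolding split norm_mult[symmetric] by (rule norm_triangle_ineq)
  moreover have "cmod (?p - ?a * \<phi>) \<le> 4 * u\<^sup>2 * v * \<theta> r"
    using decorrelation[OF A B r sep, of u] insert.prems(4,5)[of z] by simp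
  moreover have "cmod (?a - \<phi> ^ card S) * cmod \<phi> \<le> card S * (4 * u\<^sup>2 * v * \<theta> r)"
    using mult_mono[OF IH \<phi>] \<phi> order_trans[OF norm_ge_zero IH] by simp
  ultimately have "cmod (?p - \<phi> ^ card (insert z S)) \<le> 4 * u\<^sup>2 * v * \<theta> r + card S * (4 * u\<^sup>2 * v * \<theta> r)"
    by linarith
  also have "\<dots> = card (insert z S) * (4 * u\<^sup>2 * v * \<theta> r)"
    using insert.hyps by (simp add: algebra_simps)
  finally show ?case unfolding eq .
qed

end

section \<open>Blocks inside a Van Hove window\<close>

text \<open>
  For \<open>r = 0\<close> these cubes tile the space. Shortening them at the upper ends leaves corridors of width
  \<open>r\<close> between different blocks.
\<close>

definition block :: "nat \<Rightarrow> nat \<Rightarrow> int ^ 'd \<Rightarrow> (real ^ 'd) set" where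
  "block m r z = half_open_box (\<chi> i. real m * of_int (z $ i)) (\<chi> i. real m * of_int (z $ i) + (real m - real r))"

lemma mem_block:
  "x \<in> block m r z \<longleftrightarrow> (\<forall>i. real m * of_int (z $ i) \<le> x $ i \<and> x $ i < real m * of_int (z $ i) + (real m - real r))"
  by (simp add: block_def half_open_box_def)

lemma bounded_block: "bounded (block m r z)" and sets_block: "block m r z \<in> sets borel"
  unfolding block_def by (rule bounded_half_open_box, rule half_open_box_sets)

lemma measure_block: "r \<le> m \<Longrightarrow> measure lborel (block m r z :: (real ^ 'd) set) = (real m - real r) ^ CARD('d)"
  unfolding block_def by (subst half_open_box_measure) auto

lemma aligned_block: "r \<le> m \<Longrightarrow> aligned (block m r z)"
proof -
  assume rm: "r \<le> m"
  have "real m * of_int k \<le> of_int \<lfloor>y\<rfloor> \<and> of_int \<lfloor>y\<rfloor> < real m * of_int k + (real m - real r)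
     \<longleftrightarrow> real m * of_int k \<le> y \<and> y < real m * of_int k + (real m - real r)" for k y
  proof -
    have *: "of_int j \<le> real_of_int \<lfloor>y\<rfloor> \<longleftrightarrow> of_int j \<le> y" "real_of_int \<lfloor>y\<rfloor> < of_int j \<longleftrightarrow> y < of_int j" for j
      by (simp_all add: le_floor_iff floor_less_iff)
    show ?thesis
      using *(1)[of "int m * k"] *(2)[of "int m * k + (int m - int r)"] by simp
  qed
  then show ?thesis unfolding aligned_def mem_block by (simp add: grid_floor_def)
qed

lemma l1_norm_ge_component: "\<bar>x $ i\<bar> \<le> l1_norm x"
  unfolding l1_norm_def by (rule member_le_sum) auto

lemma block_separated:
  assumes "z \<noteq> z'" "x \<in> block m r z" "y \<in> block m r z'"
  shows "real r \<le> l1_norm (x - y)"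
proof -
  obtain i where i: "z $ i \<noteq> z' $ i" using assms(1) by (auto simp: vec_eq_iff)
  have gap: "real r \<le> b - a"
    if "p < q" "a < real m * of_int p + (real m - real r)" "real m * of_int q \<le> b" for p q :: int and a b
  proof -
    have "real m * (of_int p + 1) \<le> real m * of_int q"
      using that(1) by (intro mult_left_mono) auto
    then show ?thesis using that by (simp add: algebra_simps)
  qed
  have "real r \<le> \<bar>(x - y) $ i\<bar>"
    using i gap[of "z $ i" "z' $ i" "x $ i" "y $ i"] gap[of "z' $ i" "z $ i" "y $ i" "x $ i"] assms(2,3)
    unfolding mem_block by (cases "z $ i < z' $ i") (auto simp: abs_if not_less)
  also have "\<dots> \<le> l1_norm (x - y)" by (rule l1_norm_ge_component)
  finally show ?thesis .
qed

lemma block_subset: "block m r z \<subseteq> block m 0 z"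
proof
  fix x assume x: "x \<in> block m r z"
  have "real m * of_int (z $ i) \<le> x $ i \<and> x $ i < real m * of_int (z $ i) + (real m - real 0)" for i
    using x[unfolded mem_block, rule_format, of i] by auto
  then show "x \<in> block m 0 z" unfolding mem_block by blast
qed

lemma block_disjoint:
  assumes "z \<noteq> z'"
  shows "block m r z \<inter> block m r z' = {}"
proof -
  obtain i where i: "z $ i \<noteq> z' $ i" using assms(1) by (auto simp: vec_eq_iff)
  have False if "x \<in> block m r z" "x \<in> block m r z'" for x
  proof -
    have *: False if "p < q" "a < real m * of_int p + real m" "real m * of_int q \<le> a" for p q :: int and a
    proof -
      have "real m * (of_int p + 1) \<le> real m * of_int q"
        using that(1) by (intro mult_left_mono) auto
      then show ?thesis using that by (simp add: algebra_simps)
    qed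
    have "x \<in> block m 0 z" "x \<in> block m 0 z'" using that block_subset by blast+
    then show False
      using i *[of "z $ i" "z' $ i" "x $ i"] *[of "z' $ i" "z $ i" "x $ i"]
      unfolding mem_block by (cases "z $ i < z' $ i") (auto simp: not_less)
  qed
  then show ?thesis by blast
qed

lemma mem_block_floor:
  assumes m: "m \<ge> 1"
  shows "x \<in> block m 0 (\<chi> i. \<lfloor>x $ i / real m\<rfloor>)"
proof -
  have "real m * of_int \<lfloor>y / real m\<rfloor> \<le> y \<and> y < real m * of_int \<lfloor>y / real m\<rfloor> + real m" for y
  proof -
    have *: "real m * f \<le> y \<and> y < real m * f + real m" if "f \<le> y / real m" "y / real m < f + 1" for f
      using that m by (simp add: field_simps)
    show ?thesis by (rule *) linarith+
  qed
  then show ?thesis by (simp add: mem_block)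
qed

definition inner_blocks :: "nat \<Rightarrow> (real ^ 'd) set \<Rightarrow> (int ^ 'd) set" where
  "inner_blocks m W = {z. block m 0 z \<subseteq> W}"

lemma finite_inner_blocks:
  fixes W :: "(real ^ 'd) set"
  assumes m: "m \<ge> 1" and W: "bounded W"
  shows "finite (inner_blocks m W)"
proof (rule finite_imageD)
  \<comment> \<open>A cube inside \<open>W\<close> is identified by its lower corner, an integer point of \<open>W\<close>.\<close>
  let ?c = "\<lambda>z :: int ^ 'd. (\<chi> i. real m * of_int (z $ i)) :: real ^ 'd"
  have "?c z \<in> W" if "z \<in> inner_blocks m W" for z
  proof -
    have "?c z \<in> block m 0 z" using m by (simp add: mem_block)
    then show ?thesis using that by (auto simp: inner_blocks_def)
  qed
  moreover have "?c z \<in> grid (real 1)" for z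
    unfolding grid_def by (auto intro!: exI[of _ "\<chi> i. int m * z $ i"])
  ultimately have "?c ` inner_blocks m W \<subseteq> grid (real 1) \<inter> W" by blast
  then show "finite (?c ` inner_blocks m W)"
    by (rule finite_subset) (intro finite_grid_Int W order_refl)
  show "inj_on ?c (inner_blocks m W)"
    using m by (auto simp: inj_on_def vec_eq_iff)
qed

lemma measure_union_blocks:
  fixes S :: "(int ^ 'd) set"
  assumes "finite S" "r \<le> m"
  shows "measure lborel (\<Union>z\<in>S. block m r z) = card S * (real m - real r) ^ CARD('d)"
proof -
  have "measure lborel (\<Union>z\<in>S. block m r z) = (\<Sum>z\<in>S. measure lborel (block m r z))"
    using assms(1) emeasure_bounded_finite[OF bounded_block]
    by (intro measure_finite_Union) (auto simp: disjoint_family_on_def block_disjoint sets_block less_top)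
  then show ?thesis using assms(2) by (simp add: measure_block)
qed

lemma compact_set_plus:
  fixes A B :: "'a::real_normed_vector set"
  assumes "compact A" "compact B"
  shows "compact (A + B)"
proof -
  have "A + B = {x + y |x y. x \<in> A \<and> y \<in> B}" by (auto simp: set_plus_def)
  then show ?thesis using compact_sums[OF assms] by simp
qed

text \<open>
  A point of \<open>W\<close> outside the inner cubes lies in a cube that is not contained in \<open>W\<close>. The cube is
  connected, so it meets the boundary of \<open>W\<close>, and its diameter is at most \<open>m d\<close>.
\<close>

lemma uncovered_subset:
  fixes W :: "(real ^ 'd) set"
  assumes m: "m \<ge> 1"
  shows "W - (\<Union>z\<in>inner_blocks m W. block m 0 z) \<subseteq> frontier W + cball 0 (m * CARD('d))"
proof
  fix x assume x: "x \<in> W - (\<Union>z\<in>inner_blocks m W. block m 0 z)"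
  define z where "z = (\<chi> i. \<lfloor>x $ i / real m\<rfloor>)"
  have xz: "x \<in> block m 0 z" unfolding z_def by (rule mem_block_floor[OF m])
  with x have "\<not> block m 0 z \<subseteq> W" by (auto simp: inner_blocks_def)
  moreover have "convex (block m 0 z)"
  proof -
    have "block m 0 z = (\<Inter>i. {y. real m * of_int (z $ i) \<le> y $ i} \<inter> {y. y $ i < real m * of_int (z $ i) + real m})"
      by (auto simp: mem_block)
    moreover have "convex {y :: real ^ 'd. a \<le> y $ i}" "convex {y :: real ^ 'd. y $ i < a}" for a i
      using convex_halfspace_ge[of a "axis i 1 :: real ^ 'd"] convex_halfspace_lt[of "axis i 1 :: real ^ 'd" a]
      by (simp_all add: inner_axis' inner_real_def)
    ultimately show ?thesis by (auto intro!: convex_INT convex_Int)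
  qed
  ultimately have "block m 0 z \<inter> frontier W \<noteq> {}"
    using x xz by (intro connected_Int_frontier convex_connected) auto
  then obtain y where y: "y \<in> block m 0 z" "y \<in> frontier W" by blast
  have "\<bar>(x - y) $ i\<bar> \<le> real m" for i
    using xz y(1) unfolding mem_block by (auto simp: abs_le_iff) (smt (verit))+
  then have "(\<Sum>i\<in>UNIV. \<bar>(x - y) $ i\<bar>) \<le> (\<Sum>i\<in>(UNIV :: 'd set). real m)"
    by (intro sum_mono) simp
  then have "norm (x - y) \<le> m * CARD('d)"
    using norm_le_l1_cart[of "x - y"] by (simp add: mult.commute)
  then have "x - y \<in> cball 0 (m * CARD('d))" by simp
  with y(2) have "y + (x - y) \<in> frontier W + cball 0 (m * CARD('d))" by (rule set_plus_intro)
  then show "x \<in> frontier W + cball 0 (m * CARD('d))" by simp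
qed

text \<open>
  A large ball is covered by finitely many unit balls. This is why the Van Hove condition for the
  unit ball implies the same for balls of every radius.
\<close>

lemma measure_plus_cball_le:
  fixes R :: real
  shows "\<exists>K. \<forall>F :: (real ^ 'd) set. compact F \<longrightarrow> measure lborel (F + cball 0 R) \<le> K * measure lborel (F + cball 0 1)"
proof -
  obtain T :: "(real ^ 'd) set" where T: "finite T" "cball 0 R \<subseteq> (\<Union>x\<in>T. ball x 1)"
    using compact_cball[of "0 :: real ^ 'd" R] unfolding compact_eq_totally_bounded by (metis zero_less_one)
  have "measure lborel (F + cball 0 R) \<le> card T * measure lborel (F + cball 0 1)"
    if F: "compact F" for F :: "(real ^ 'd) set"
  proof -
    let ?G = "F + cball 0 1"
    have G: "compact ?G" by (intro compact_set_plus F compact_cball)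
    have tr: "(+) c ` ?G \<in> fmeasurable lborel" "measure lborel ((+) c ` ?G) = measure lborel ?G" for c
    proof -
      have c: "compact ((+) c ` ?G)" using G by (rule compact_translation)
      then show "(+) c ` ?G \<in> fmeasurable lborel"
        by (intro bounded_fmeasurable) (auto intro: compact_imp_bounded borel_compact)
      show "measure lborel ((+) c ` ?G) = measure lborel ?G"
        using measure_translation[of c ?G] c G by (simp add: measure_completion borel_compact)
    qed
    have "F + cball 0 R \<subseteq> (\<Union>c\<in>T. (+) c ` ?G)"
    proof
      fix x assume "x \<in> F + cball 0 R"
      then obtain a b where ab: "a \<in> F" "b \<in> cball 0 R" "x = a + b" by (auto simp: set_plus_def)
      then obtain c where c: "c \<in> T" "b \<in> ball c 1" using T(2) by blast
      then have "b - c \<in> cball 0 1" by (simp add: dist_norm norm_minus_commute less_imp_le)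
      with ab(1) have "a + (b - c) \<in> ?G" by (rule set_plus_intro)
      then have "x \<in> (+) c ` ?G" using ab(3) by (intro image_eqI[of _ _ "a + (b - c)"]) auto
      then show "x \<in> (\<Union>c\<in>T. (+) c ` ?G)" using c by blast
    qed
    moreover have "(\<Union>c\<in>T. (+) c ` ?G) \<in> fmeasurable lborel"
      using T tr by (intro fmeasurable.finite_UN) auto
    moreover have "F + cball 0 R \<in> sets lborel"
      using compact_set_plus[OF F compact_cball] by (simp add: borel_compact)
    ultimately have "measure lborel (F + cball 0 R) \<le> measure lborel (\<Union>c\<in>T. (+) c ` ?G)"
      by (intro measure_mono_fmeasurable)
    also have "\<dots> \<le> (\<Sum>c\<in>T. measure lborel ((+) c ` ?G))"
      using T tr by (intro measure_UNION_le) (auto simp: fmeasurable_def)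
    finally show ?thesis by (simp add: tr)
  qed
  then show ?thesis by blast
qed

text \<open>
  The boundary of a nonempty compact set is nonempty, so the numerator in the Van Hove condition is
  at least the volume of a unit ball, and the denominator has to diverge.
\<close>

lemma VH_volume_at_top:
  fixes W :: "nat \<Rightarrow> (real ^ 'd) set"
  assumes "VH_growing W"
  shows "filterlim (\<lambda>n. measure lborel (W n)) at_top sequentially"
proof -
  have W: "compact (W n)" "0 < measure lborel (W n)" for n using assms by (auto simp: VH_growing_def)
  let ?\<kappa> = "measure lborel (cball (0 :: real ^ 'd) 1)"
  have \<kappa>: "?\<kappa> > 0" by (simp add: content_cball_pos)
  have le: "?\<kappa> \<le> measure lborel (frontier (W n) + cball 0 1)" for n
  proof -
    have "W n \<noteq> {}" "W n \<noteq> UNIV" using W[of n] not_compact_UNIV by auto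
    then have "frontier (W n) \<noteq> {}" by (simp add: frontier_eq_empty)
    then obtain x where x: "x \<in> frontier (W n)" by blast
    have c: "compact (frontier (W n) + cball 0 1)"
      by (intro compact_set_plus compact_frontier W compact_cball)
    have "cball x 1 \<subseteq> frontier (W n) + cball 0 1"
    proof
      fix y assume "y \<in> cball x 1"
      then have "y - x \<in> cball 0 1" by (simp add: dist_norm norm_minus_commute)
      with x have "x + (y - x) \<in> frontier (W n) + cball 0 1" by (rule set_plus_intro)
      then show "y \<in> frontier (W n) + cball 0 1" by simp
    qed
    then have "measure lborel (cball x 1) \<le> measure lborel (frontier (W n) + cball 0 1)"
      using c by (intro measure_mono_fmeasurable bounded_fmeasurable) (auto intro: compact_imp_bounded borel_compact)
    then show ?thesis by (simp add: content_cball)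
  qed
  have "(\<lambda>n. ?\<kappa> / measure lborel (W n)) \<longlonglongrightarrow> 0"
  proof (rule tendsto_sandwich[OF _ _ tendsto_const])
    show "(\<lambda>n. measure lborel (frontier (W n) + cball 0 1) / measure lborel (W n)) \<longlonglongrightarrow> 0"
      using assms by (simp add: VH_growing_def)
    show "\<forall>\<^sub>F n in sequentially. ?\<kappa> / measure lborel (W n)
        \<le> measure lborel (frontier (W n) + cball 0 1) / measure lborel (W n)"
      using le by (intro always_eventually allI divide_right_mono) auto
  qed simp
  from tendsto_mult_right_zero[OF this, of "inverse ?\<kappa>"] \<kappa>
  have "(\<lambda>n. inverse (measure lborel (W n))) \<longlonglongrightarrow> 0" by (simp add: field_simps)
  then have "filterlim (\<lambda>n. inverse (inverse (measure lborel (W n)))) at_top sequentially"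
    by (rule filterlim_inverse_at_top) (use W(2) in auto)
  then show ?thesis by simp
qed

lemma VH_block_density:
  fixes W :: "nat \<Rightarrow> (real ^ 'd) set"
  assumes "VH_growing W" and m: "m \<ge> 1"
  shows "real (card (inner_blocks m (W n))) * real m ^ CARD('d) \<le> measure lborel (W n)"
    and "(\<lambda>n. real (card (inner_blocks m (W n))) / measure lborel (W n)) \<longlonglongrightarrow> 1 / real m ^ CARD('d)"
proof -
  let ?V = "\<lambda>n. measure lborel (W n)" and ?N = "\<lambda>n. real (card (inner_blocks m (W n)))"
  let ?U = "\<lambda>n. \<Union>z\<in>inner_blocks m (W n). block m 0 z"
  let ?D = "real m ^ CARD('d)"
  have W: "compact (W n)" "0 < ?V n" for n using assms by (auto simp: VH_growing_def)
  have fin: "finite (inner_blocks m (W n))" for n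
    by (intro finite_inner_blocks m compact_imp_bounded W)
  have Wf: "W n \<in> fmeasurable lborel" for n
    using W(1) by (intro bounded_fmeasurable) (auto intro: compact_imp_bounded borel_compact)
  have Us: "?U n \<subseteq> W n" for n by (auto simp: inner_blocks_def)
  have Um: "?U n \<in> sets lborel" for n using fin by (auto intro!: sets.finite_UN sets_block)
  have U: "measure lborel (?U n) = ?N n * ?D" for n
    using measure_union_blocks[OF fin, of 0 m] by simp
  have le: "?N n * ?D \<le> ?V n" for n
    using measure_mono_fmeasurable[OF Us Um Wf] by (simp add: U)
  then show "?N n * ?D \<le> ?V n" .
  obtain K where K: "\<And>F :: (real ^ 'd) set. compact F \<Longrightarrow>
      measure lborel (F + cball 0 (m * CARD('d))) \<le> K * measure lborel (F + cball 0 1)"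
    using measure_plus_cball_le by blast
  have ge: "?V n - ?N n * ?D \<le> K * measure lborel (frontier (W n) + cball 0 1)" for n
  proof -
    have c: "compact (frontier (W n) + cball 0 (real (m * CARD('d))))"
      by (intro compact_set_plus compact_frontier W compact_cball)
    have "?V n - ?N n * ?D = measure lborel (W n - ?U n)"
      
    proof -
      have "emeasure lborel (W n) \<noteq> \<infinity>" using Wf[of n] by (auto simp: fmeasurable_def)
      from measure_Diff[OF this _ Um Us] show ?thesis using Wf[of n] U by (simp add: fmeasurable_def)
    qed
    also have "\<dots> \<le> measure lborel (frontier (W n) + cball 0 (m * CARD('d)))"
      using c sets.Diff[OF fmeasurableD[OF Wf] Um, of n n]
      by (intro measure_mono_fmeasurable uncovered_subset m bounded_fmeasurable)
        (auto intro: compact_imp_bounded borel_compact)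
    also have "\<dots> \<le> K * measure lborel (frontier (W n) + cball 0 1)"
      by (intro K compact_frontier W)
    finally show ?thesis .
  qed
  have "(\<lambda>n. ?N n * ?D / ?V n) \<longlonglongrightarrow> 1"
  proof (rule tendsto_sandwich)
    have "(\<lambda>n. measure lborel (frontier (W n) + cball 0 1) / ?V n) \<longlonglongrightarrow> 0"
      using assms by (simp add: VH_growing_def)
    from tendsto_diff[OF tendsto_const tendsto_mult_right_zero[OF this, of K], of 1]
    show "(\<lambda>n. 1 - K * (measure lborel (frontier (W n) + cball 0 1) / ?V n)) \<longlonglongrightarrow> 1" by simp
    show "\<forall>\<^sub>F n in sequentially. 1 - K * (measure lborel (frontier (W n) + cball 0 1) / ?V n) \<le> ?N n * ?D / ?V n"
    proof (intro always_eventually allI)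
      fix n
      have "?V n \<le> ?N n * ?D + K * measure lborel (frontier (W n) + cball 0 1)" using ge[of n] by simp
      then have "?V n / ?V n \<le> (?N n * ?D + K * measure lborel (frontier (W n) + cball 0 1)) / ?V n"
        using W(2)[of n] by (intro divide_right_mono) auto
      then show "1 - K * (measure lborel (frontier (W n) + cball 0 1) / ?V n) \<le> ?N n * ?D / ?V n"
        using W(2)[of n] by (simp add: add_divide_distrib)
    qed
    show "\<forall>\<^sub>F n in sequentially. ?N n * ?D / ?V n \<le> 1"
      using le W(2) by (auto intro!: always_eventually simp: divide_le_eq)
  qed simp
  from tendsto_mult[OF this tendsto_const[of "1 / ?D"]] m
  show "(\<lambda>n. ?N n / ?V n) \<longlonglongrightarrow> 1 / ?D" by (simp add: field_simps)
qed

section \<open>Characteristic functions of normal limits\<close>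

lemma normal_distribution_real_distribution:
  assumes "v \<ge> 0"
  shows "real_distribution (normal_distribution 0 v)"
proof (cases "v = 0")
  case True
  then show ?thesis
    by (auto simp: normal_distribution_def real_distribution_def real_distribution_axioms_def
        intro: prob_space_return)
next
  case False
  then show ?thesis
    using assms prob_space_normal_density[of "sqrt v" 0]
    by (auto simp: normal_distribution_def real_distribution_def real_distribution_axioms_def)
qed

lemma char_normal_distribution:
  assumes "v \<ge> 0"
  shows "char (normal_distribution 0 v) t = of_real (exp (- (t\<^sup>2 * v / 2)))"
proof (cases "v = 0")
  case True
  then show ?thesis by (simp add: normal_distribution_def char_def integral_return)
next
  case False
  then have v: "sqrt v > 0" using assms by simp
  interpret N: prob_space std_normal_distribution by (rule prob_space_normal_density) simp
  have "distributed std_normal_distribution lborel (\<lambda>x. x) std_normal_density"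
    by (simp add: distributed_def distr_id2)
  from N.normal_density_affine[OF this, of "sqrt v" 0] v
  have "distributed std_normal_distribution lborel (\<lambda>x. sqrt v * x) (normal_density 0 (sqrt v))" by simp
  then have "normal_distribution 0 v = distr std_normal_distribution lborel (\<lambda>x. sqrt v * x)"
    using False by (simp add: distributed_def normal_distribution_def)
  then have "char (normal_distribution 0 v) t = (CLINT x|std_normal_distribution. iexp (t * (sqrt v * x)))"
    unfolding char_def by (simp add: integral_distr)
  also have "\<dots> = char std_normal_distribution (t * sqrt v)"
    by (simp add: char_def mult.assoc)
  also have "\<dots> = of_real (exp (- (t\<^sup>2 * v / 2)))"
    using assms by (simp add: char_std_normal_distribution power_mult_distrib)
  finally show ?thesis .
qed

lemma exp_minus_bounds:
  fixes y :: real
  assumes "y \<ge> 0"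
  shows "\<bar>exp (- y) - (1 - y)\<bar> \<le> y\<^sup>2"
proof -
  have "1 + y \<le> exp y" by (rule exp_ge_add_one_self)
  then have "exp (- y) * (1 + y) \<le> exp (- y) * exp y" by (intro mult_left_mono) auto
  then have 1: "exp (- y) * (1 + y) \<le> 1" by (simp add: exp_minus)
  \<comment> \<open>The elementary bound \<open>1 / (1 + y) \<le> 1 - y + y\<^sup>2\<close>.\<close>
  have "1 \<le> (1 - y + y\<^sup>2) * (1 + y)"
  proof -
    have "(1 - y + y\<^sup>2) * (1 + y) = 1 + y ^ 3" by (simp add: algebra_simps power2_eq_square power3_eq_cube)
    then show ?thesis using assms by simp
  qed
  with 1 have "exp (- y) * (1 + y) \<le> (1 - y + y\<^sup>2) * (1 + y)" by linarith
  then have "exp (- y) \<le> 1 - y + y\<^sup>2" using assms by (simp add: mult_le_cancel_right)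
  moreover have "1 - y \<le> exp (- y)" using exp_ge_add_one_self[of "- y"] by simp
  ultimately show ?thesis by simp
qed

text \<open>
  The analytic core of the classical central limit theorem, for numbers of summands \<open>N n\<close> and scales
  \<open>a n\<close> that are not tied to each other by \<open>N n = n\<close>. Both the characteristic function and the Gaussian
  agree with \<open>1 - t\<^sup>2 v / 2\<close> up to \<open>o(t\<^sup>2)\<close>, and powers of numbers in the unit disc differ by at most
  the exponent times the difference of the bases.
\<close>

lemma (in prob_space) char_power_tendsto:
  fixes Y :: "'a \<Rightarrow> real" and N :: "nat \<Rightarrow> nat" and a :: "nat \<Rightarrow> real"
  assumes int: "integrable M Y" "integrable M (\<lambda>\<omega>. (Y \<omega>)\<^sup>2)" and mean: "expectation Y = 0"
    and v: "expectation (\<lambda>\<omega>. (Y \<omega>)\<^sup>2) = v"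
    and a: "a \<longlonglongrightarrow> 0" and N: "(\<lambda>n. real (N n) * (a n)\<^sup>2) \<longlonglongrightarrow> q"
  shows "(\<lambda>n. (\<integral>\<omega>. iexp (a n * Y \<omega>) \<partial>M) ^ N n) \<longlonglongrightarrow> of_real (exp (- (q * v / 2)))"
proof -
  have [measurable]: "Y \<in> borel_measurable M" using int(1) by auto
  define \<phi> where "\<phi> t = (\<integral>\<omega>. iexp (t * Y \<omega>) \<partial>M)" for t
  define g where "g t = expectation (\<lambda>\<omega>. min (6 * (Y \<omega>)\<^sup>2) (\<bar>t\<bar> * \<bar>Y \<omega>\<bar> ^ 3))" for t
  define e where "e t = (of_real (exp (- (t\<^sup>2 * v / 2))) :: complex)" for t
  interpret D: real_distribution "distr M borel Y" by (rule real_distribution_distr) simp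
  have \<phi>: "char (distr M borel Y) t = \<phi> t" for t
    unfolding char_def \<phi>_def by (simp add: integral_distr)
  have v0: "v \<ge> 0" using v by auto
  have \<phi>1: "cmod (\<phi> t) \<le> 1" for t using D.cmod_char_le_1[of t] by (simp add: \<phi>)
  have e1: "cmod (e t) \<le> 1" for t using v0 by (simp add: e_def)
  have approx: "cmod (\<phi> t - e t) \<le> t\<^sup>2 * (g t / 6 + t\<^sup>2 * v\<^sup>2 / 4)" for t
  proof -
    have "cmod (\<phi> t - (1 - t\<^sup>2 * v / 2)) \<le> t\<^sup>2 / 6 * g t"
      using char_approx3'[OF _ int mean _ refl, of v t] v mean by (simp add: \<phi> g_def)
    moreover have "cmod ((1 - t\<^sup>2 * v / 2) - e t) \<le> (t\<^sup>2 * v / 2)\<^sup>2"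
    proof -
      have "(1 - t\<^sup>2 * v / 2) - e t = of_real ((1 - t\<^sup>2 * v / 2) - exp (- (t\<^sup>2 * v / 2)))" by (simp add: e_def)
      then have "cmod ((1 - t\<^sup>2 * v / 2) - e t) = \<bar>(1 - t\<^sup>2 * v / 2) - exp (- (t\<^sup>2 * v / 2))\<bar>"
        by (simp only: norm_of_real)
      also have "\<dots> \<le> (t\<^sup>2 * v / 2)\<^sup>2"
        using exp_minus_bounds[of "t\<^sup>2 * v / 2"] v0 by (simp add: abs_minus_commute)
      finally show ?thesis .
    qed
    ultimately have "cmod (\<phi> t - e t) \<le> t\<^sup>2 / 6 * g t + (t\<^sup>2 * v / 2)\<^sup>2"
      using norm_triangle_ineq[of "\<phi> t - (1 - t\<^sup>2 * v / 2)" "(1 - t\<^sup>2 * v / 2) - e t"] by simp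
    also have "\<dots> = t\<^sup>2 * (g t / 6 + t\<^sup>2 * v\<^sup>2 / 4)" by (simp add: field_simps power2_eq_square)
    finally show ?thesis .
  qed
  have g_lim: "(\<lambda>n. g (a n)) \<longlonglongrightarrow> 0"
  proof -
    have "(\<lambda>n. g (a n)) \<longlonglongrightarrow> expectation (\<lambda>_. 0)"
      unfolding g_def
    proof (rule integral_dominated_convergence[where w="\<lambda>\<omega>. 6 * (Y \<omega>)\<^sup>2"])
      show "AE \<omega> in M. (\<lambda>n. min (6 * (Y \<omega>)\<^sup>2) (\<bar>a n\<bar> * \<bar>Y \<omega>\<bar> ^ 3)) \<longlonglongrightarrow> 0"
      proof (intro AE_I2)
        fix \<omega>
        have "(\<lambda>n. \<bar>a n\<bar> * \<bar>Y \<omega>\<bar> ^ 3) \<longlonglongrightarrow> 0"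
          using tendsto_mult_left_zero[OF tendsto_rabs_zero[OF a]] by simp
        from tendsto_min[OF tendsto_const this, of "6 * (Y \<omega>)\<^sup>2"]
        show "(\<lambda>n. min (6 * (Y \<omega>)\<^sup>2) (\<bar>a n\<bar> * \<bar>Y \<omega>\<bar> ^ 3)) \<longlonglongrightarrow> 0" by (simp add: min_absorb2)
      qed
    qed (use int in auto)
    then show ?thesis by simp
  qed
  have "(\<lambda>n. \<phi> (a n) ^ N n - e (a n) ^ N n) \<longlonglongrightarrow> 0"
  proof (rule Lim_null_comparison)
    show "\<forall>\<^sub>F n in sequentially. norm (\<phi> (a n) ^ N n - e (a n) ^ N n)
        \<le> (real (N n) * (a n)\<^sup>2) * (g (a n) / 6 + (a n)\<^sup>2 * v\<^sup>2 / 4)"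
    proof (intro always_eventually allI)
      fix n
      have "norm (\<phi> (a n) ^ N n - e (a n) ^ N n) \<le> N n * cmod (\<phi> (a n) - e (a n))"
        by (rule norm_power_diff[OF \<phi>1 e1])
      also have "\<dots> \<le> N n * ((a n)\<^sup>2 * (g (a n) / 6 + (a n)\<^sup>2 * v\<^sup>2 / 4))"
        by (intro mult_left_mono approx) simp
      finally show "norm (\<phi> (a n) ^ N n - e (a n) ^ N n)
        \<le> (real (N n) * (a n)\<^sup>2) * (g (a n) / 6 + (a n)\<^sup>2 * v\<^sup>2 / 4)" by (simp add: mult.assoc)
    qed
    have "(\<lambda>n. (real (N n) * (a n)\<^sup>2) * (g (a n) / 6 + (a n)\<^sup>2 * v\<^sup>2 / 4)) \<longlonglongrightarrow> q * (0 / 6 + 0\<^sup>2 * v\<^sup>2 / 4)"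
      by (intro tendsto_intros N g_lim a) auto
    then show "(\<lambda>n. (real (N n) * (a n)\<^sup>2) * (g (a n) / 6 + (a n)\<^sup>2 * v\<^sup>2 / 4)) \<longlonglongrightarrow> 0" by simp
  qed
  moreover have "(\<lambda>n. e (a n) ^ N n) \<longlonglongrightarrow> of_real (exp (- (q * v / 2)))"
  proof -
    have "e (a n) ^ N n = of_real (exp (- ((real (N n) * (a n)\<^sup>2) * v / 2)))" for n
      by (simp add: e_def of_real_power[symmetric] exp_of_nat_mult[symmetric] algebra_simps del: of_real_power)
    then show ?thesis by (auto intro!: tendsto_intros N)
  qed
  ultimately show ?thesis
    unfolding \<phi>_def by (rule Lim_transform[rotated])
qed

lemma (in prob_space) abs_expectation_le_sqrt:
  fixes Y :: "'a \<Rightarrow> real"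
  assumes "integrable M Y" "integrable M (\<lambda>\<omega>. (Y \<omega>)\<^sup>2)"
  shows "(\<integral>\<omega>. \<bar>Y \<omega>\<bar> \<partial>M) \<le> sqrt (\<integral>\<omega>. (Y \<omega>)\<^sup>2 \<partial>M)"
proof (rule real_le_rsqrt)
  have "0 \<le> variance (\<lambda>\<omega>. \<bar>Y \<omega>\<bar>)" by simp
  also have "\<dots> = (\<integral>\<omega>. (Y \<omega>)\<^sup>2 \<partial>M) - (\<integral>\<omega>. \<bar>Y \<omega>\<bar> \<partial>M)\<^sup>2"
    using assms by (subst variance_eq) auto
  finally show "(\<integral>\<omega>. \<bar>Y \<omega>\<bar> \<partial>M)\<^sup>2 \<le> (\<integral>\<omega>. (Y \<omega>)\<^sup>2 \<partial>M)" by simp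
qed

section \<open>The central limit theorem\<close>

context BL_field begin

lemma mean_fluctuation:
  assumes A: "bounded A" "A \<in> sets borel"
  shows "(\<integral>\<omega>. fluctuation A \<omega> \<partial>M) = 0"
proof -
  have B': "A \<in> sets lborel" "emeasure lborel A < \<infinity>" using A emeasure_bounded_finite[OF A(1)] by auto
  have jm: "(\<lambda>(\<omega>, t). centered t \<omega>) \<in> borel_measurable (M \<Otimes>\<^sub>M lborel)"
    by (simp add: split_beta')
  have [measurable]: "fluctuation A \<in> borel_measurable M" using integrable_fluctuation[OF A] by auto
  have bd: "(\<integral>\<omega>. \<bar>centered t \<omega>\<bar> \<partial>M) \<le> sqrt (autocov 0)" for t
    using abs_expectation_le_sqrt[OF integrable_centered square_integrable_centered, of t] autocov_eq[of t t]
    by (simp add: power2_eq_square)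
  note f = lborel.sigma_finite_measure_axioms jm B' integrable_centered bd
  have "(\<integral>\<omega>. fluctuation A \<omega> \<partial>M) = (\<integral>\<omega>. (LINT t:A|lborel. centered t \<omega>) \<partial>M)"
    using integrable_set_integral[OF f] fluctuation_eq_centered[OF A] by (intro integral_cong_AE) auto
  also have "\<dots> = 0" by (simp add: expectation_set_integral[OF f])
  finally show ?thesis .
qed

lemma expectation_iexp_block:
  assumes rm: "r \<le> m"
  shows "(\<integral>\<omega>. iexp (u * fluctuation (block m r z) \<omega>) \<partial>M) = (\<integral>\<omega>. iexp (u * fluctuation (block m r 0) \<omega>) \<partial>M)"
proof -
  define h where "h = (\<chi> i. real m * of_int (z $ i))"
  have "t + h \<in> block m r z \<longleftrightarrow> t \<in> block m r 0" for t
    by (simp add: mem_block h_def)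
  from field_integral_translate[OF this sets_block]
  have "(\<integral>\<omega>. iexp (u * (field_integral 0 (block m r z) \<omega> - mean * (real m - real r) ^ CARD('d))) \<partial>M)
     = (\<integral>\<omega>. iexp (u * (field_integral h (block m r 0) \<omega> - mean * (real m - real r) ^ CARD('d))) \<partial>M)"
    by (intro Bochner_Integration.integral_cong refl) simp
  also have "\<dots> = (\<integral>\<omega>. iexp (u * (field_integral 0 (block m r 0) \<omega> - mean * (real m - real r) ^ CARD('d))) \<partial>M)"
    by (intro expectation_iexp_shift bounded_block sets_block aligned_block rm)
  finally show ?thesis using rm by (simp add: fluctuation_def measure_block)
qed

text \<open>
  Discarding a part of the window is controlled by the standard deviation of the discarded integral,
  which is at most the square root of its volume times the integral of the absolute autocovariance.
\<close>

lemma fluctuation_increment_bound: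
  assumes C: "integrable lborel autocov" and A: "bounded A" "A \<in> sets borel" and B: "B \<in> sets borel" "B \<subseteq> A"
  shows "cmod ((\<integral>\<omega>. iexp (u * fluctuation A \<omega>) \<partial>M) - (\<integral>\<omega>. iexp (u * fluctuation B \<omega>) \<partial>M))
    \<le> \<bar>u\<bar> * sqrt ((measure lborel A - measure lborel B) * (\<integral>h. \<bar>autocov h\<bar> \<partial>lborel))"
proof -
  let ?D = "A - B"
  have Bb: "bounded B" using A(1) B(2) by (rule bounded_subset)
  have D: "bounded ?D" "?D \<in> sets borel" using A B by auto
  have [measurable]: "fluctuation A \<in> borel_measurable M" "fluctuation B \<in> borel_measurable M"
    using integrable_fluctuation A B Bb by (auto intro!: borel_measurable_integrable)
  have AB: "AE \<omega> in M. fluctuation A \<omega> = fluctuation B \<omega> + fluctuation ?D \<omega>"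
  proof -
    have "B \<union> ?D = A" using B(2) by blast
    then show ?thesis using fluctuation_Un[OF Bb B(1) D] by auto
  qed
  have "(\<integral>\<omega>. iexp (u * fluctuation A \<omega>) \<partial>M) - (\<integral>\<omega>. iexp (u * fluctuation B \<omega>) \<partial>M)
      = (\<integral>\<omega>. iexp (u * fluctuation A \<omega>) - iexp (u * fluctuation B \<omega>) \<partial>M)"
    by (rule Bochner_Integration.integral_diff[symmetric]; rule integrable_iexp_real; measurable)
  also have "cmod \<dots> \<le> (\<integral>\<omega>. cmod (iexp (u * fluctuation A \<omega>) - iexp (u * fluctuation B \<omega>)) \<partial>M)"
    by (rule integral_norm_bound)
  also have "\<dots> \<le> (\<integral>\<omega>. \<bar>u\<bar> * \<bar>fluctuation ?D \<omega>\<bar> \<partial>M)"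
  proof (rule integral_mono_AE)
    show "integrable M (\<lambda>\<omega>. cmod (iexp (u * fluctuation A \<omega>) - iexp (u * fluctuation B \<omega>)))"
      by (intro integrable_norm Bochner_Integration.integrable_diff integrable_iexp_real) measurable
    show "integrable M (\<lambda>\<omega>. \<bar>u\<bar> * \<bar>fluctuation ?D \<omega>\<bar>)" using integrable_fluctuation[OF D] by auto
    show "AE \<omega> in M. cmod (iexp (u * fluctuation A \<omega>) - iexp (u * fluctuation B \<omega>)) \<le> \<bar>u\<bar> * \<bar>fluctuation ?D \<omega>\<bar>"
      using AB
    proof eventually_elim
      fix \<omega> assume "fluctuation A \<omega> = fluctuation B \<omega> + fluctuation ?D \<omega>"
      then have "u * fluctuation A \<omega> - u * fluctuation B \<omega> = u * fluctuation ?D \<omega>" by (simp add: algebra_simps)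
      with norm_iexp_diff[of "u * fluctuation A \<omega>" "u * fluctuation B \<omega>"]
      show "cmod (iexp (u * fluctuation A \<omega>) - iexp (u * fluctuation B \<omega>)) \<le> \<bar>u\<bar> * \<bar>fluctuation ?D \<omega>\<bar>" by (simp only: abs_mult)
    qed
  qed
  also have "\<dots> = \<bar>u\<bar> * (\<integral>\<omega>. \<bar>fluctuation ?D \<omega>\<bar> \<partial>M)" by simp
  also have "\<dots> \<le> \<bar>u\<bar> * sqrt ((measure lborel A - measure lborel B) * (\<integral>h. \<bar>autocov h\<bar> \<partial>lborel))"
  proof (rule mult_left_mono)
    have "(\<integral>\<omega>. \<bar>fluctuation ?D \<omega>\<bar> \<partial>M) \<le> sqrt (\<integral>\<omega>. (fluctuation ?D \<omega>)\<^sup>2 \<partial>M)"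
      by (intro abs_expectation_le_sqrt integrable_fluctuation square_integrable_fluctuation D C)
    also have "\<dots> \<le> sqrt (measure lborel ?D * (\<integral>h. \<bar>autocov h\<bar> \<partial>lborel))"
      using second_moment_fluctuation[OF D C] window_variance_le[OF D C] by simp
    also have "measure lborel ?D = measure lborel A - measure lborel B"
      using A B emeasure_bounded_finite[OF A(1)] by (intro measure_Diff) auto
    finally show "(\<integral>\<omega>. \<bar>fluctuation ?D \<omega>\<bar> \<partial>M) \<le> sqrt ((measure lborel A - measure lborel B) * (\<integral>h. \<bar>autocov h\<bar> \<partial>lborel))" .
  qed simp
  finally show ?thesis .
qed

lemma variance_block_tendsto:
  assumes C: "integrable lborel autocov"
  shows "(\<lambda>m. window_variance (block m r 0 :: (real ^ 'd) set) / real m ^ CARD('d)) \<longlonglongrightarrow> (\<integral>h. autocov h \<partial>lborel)"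
proof -
  have eq: "block m r 0 = cube (real m - real r)" for m
    by (simp add: block_def zero_vec_def)
  have "(\<lambda>m. window_variance (cube (real m - real r)) / (real m - real r) ^ CARD('d) * ((real m - real r) / real m) ^ CARD('d))
     \<longlonglongrightarrow> (\<integral>h. autocov h \<partial>lborel) * 1 ^ CARD('d)"
  proof (intro tendsto_mult tendsto_power variance_cube_tendsto C)
    show "filterlim (\<lambda>m. real m - real r) at_top sequentially" by real_asymp
    show "(\<lambda>m. (real m - real r) / real m) \<longlonglongrightarrow> 1" by real_asymp
  qed
  moreover have "\<forall>\<^sub>F m in sequentially. window_variance (cube (real m - real r)) / (real m - real r) ^ CARD('d) * ((real m - real r) / real m) ^ CARD('d)
      = window_variance (block m r 0 :: (real ^ 'd) set) / real m ^ CARD('d)"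
    using eventually_gt_at_top[of r] by eventually_elim (simp add: eq power_divide)
  ultimately show ?thesis by (simp add: tendsto_cong)
qed

lemma limit_variance_nonneg:
  assumes C: "integrable lborel autocov"
  shows "0 \<le> (\<integral>h. autocov h \<partial>lborel)"
proof (rule LIMSEQ_le_const[OF variance_block_tendsto[OF C, of 0]])
  have "0 \<le> window_variance (block m 0 0 :: (real ^ 'd) set)" for m
    using second_moment_fluctuation[OF bounded_block sets_block C, of m 0 0]
    by (metis integral_nonneg_AE AE_I2 zero_le_power2)
  then show "\<exists>N. \<forall>m\<ge>N. 0 \<le> window_variance (block m 0 0 :: (real ^ 'd) set) / real m ^ CARD('d)" by simp
qed

text \<open>
  The error that remains after \<open>n\<close> has tended to infinity. The three terms come from the corridors
  between the blocks, from the dependence between different blocks, and from the difference between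
  the variance of a block and its limit.
\<close>

definition block_error :: "real \<Rightarrow> nat \<Rightarrow> nat \<Rightarrow> real" where
  "block_error u m r =
     \<bar>u\<bar> * sqrt ((1 - ((real m - real r) / real m) ^ CARD('d)) * (\<integral>h. \<bar>autocov h\<bar> \<partial>lborel)) + 4 * u\<^sup>2 * \<theta> r
     + \<bar>exp (- (u\<^sup>2 * (window_variance (block m r 0) / real m ^ CARD('d)) / 2)) - exp (- (u\<^sup>2 * (\<integral>h. autocov h \<partial>lborel) / 2))\<bar>"

text \<open>
  The order of the choices matters: \<open>r\<close> makes the dependence term small for all \<open>m\<close> at once, and a
  large \<open>m\<close> then makes the corridors negligible.
\<close>

lemma block_error_small:
  assumes C: "integrable lborel autocov" and e: "e > 0"
  obtains m r where "r \<ge> 1" "r < m" "block_error u m r < e"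
proof -
  have "(\<lambda>r. 4 * u\<^sup>2 * \<theta> r) \<longlonglongrightarrow> 4 * u\<^sup>2 * 0" by (intro tendsto_intros theta_lim)
  then have "\<forall>\<^sub>F r in sequentially. 4 * u\<^sup>2 * \<theta> r < e" using e by (intro order_tendstoD(2)[where a=e]) auto
  with eventually_ge_at_top[of 1] have "\<forall>\<^sub>F r in sequentially. 1 \<le> r \<and> 4 * u\<^sup>2 * \<theta> r < e"
    by eventually_elim auto
  then obtain r where r: "r \<ge> 1" "4 * u\<^sup>2 * \<theta> r < e"
    by (auto simp: eventually_sequentially)
  have "(\<lambda>m. (real m - real r) / real m) \<longlonglongrightarrow> 1" by real_asymp
  then have "(\<lambda>m. block_error u m r) \<longlonglongrightarrow> \<bar>u\<bar> * sqrt ((1 - 1 ^ CARD('d)) * (\<integral>h. \<bar>autocov h\<bar> \<partial>lborel)) + 4 * u\<^sup>2 * \<theta> r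
     + \<bar>exp (- (u\<^sup>2 * (\<integral>h. autocov h \<partial>lborel) / 2)) - exp (- (u\<^sup>2 * (\<integral>h. autocov h \<partial>lborel) / 2))\<bar>"
    unfolding block_error_def by (intro tendsto_intros variance_block_tendsto C) auto
  then have "\<forall>\<^sub>F m in sequentially. block_error u m r < e"
    using r(2) by (intro order_tendstoD(2)) auto
  with eventually_gt_at_top[of r] have "\<forall>\<^sub>F m in sequentially. r < m \<and> block_error u m r < e"
    by eventually_elim auto
  then obtain m where "r < m" "block_error u m r < e" by (auto simp: eventually_sequentially)
  with r(1) show thesis by (rule that)
qed

text \<open>
  The characteristic function of the normalised fluctuation is compared first with that of the
  blocks only (\<open>b1\<close>), then with a power of the characteristic function of one block (\<open>b2\<close>), and
  finally with the Gaussian limit of this power (\<open>b3\<close>).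
\<close>

lemma char_fluctuation_tendsto:
  fixes W :: "nat \<Rightarrow> (real ^ 'd) set"
  assumes C: "integrable lborel autocov" and VH: "VH_growing W"
  defines "V \<equiv> \<lambda>n. measure lborel (W n)"
  shows "(\<lambda>n. \<integral>\<omega>. iexp (u / sqrt (V n) * fluctuation (W n) \<omega>) \<partial>M)
     \<longlonglongrightarrow> of_real (exp (- (u\<^sup>2 * (\<integral>h. autocov h \<partial>lborel) / 2)))"
proof (rule tendstoI)
  fix e :: real assume e: "e > 0"
  let ?l = "of_real (exp (- (u\<^sup>2 * (\<integral>h. autocov h \<partial>lborel) / 2))) :: complex"
  obtain m r where r: "r \<ge> 1" and rm: "r < m" and err: "block_error u m r < e"
    by (rule block_error_small[OF C e])
  have W: "compact (W n)" "0 < V n" for n using VH by (auto simp: VH_growing_def V_def)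
  have Wb: "bounded (W n)" "W n \<in> sets borel" for n
    using W(1) by (auto intro: compact_imp_bounded borel_compact)
  have m: "m \<ge> 1" using rm by simp
  let ?D = "CARD('d)"
  let ?S = "\<lambda>n. inner_blocks m (W n)" and ?B = "block m r :: _ \<Rightarrow> (real ^ 'd) set"
  let ?U = "\<lambda>n. \<Union>z\<in>?S n. ?B z"
  let ?a = "\<lambda>n. u / sqrt (V n)"
  define v where "v = window_variance (?B 0)"
  define \<phi> where "\<phi> t = (\<integral>\<omega>. iexp (t * fluctuation (?B 0) \<omega>) \<partial>M)" for t
  have fin: "finite (?S n)" for n by (intro finite_inner_blocks m Wb)
  have Us: "?U n \<subseteq> W n" for n using block_subset by (fastforce simp: inner_blocks_def)
  have Um: "?U n \<in> sets borel" for n using fin by (auto intro!: sets.finite_UN sets_block)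
  have U: "measure lborel (?U n) = card (?S n) * (real m - real r) ^ ?D" for n
    using fin rm by (intro measure_union_blocks) auto
  have dens: "(\<lambda>n. card (?S n) / V n) \<longlonglongrightarrow> 1 / real m ^ ?D"
    unfolding V_def by (rule VH_block_density(2)[OF VH m])
  \<comment> \<open>Hence the sum of the decorrelation errors over all blocks is bounded independently of \<open>n\<close>.\<close>
  have card_le: "card (?S n) * (real m - real r) ^ ?D \<le> V n" for n
  proof -
    have "(real m - real r) ^ ?D \<le> real m ^ ?D" using rm by (intro power_mono) auto
    then have "card (?S n) * (real m - real r) ^ ?D \<le> card (?S n) * real m ^ ?D" by (intro mult_left_mono) auto
    also have "\<dots> \<le> V n" unfolding V_def by (rule VH_block_density(1)[OF VH m])
    finally show ?thesis .
  qed
  have a2: "(?a n)\<^sup>2 = u\<^sup>2 / V n" for n using W(2)[of n] by (simp add: power_divide)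
  let ?c = "\<integral>h. \<bar>autocov h\<bar> \<partial>lborel"
  have b1: "cmod ((\<integral>\<omega>. iexp (?a n * fluctuation (W n) \<omega>) \<partial>M) - (\<integral>\<omega>. iexp (?a n * fluctuation (?U n) \<omega>) \<partial>M))
     \<le> \<bar>u\<bar> * sqrt ((1 - card (?S n) / V n * (real m - real r) ^ ?D) * ?c)" for n
  proof -
    have "\<bar>?a n\<bar> * sqrt ((V n - measure lborel (?U n)) * ?c) = \<bar>u\<bar> * sqrt ((V n - measure lborel (?U n)) * ?c / V n)"
      using W(2)[of n] by (simp add: real_sqrt_divide abs_divide)
    also have "(V n - measure lborel (?U n)) * ?c / V n = (1 - card (?S n) / V n * (real m - real r) ^ ?D) * ?c"
      using W(2)[of n] unfolding U by (simp add: field_simps)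
    finally show ?thesis
      using fluctuation_increment_bound[OF C Wb[of n] Um[of n] Us[of n], of "?a n"] by (simp add: V_def)
  qed
  have \<phi>1: "cmod (\<phi> t) \<le> 1" for t
  proof -
    have [measurable]: "fluctuation (?B 0) \<in> borel_measurable M"
      using integrable_fluctuation[OF bounded_block sets_block] by (rule borel_measurable_integrable)
    have "cmod (\<phi> t) \<le> (\<integral>\<omega>. cmod (iexp (t * fluctuation (?B 0) \<omega>)) \<partial>M)" unfolding \<phi>_def by (rule integral_norm_bound)
    also have "\<dots> = 1" by (simp add: prob_space)
    finally show ?thesis .
  qed
  have b2: "cmod ((\<integral>\<omega>. iexp (?a n * fluctuation (?U n) \<omega>) \<partial>M) - \<phi> (?a n) ^ card (?S n)) \<le> 4 * u\<^sup>2 * \<theta> r" for n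
  proof -
    have "cmod ((\<integral>\<omega>. iexp (?a n * fluctuation (?U n) \<omega>) \<partial>M) - \<phi> (?a n) ^ card (?S n))
        \<le> card (?S n) * (4 * (?a n)\<^sup>2 * (real m - real r) ^ ?D * \<theta> r)"
    proof (rule char_separated_union)
      show "(\<integral>\<omega>. iexp (?a n * fluctuation (?B z) \<omega>) \<partial>M) = \<phi> (?a n)" for z
        unfolding \<phi>_def using rm by (intro expectation_iexp_block) simp
      show "measure lborel (?B z) = (real m - real r) ^ ?D" for z using rm by (intro measure_block) simp
      show "aligned (?B z)" for z using rm by (intro aligned_block) simp
      show "real r \<le> l1_norm (x - y)" if "z \<noteq> z'" "x \<in> ?B z" "y \<in> ?B z'" for z z' x y
        by (rule block_separated[OF that])
    qed (use fin r \<phi>1 in \<open>auto intro: bounded_block sets_block\<close>)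
    also have "\<dots> = (card (?S n) * (real m - real r) ^ ?D / V n) * (4 * u\<^sup>2 * \<theta> r)"
      unfolding a2 by simp
    also have "\<dots> \<le> 1 * (4 * u\<^sup>2 * \<theta> r)"
      using card_le W(2)[of n] theta_nonneg by (intro mult_right_mono) (auto simp: divide_le_eq)
    finally show ?thesis by simp
  qed
  have b3: "(\<lambda>n. \<phi> (?a n) ^ card (?S n)) \<longlonglongrightarrow> of_real (exp (- (u\<^sup>2 * (v / real m ^ ?D) / 2)))"
  proof -
    have "filterlim (\<lambda>n. sqrt (V n)) at_top sequentially"
      unfolding V_def by (rule filterlim_compose[OF sqrt_at_top VH_volume_at_top[OF VH]])
    then have "?a \<longlonglongrightarrow> 0"
      by (intro tendsto_divide_0[OF tendsto_const] filterlim_at_top_imp_at_infinity)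
    moreover have "(\<lambda>n. card (?S n) * (?a n)\<^sup>2) \<longlonglongrightarrow> 1 / real m ^ ?D * u\<^sup>2"
      using tendsto_mult[OF dens tendsto_const[of "u\<^sup>2"]] unfolding a2 by simp
    ultimately have "(\<lambda>n. \<phi> (?a n) ^ card (?S n)) \<longlonglongrightarrow> of_real (exp (- (1 / real m ^ ?D * u\<^sup>2 * v / 2)))"
      unfolding \<phi>_def v_def
      by (intro char_power_tendsto integrable_fluctuation square_integrable_fluctuation second_moment_fluctuation mean_fluctuation bounded_block sets_block C)
    then show ?thesis by (simp add: algebra_simps)
  qed
  let ?err = "\<lambda>n. \<bar>u\<bar> * sqrt ((1 - card (?S n) / V n * (real m - real r) ^ ?D) * ?c) + 4 * u\<^sup>2 * \<theta> r
      + cmod (\<phi> (?a n) ^ card (?S n) - ?l)"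
  have "?err \<longlonglongrightarrow> \<bar>u\<bar> * sqrt ((1 - 1 / real m ^ ?D * (real m - real r) ^ ?D) * ?c) + 4 * u\<^sup>2 * \<theta> r
      + cmod (of_real (exp (- (u\<^sup>2 * (v / real m ^ ?D) / 2))) - ?l)"
    by (intro tendsto_intros dens b3)
  also have "\<bar>u\<bar> * sqrt ((1 - 1 / real m ^ ?D * (real m - real r) ^ ?D) * ?c) + 4 * u\<^sup>2 * \<theta> r
      + cmod (of_real (exp (- (u\<^sup>2 * (v / real m ^ ?D) / 2))) - ?l) = block_error u m r"
    unfolding block_error_def v_def of_real_diff[symmetric] norm_of_real by (simp add: power_divide)
  finally have "\<forall>\<^sub>F n in sequentially. ?err n < e" using err by (intro order_tendstoD(2))
  then show "\<forall>\<^sub>F n in sequentially. dist (\<integral>\<omega>. iexp (?a n * fluctuation (W n) \<omega>) \<partial>M) ?l < e"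
  proof eventually_elim
    fix n assume le: "?err n < e"
    have tri: "cmod (w - z) \<le> cmod (w - x) + cmod (x - y) + cmod (y - z)" for w x y z :: complex
      using norm_triangle_ineq[of "w - x" "x - z"] norm_triangle_ineq[of "x - y" "y - z"] by simp
    show "dist (\<integral>\<omega>. iexp (?a n * fluctuation (W n) \<omega>) \<partial>M) ?l < e"
      unfolding dist_norm
      using tri[of "\<integral>\<omega>. iexp (?a n * fluctuation (W n) \<omega>) \<partial>M" ?l "\<integral>\<omega>. iexp (?a n * fluctuation (?U n) \<omega>) \<partial>M" "\<phi> (?a n) ^ card (?S n)"]
        b1[of n] b2[of n] le by linarith
  qed
qed

end

theorem theorem1:
  fixes M :: "'w measure"
    and X :: "real ^ 'd \<Rightarrow> 'w \<Rightarrow> real"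
    and \<theta> :: "nat \<Rightarrow> real"
    and W :: "nat \<Rightarrow> (real ^ 'd) set"
    and \<sigma>2 :: real
  assumes "decseq \<theta>" and "\<theta> \<longlonglongrightarrow> 0"
    and "random_field M X"
    and "measurable_field M X"
    and "stationary_field M X"
    and "BL_dependent M \<theta> X"
    and "integrable M (\<lambda>\<omega>. (X 0 \<omega>)\<^sup>2)"
    and "integrable lborel (\<lambda>t. covariance M (X 0) (X t))"
    and "VH_growing W"
  defines "\<sigma>2 \<equiv> (\<integral>t. covariance M (X 0) (X t) \<partial>lborel)"
  shows "0 \<le> \<sigma>2 \<and>
    weak_conv_m
      (\<lambda>n. distr M borel (\<lambda>\<omega>.
         ((LINT t:W n|lborel. X t \<omega>) - (\<integral>\<omega>'. X 0 \<omega>' \<partial>M) * measure lborel (W n))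
           / sqrt (measure lborel (W n))))
      (normal_distribution 0 \<sigma>2)"
proof -
  interpret prob_space M using assms(3) by (simp add: random_field_def)
  interpret BL_field M X \<theta> using assms by unfold_locales auto
  have C: "integrable lborel autocov" using assms(8) by (simp add: autocov_def[abs_def])
  have \<sigma>2: "\<sigma>2 = (\<integral>h. autocov h \<partial>lborel)" by (simp add: \<sigma>2_def autocov_def)
  have nonneg: "0 \<le> \<sigma>2" unfolding \<sigma>2 by (rule limit_variance_nonneg[OF C])
  let ?V = "\<lambda>n. measure lborel (W n)"
  have Wb: "bounded (W n)" "W n \<in> sets borel" for n
    using assms(9) by (auto simp: VH_growing_def intro: compact_imp_bounded borel_compact)
  have [measurable]: "fluctuation (W n) \<in> borel_measurable M" for n
    using integrable_fluctuation[OF Wb] by (rule borel_measurable_integrable)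
  have eq: "(\<lambda>\<omega>. ((LINT t:W n|lborel. X t \<omega>) - (\<integral>\<omega>'. X 0 \<omega>' \<partial>M) * ?V n) / sqrt (?V n))
      = (\<lambda>\<omega>. fluctuation (W n) \<omega> / sqrt (?V n))" for n
    by (simp add: fluctuation_def field_integral_def)
  have "weak_conv_m (\<lambda>n. distr M borel (\<lambda>\<omega>. fluctuation (W n) \<omega> / sqrt (?V n))) (normal_distribution 0 \<sigma>2)"
  proof (rule levy_continuity)
    show "real_distribution (distr M borel (\<lambda>\<omega>. fluctuation (W n) \<omega> / sqrt (?V n)))" for n
      by (rule real_distribution_distr) simp
    show "real_distribution (normal_distribution 0 \<sigma>2)"
      by (rule normal_distribution_real_distribution[OF nonneg])
    fix u
    have "char (distr M borel (\<lambda>\<omega>. fluctuation (W n) \<omega> / sqrt (?V n))) u = (\<integral>\<omega>. iexp (u / sqrt (?V n) * fluctuation (W n) \<omega>) \<partial>M)" for n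
      unfolding char_def by (simp add: integral_distr)
    then show "(\<lambda>n. char (distr M borel (\<lambda>\<omega>. fluctuation (W n) \<omega> / sqrt (?V n))) u) \<longlonglongrightarrow> char (normal_distribution 0 \<sigma>2) u"
      using char_fluctuation_tendsto[OF C assms(9), of u] char_normal_distribution[OF nonneg, of u]
      by (simp add: \<sigma>2)
  qed
  with nonneg show ?thesis unfolding eq by blast
qed

end
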